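(* Let $X$ be a $\delta$-hyperbolic graph and let $G$ be a group acting on $X$ by isometries. Suppose that the action is nonelementary and that there exist independent hyperbolic elements $g_1,g_2\in G$ such that $g_1\not\sim g_2$. Then the real vector space $\widetilde{QH}(G)$ is infinite dimensional.
   Context: Quasi-homomorphisms. For a discrete group $G$, a quasi-homomorphism is a function $h:G\to\mathbb R$ with $\sup_{\gamma_1,\gamma_2\in G}|h(\gamma_1\gamma_2)-h(\gamma_1)-h(\gamma_2)|<\infty$. Let $\mathcal V(G)$ be the real vector space of all quasi-homomorphisms on $G$, $BDD(G)$ the subspace of bounded functions, $HOM(G)$ the subspace of homomorphisms $G\to\mathbb R$. Define $\widetilde{QH}(G)=\mathcal V(G)/(BDD(G)+HOM(G))$ (it is isomorphic to the kernel of $H^2_b(G;\mathbb R)\to H^2(G;\mathbb R)$). Hyperbolic graphs. $X$ is a connected graph with the path metric $d$ in which each edge has length 1; it is $\delta$-hyperbolic if for any three geodesic arcs $\alpha,\beta,\gamma$ forming a triangle, $\alpha$ is contained in the $\delta$-neighborhood of $\beta\cup\gamma$. A $(K,L)$-quasi-geodesic is a map $\phi$ of a (finite or infinite) interval into $X$ with $\frac1K|s-t|-L\le d(\phi(s),\phi(t))\le K|s-t|+L$. We often identify it with its image. $B(K,L,\delta)$ denotes a constant such that any two finite $(K,L)$-quasi-geodesics with common endpoints are within $B(K,L,\delta)$ of each other, and any two bi-infinite $(K,L)$-quasi-geodesics at finite distance from each other are within $B(K,L,\delta)$ of each other. Hyperbolic elements. An isometry $g$ of $X$ is hyperbolic if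 it admits an invariant bi-infinite quasi-geodesic along which $g$ acts as a nontrivial translation; such a $(K,L)$-quasi-geodesic is called a $(K,L)$-quasi-axis of $g$. The $g$-orientation of a quasi-axis is the one for which $g$ acts as a positive translation. More generally, a sufficiently long $(K,L)$-quasi-geodesic arc $J$ inside the $B(K,L,\delta)$-neighborhood of a $(K,L)$-quasi-axis $\ell$ of $g$ has a $g$-orientation: the one for which a point of $\ell$ within $B(K,L,\delta)$ of the terminal endpoint of $J$ is ahead (in the $g$-orientation of $\ell$) of a point of $\ell$ within $B(K,L,\delta)$ of the initial endpoint. The relation $\sim$. For hyperbolic $g_1,g_2\in G$, fix $(K,L)$ so that both have $(K,L)$-quasi-axes. Write $g_1\sim g_2$ if for arbitrarily long segments $J$ in a $(K,L)$-quasi-axis of $g_1$ there is $g\in G$ such that $g(J)$ is within $B(K,L,\delta)$ of a $(K,L)$-quasi-axis of $g_2$ and $g:J\to g(J)$ is orientation-preserving with respect to the $g_1$-orientation on $J$ and the $g_2$-orientation on $g(J)$. This is an equivalence relation, independent of the choice of $(K,L)$. The action of $G$ on $X$ is nonelementary if there exist at least two hyperbolic elements of $G$ whose $(K,L)$-quasi-axes do not contain rays within finite distance of each other; two such hyperbolic elements are called independent. *)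

theory Defs
  imports
    "HOL-Analysis.Analysis"
    "HOL-Algebra.Module"
    "HOL-Algebra.AbelCoset"
    "HOL-Algebra.Group_Action"
begin

section \<open>Quasi-homomorphisms and the vector space QH\<close>

definition real_ring :: "real ring"
  where "real_ring = \<lparr>carrier = UNIV, mult = (*), one = 1, zero = 0, add = (+)\<rparr>"

definition quotient_module ::
    "('r, 'a, 'm) module_scheme \<Rightarrow> 'a set \<Rightarrow> ('r, 'a set) module"
  where "quotient_module M W =
    \<lparr>carrier = a_rcosets\<^bsub>M\<^esub> W,
     mult = undefined,
     one = undefined,
     zero = W,
     add = set_add M,
     smult = (\<lambda>r C. \<Union>x\<in>C. W +>\<^bsub>M\<^esub> (r \<odot>\<^bsub>M\<^esub> x))\<rparr>"

definition finite_dimensional ::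
    "('r, 's) ring_scheme \<Rightarrow> ('r, 'a, 'm) module_scheme \<Rightarrow> bool"
  where "finite_dimensional R M \<longleftrightarrow>
    (\<exists>A. finite A \<and> A \<subseteq> carrier M \<and>
      (\<forall>x\<in>carrier M. \<exists>c\<in>A \<rightarrow> carrier R. x = (\<Oplus>\<^bsub>M\<^esub>a\<in>A. c a \<odot>\<^bsub>M\<^esub> a)))"

text \<open>Real functions on a group are represented by functions on the carrier that are
  extensional, so that the representation is unique.\<close>

definition quasi_homs :: "('g, 'b) monoid_scheme \<Rightarrow> ('g \<Rightarrow> real) set"
  where "quasi_homs G = {h \<in> extensional (carrier G).
    \<exists>C. \<forall>x\<in>carrier G. \<forall>y\<in>carrier G. \<bar>h (x \<otimes>\<^bsub>G\<^esub> y) - h x - h y\<bar> \<le> C}"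

definition quasi_hom_space :: "('g, 'b) monoid_scheme \<Rightarrow> (real, 'g \<Rightarrow> real) module"
  where "quasi_hom_space G =
    \<lparr>carrier = quasi_homs G,
     mult = undefined,
     one = undefined,
     zero = (\<lambda>x\<in>carrier G. 0),
     add = (\<lambda>h k. \<lambda>x\<in>carrier G. h x + k x),
     smult = (\<lambda>r h. \<lambda>x\<in>carrier G. r * h x)\<rparr>"

definition bounded_functions :: "('g, 'b) monoid_scheme \<Rightarrow> ('g \<Rightarrow> real) set"
  where "bounded_functions G = {h \<in> extensional (carrier G).
    \<exists>C. \<forall>x\<in>carrier G. \<bar>h x\<bar> \<le> C}"

definition real_homs :: "('g, 'b) monoid_scheme \<Rightarrow> ('g \<Rightarrow> real) set"
  where "real_homs G = {h \<in> extensional (carrier G).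
    \<forall>x\<in>carrier G. \<forall>y\<in>carrier G. h (x \<otimes>\<^bsub>G\<^esub> y) = h x + h y}"

definition QH :: "('g, 'b) monoid_scheme \<Rightarrow> (real, ('g \<Rightarrow> real) set) module"
  where "QH G = quotient_module (quasi_hom_space G)
    (bounded_functions G <+>\<^bsub>quasi_hom_space G\<^esub> real_homs G)"

subsection \<open>QH is a real vector space\<close>

lemma cring_real_ring: "cring real_ring"
proof -
  have "\<exists>y. x + y = 0" for x :: real
    using add.right_inverse by blast
  then show ?thesis
    unfolding real_ring_def using add.right_inverse
    by unfold_locales (auto simp: algebra_simps Units_def)
qed

lemma quotient_module_is_module:
  fixes R (structure) and M (structure)
  assumes M: "module R M" and W: "submodule W R M"
  shows "module R (quotient_module M W)"
proof -
  interpret module R M by (rule M)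
  interpret W: abelian_subgroup W M
    using abelian_subgroupI2[OF a_comm_group] W submodule.axioms(1) by blast
  let ?Q = "quotient_module M W"
  have car: "carrier ?Q = (\<lambda>x. W +>\<^bsub>M\<^esub> x) ` carrier M"
    by (auto simp: quotient_module_def A_RCOSETS_def RCOSETS_def a_r_coset_def)
  have add: "(W +>\<^bsub>M\<^esub> x) \<oplus>\<^bsub>?Q\<^esub> (W +>\<^bsub>M\<^esub> y) = W +>\<^bsub>M\<^esub> (x \<oplus>\<^bsub>M\<^esub> y)"
    if "x \<in> carrier M" "y \<in> carrier M" for x y
    using W.a_rcos_sum[OF that] by (simp add: quotient_module_def)
  have eqI: "W +>\<^bsub>M\<^esub> y = W +>\<^bsub>M\<^esub> x" if "y \<in> W +>\<^bsub>M\<^esub> x" "x \<in> carrier M" for x y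
    using add.repr_independence[OF _ _ W.a_subgroup, of y x] that
    by (simp add: a_r_coset_def)
  have smult: "r \<odot>\<^bsub>?Q\<^esub> (W +>\<^bsub>M\<^esub> x) = W +>\<^bsub>M\<^esub> (r \<odot>\<^bsub>M\<^esub> x)"
    if r: "r \<in> carrier R" and x: "x \<in> carrier M" for r x
  proof -
    have const: "W +>\<^bsub>M\<^esub> (r \<odot>\<^bsub>M\<^esub> y) = W +>\<^bsub>M\<^esub> (r \<odot>\<^bsub>M\<^esub> x)" if "y \<in> W +>\<^bsub>M\<^esub> x" for y
    proof -
      obtain w where w: "w \<in> W" "y = w \<oplus>\<^bsub>M\<^esub> x"
        using \<open>y \<in> W +>\<^bsub>M\<^esub> x\<close> unfolding a_r_coset_def' by blast
      have wM: "w \<in> carrier M" using w W.a_subset by blast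
      have "r \<odot>\<^bsub>M\<^esub> y = (r \<odot>\<^bsub>M\<^esub> w) \<oplus>\<^bsub>M\<^esub> (r \<odot>\<^bsub>M\<^esub> x)"
        using w r x wM by (simp add: smult_r_distr)
      moreover have "r \<odot>\<^bsub>M\<^esub> w \<in> W"
        using submodule.smult_closed[OF W r w(1)] .
      ultimately have "r \<odot>\<^bsub>M\<^esub> y \<in> W +>\<^bsub>M\<^esub> (r \<odot>\<^bsub>M\<^esub> x)"
        by (auto simp: a_r_coset_def')
      then show ?thesis using eqI r x by simp
    qed
    have "r \<odot>\<^bsub>?Q\<^esub> (W +>\<^bsub>M\<^esub> x) = (\<Union>y\<in>W +>\<^bsub>M\<^esub> x. W +>\<^bsub>M\<^esub> (r \<odot>\<^bsub>M\<^esub> y))"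
      by (simp add: quotient_module_def)
    also have "\<dots> = W +>\<^bsub>M\<^esub> (r \<odot>\<^bsub>M\<^esub> x)"
      using const W.a_rcos_self[OF x] by blast
    finally show ?thesis .
  qed
  have zero: "\<zero>\<^bsub>?Q\<^esub> = W +>\<^bsub>M\<^esub> \<zero>\<^bsub>M\<^esub>"
    using add.coset_mult_one[OF W.a_subset] by (simp add: quotient_module_def a_r_coset_def)
  have grp: "abelian_group ?Q"
  proof (rule abelian_groupI)
    fix C assume "C \<in> carrier ?Q"
    then obtain x where x: "x \<in> carrier M" "C = W +>\<^bsub>M\<^esub> x" by (auto simp: car)
    then have "(W +>\<^bsub>M\<^esub> (\<ominus>\<^bsub>M\<^esub> x)) \<oplus>\<^bsub>?Q\<^esub> C = \<zero>\<^bsub>?Q\<^esub>"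
      by (simp add: add zero M.l_neg)
    moreover have "W +>\<^bsub>M\<^esub> (\<ominus>\<^bsub>M\<^esub> x) \<in> carrier ?Q" using x by (simp add: car)
    ultimately show "\<exists>D\<in>carrier ?Q. D \<oplus>\<^bsub>?Q\<^esub> C = \<zero>\<^bsub>?Q\<^esub>" by blast
  qed (auto simp: car add zero M.a_ac)
  show ?thesis
  proof (rule moduleI)
    show "cring R" by (rule is_cring)
    show "abelian_group ?Q" by (rule grp)
  qed (auto simp: car add smult smult_l_distr smult_r_distr smult_assoc1)
qed

context group
begin

lemma quasi_hom_space_module: "module real_ring (quasi_hom_space G)"
proof -
  let ?V = "quasi_hom_space G"
  have closed: "(\<lambda>x\<in>carrier G. a * h x + b * k x) \<in> quasi_homs G"
    if h: "h \<in> quasi_homs G" and k: "k \<in> quasi_homs G" for a b h k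
  proof -
    obtain C where C: "\<And>x y. x \<in> carrier G \<Longrightarrow> y \<in> carrier G \<Longrightarrow> \<bar>h (x \<otimes> y) - h x - h y\<bar> \<le> C"
      using h by (auto simp: quasi_homs_def)
    obtain D where D: "\<And>x y. x \<in> carrier G \<Longrightarrow> y \<in> carrier G \<Longrightarrow> \<bar>k (x \<otimes> y) - k x - k y\<bar> \<le> D"
      using k by (auto simp: quasi_homs_def)
    have "\<bar>(a * h (x \<otimes> y) + b * k (x \<otimes> y)) - (a * h x + b * k x) - (a * h y + b * k y)\<bar>
        \<le> \<bar>a\<bar> * C + \<bar>b\<bar> * D" if "x \<in> carrier G" "y \<in> carrier G" for x y
    proof -
      have "(a * h (x \<otimes> y) + b * k (x \<otimes> y)) - (a * h x + b * k x) - (a * h y + b * k y)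
          = a * (h (x \<otimes> y) - h x - h y) + b * (k (x \<otimes> y) - k x - k y)"
        by (simp add: algebra_simps)
      also have "\<bar>\<dots>\<bar> \<le> \<bar>a\<bar> * \<bar>h (x \<otimes> y) - h x - h y\<bar> + \<bar>b\<bar> * \<bar>k (x \<otimes> y) - k x - k y\<bar>"
        by (metis abs_mult abs_triangle_ineq)
      also have "\<dots> \<le> \<bar>a\<bar> * C + \<bar>b\<bar> * D"
        by (intro add_mono mult_left_mono C D that abs_ge_zero)
      finally show ?thesis .
    qed
    then show ?thesis by (auto simp: quasi_homs_def)
  qed
  have add_closed: "(\<lambda>x\<in>carrier G. h x + k x) \<in> quasi_homs G"
    if "h \<in> quasi_homs G" "k \<in> quasi_homs G" for h k
    using closed[OF that, of 1 1] by simp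
  have smult_closed: "(\<lambda>x\<in>carrier G. a * h x) \<in> quasi_homs G"
    if "h \<in> quasi_homs G" for a h
    using closed[OF that that, of a 0] by simp
  have zero: "(\<lambda>x\<in>carrier G. 0) \<in> quasi_homs G"
    by (auto simp: quasi_homs_def)
  have ext: "restrict h (carrier G) = h" if "h \<in> quasi_homs G" for h
    using that by (simp add: quasi_homs_def extensional_restrict)
  show ?thesis
  proof (rule moduleI)
    show "cring real_ring" by (rule cring_real_ring)
    show "abelian_group ?V"
    proof (rule abelian_groupI)
      fix h assume h: "h \<in> carrier ?V"
      show "\<exists>k\<in>carrier ?V. k \<oplus>\<^bsub>?V\<^esub> h = \<zero>\<^bsub>?V\<^esub>"
        using h smult_closed[of h "-1"]
        by (intro bexI[of _ "\<lambda>x\<in>carrier G. -1 * h x"])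
          (auto simp: quasi_hom_space_def fun_eq_iff)
    next
      fix h assume h: "h \<in> carrier ?V"
      then show "\<zero>\<^bsub>?V\<^esub> \<oplus>\<^bsub>?V\<^esub> h = h"
        using ext[of h] by (auto simp: quasi_hom_space_def restrict_def cong: if_cong)
    qed (auto simp: quasi_hom_space_def add_closed zero fun_eq_iff)
  qed (auto simp: quasi_hom_space_def real_ring_def fun_eq_iff algebra_simps ext
      intro!: smult_closed)
qed

lemma QH_submodule:
  "submodule (bounded_functions G <+>\<^bsub>quasi_hom_space G\<^esub> real_homs G) real_ring (quasi_hom_space G)"
proof -
  let ?V = "quasi_hom_space G"
  let ?W = "bounded_functions G <+>\<^bsub>?V\<^esub> real_homs G"
  interpret V: module real_ring ?V by (rule quasi_hom_space_module)
  have W: "?W = {\<lambda>x\<in>carrier G. b x + h x | b h. b \<in> bounded_functions G \<and> h \<in> real_homs G}"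
    by (auto simp: set_add_def set_mult_def quasi_hom_space_def)
  have real_homs: "(\<lambda>x\<in>carrier G. a * h x + b * k x) \<in> real_homs G"
    if "h \<in> real_homs G" "k \<in> real_homs G" for a b h k
    using that by (auto simp: real_homs_def algebra_simps)
  have bounded: "(\<lambda>x\<in>carrier G. a * h x + b * k x) \<in> bounded_functions G"
    if h: "h \<in> bounded_functions G" and k: "k \<in> bounded_functions G" for a b h k
  proof -
    obtain C where C: "\<And>x. x \<in> carrier G \<Longrightarrow> \<bar>h x\<bar> \<le> C"
      using h by (auto simp: bounded_functions_def)
    obtain D where D: "\<And>x. x \<in> carrier G \<Longrightarrow> \<bar>k x\<bar> \<le> D"
      using k by (auto simp: bounded_functions_def)
    have "\<bar>a * h x + b * k x\<bar> \<le> \<bar>a\<bar> * C + \<bar>b\<bar> * D" if "x \<in> carrier G" for x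
    proof -
      have "\<bar>a * h x + b * k x\<bar> \<le> \<bar>a\<bar> * \<bar>h x\<bar> + \<bar>b\<bar> * \<bar>k x\<bar>"
        by (metis abs_mult abs_triangle_ineq)
      also have "\<dots> \<le> \<bar>a\<bar> * C + \<bar>b\<bar> * D"
        by (intro add_mono mult_left_mono C D that abs_ge_zero)
      finally show ?thesis .
    qed
    then show ?thesis by (auto simp: bounded_functions_def)
  qed
  have comb: "(\<lambda>x\<in>carrier G. a * u x + b * v x) \<in> ?W" if u: "u \<in> ?W" and v: "v \<in> ?W" for a b u v
  proof -
    obtain p h where u: "u = (\<lambda>x\<in>carrier G. p x + h x)" "p \<in> bounded_functions G" "h \<in> real_homs G"
      using u unfolding W by blast
    obtain q k where v: "v = (\<lambda>x\<in>carrier G. q x + k x)" "q \<in> bounded_functions G" "k \<in> real_homs G"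
      using v unfolding W by blast
    show ?thesis unfolding W mem_Collect_eq
      by (rule exI[of _ "\<lambda>x\<in>carrier G. a * p x + b * q x"],
          rule exI[of _ "\<lambda>x\<in>carrier G. a * h x + b * k x"])
        (use bounded[OF u(2) v(2), of a b] real_homs[OF u(3) v(3), of a b] in
          \<open>auto simp: u(1) v(1) fun_eq_iff algebra_simps\<close>)
  qed
  have zero: "(\<lambda>x\<in>carrier G. 0) \<in> ?W"
    unfolding W mem_Collect_eq
    by (intro exI[of _ "\<lambda>x\<in>carrier G. 0"])
      (auto simp: bounded_functions_def real_homs_def fun_eq_iff)
  have b_sub: "bounded_functions G \<subseteq> carrier ?V"
  proof
    fix h assume h: "h \<in> bounded_functions G"
    then obtain C where C: "\<And>x. x \<in> carrier G \<Longrightarrow> \<bar>h x\<bar> \<le> C"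
      by (auto simp: bounded_functions_def)
    have "\<bar>h (x \<otimes> y) - h x - h y\<bar> \<le> 3 * C" if "x \<in> carrier G" "y \<in> carrier G" for x y
      using C[of "x \<otimes> y"] C[of x] C[of y] that by simp
    then show "h \<in> carrier ?V"
      using h by (auto simp: quasi_hom_space_def quasi_homs_def bounded_functions_def)
  qed
  have h_sub: "real_homs G \<subseteq> carrier ?V"
    by (auto simp: quasi_hom_space_def quasi_homs_def real_homs_def)
  have sub: "?W \<subseteq> carrier ?V" by (rule V.setadd_subset_G[OF b_sub h_sub])
  show ?thesis
  proof (rule V.submoduleI)
    show "?W \<subseteq> carrier ?V" by (rule sub)
    show "\<zero>\<^bsub>?V\<^esub> \<in> ?W" using zero by (simp add: quasi_hom_space_def)
    show add: "u \<oplus>\<^bsub>?V\<^esub> v \<in> ?W" if "u \<in> ?W" "v \<in> ?W" for u v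
      using comb[OF that, of 1 1] by (simp add: quasi_hom_space_def)
    show sm: "r \<odot>\<^bsub>?V\<^esub> u \<in> ?W" if "r \<in> carrier real_ring" "u \<in> ?W" for r u
      using comb[OF that(2) that(2), of r 0] by (simp add: quasi_hom_space_def)
    show "\<ominus>\<^bsub>?V\<^esub> u \<in> ?W" if u: "u \<in> ?W" for u
    proof -
      have m: "- 1 \<in> carrier real_ring" by (simp add: real_ring_def)
      have uV: "u \<in> carrier ?V" using u sub by blast
      have "((- 1) \<odot>\<^bsub>?V\<^esub> u) \<oplus>\<^bsub>?V\<^esub> u = \<zero>\<^bsub>?V\<^esub>"
        by (auto simp: quasi_hom_space_def fun_eq_iff)
      then have "\<ominus>\<^bsub>?V\<^esub> u = (- 1) \<odot>\<^bsub>?V\<^esub> u"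
        using V.minus_equality V.smult_closed[OF m uV] uV by blast
      then show ?thesis using sm[OF m u] by simp
    qed
  qed
qed

theorem QH_module: "module real_ring (QH G)"
  unfolding QH_def
  by (rule quotient_module_is_module[OF quasi_hom_space_module QH_submodule])

end


section \<open>Hyperbolic graphs\<close>

text \<open>The whole type \<^typ>\<open>'a\<close> is the geometric realization of a graph with vertex set \<open>V\<close>; an edge
  is given by its characteristic map on \<open>{0..1}\<close>. Loops and multiple edges are allowed.\<close>

inductive piecewise_linear_path ::
    "(real \<Rightarrow> 'a) set \<Rightarrow> 'a \<Rightarrow> 'a \<Rightarrow> real \<Rightarrow> bool" for E where
  refl: "piecewise_linear_path E x x 0"
| step: "piecewise_linear_path E x (e s) r \<Longrightarrow> e \<in> E \<Longrightarrow> s \<in> {0..1} \<Longrightarrow> t \<in> {0..1} \<Longrightarrow>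
    piecewise_linear_path E x (e t) (r + \<bar>s - t\<bar>)"

definition connected_metric_graph :: "'a::metric_space set \<Rightarrow> (real \<Rightarrow> 'a) set \<Rightarrow> bool"
  where "connected_metric_graph V E \<longleftrightarrow>
    (\<forall>e\<in>E. e 0 \<in> V \<and> e 1 \<in> V \<and> inj_on e {0<..<1} \<and> e ` {0<..<1} \<inter> V = {}) \<and>
    (\<forall>e\<in>E. \<forall>e'\<in>E. e \<noteq> e' \<longrightarrow> e ` {0<..<1} \<inter> e' ` {0<..<1} = {}) \<and>
    V \<union> (\<Union>e\<in>E. e ` {0<..<1}) = UNIV \<and>
    (\<forall>x y. (\<exists>r. piecewise_linear_path E x y r) \<and>
      dist x y = Inf {r. piecewise_linear_path E x y r})"

definition nbhd :: "real \<Rightarrow> 'a::metric_space set \<Rightarrow> 'a set"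
  where "nbhd r S = (\<Union>x\<in>S. cball x r)"

definition within_distance :: "real \<Rightarrow> 'a::metric_space set \<Rightarrow> 'a set \<Rightarrow> bool"
  where "within_distance r S T \<longleftrightarrow> S \<subseteq> nbhd r T \<and> T \<subseteq> nbhd r S"

definition geodesic_arc :: "'a::metric_space \<Rightarrow> 'a \<Rightarrow> 'a set \<Rightarrow> bool"
  where "geodesic_arc x y A \<longleftrightarrow>
    (\<exists>c. c 0 = x \<and> c (dist x y) = y \<and> A = c ` {0..dist x y} \<and>
      (\<forall>s\<in>{0..dist x y}. \<forall>t\<in>{0..dist x y}. dist (c s) (c t) = \<bar>s - t\<bar>))"

definition delta_hyperbolic :: "'a::metric_space itself \<Rightarrow> real \<Rightarrow> bool"
  where "delta_hyperbolic _ \<delta> \<longleftrightarrow>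
    (\<forall>(x::'a) y z \<alpha> \<beta> \<gamma>. geodesic_arc x y \<alpha> \<and> geodesic_arc y z \<beta> \<and> geodesic_arc z x \<gamma> \<longrightarrow>
      \<alpha> \<subseteq> nbhd \<delta> (\<beta> \<union> \<gamma>))"


section \<open>Quasi-geodesics and quasi-axes\<close>

definition quasi_geodesic ::
    "real \<Rightarrow> real \<Rightarrow> real set \<Rightarrow> (real \<Rightarrow> 'a::metric_space) \<Rightarrow> bool"
  where "quasi_geodesic K L I \<phi> \<longleftrightarrow> 1 \<le> K \<and> 0 \<le> L \<and> is_interval I \<and>
    (\<forall>s\<in>I. \<forall>t\<in>I. 1 / K * \<bar>s - t\<bar> - L \<le> dist (\<phi> s) (\<phi> t) \<and>
      dist (\<phi> s) (\<phi> t) \<le> K * \<bar>s - t\<bar> + L)"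

text \<open>The possible values of the constant \<open>B(K, L, \<delta>)\<close> for the space \<^typ>\<open>'a\<close>. They form an
  upward closed set.\<close>

definition stability_constant :: "'a::metric_space itself \<Rightarrow> real \<Rightarrow> real \<Rightarrow> real \<Rightarrow> bool"
  where "stability_constant _ K L B \<longleftrightarrow>
    (\<forall>(\<phi>::real \<Rightarrow> 'a) \<psi> a b c d. a \<le> b \<and> c \<le> d \<and>
      quasi_geodesic K L {a..b} \<phi> \<and> quasi_geodesic K L {c..d} \<psi> \<and> \<phi> a = \<psi> c \<and> \<phi> b = \<psi> d \<longrightarrow>
      within_distance B (\<phi> ` {a..b}) (\<psi> ` {c..d})) \<and>
    (\<forall>(\<phi>::real \<Rightarrow> 'a) \<psi>. quasi_geodesic K L UNIV \<phi> \<and> quasi_geodesic K L UNIV \<psi> \<and>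
      (\<exists>r. within_distance r (range \<phi>) (range \<psi>)) \<longrightarrow>
      within_distance B (range \<phi>) (range \<psi>))"

definition quasi_axis ::
    "real \<Rightarrow> real \<Rightarrow> ('a::metric_space \<Rightarrow> 'a) \<Rightarrow> (real \<Rightarrow> 'a) \<Rightarrow> bool"
  where "quasi_axis K L f l \<longleftrightarrow> quasi_geodesic K L UNIV l \<and>
    (\<exists>\<tau>. \<tau> \<noteq> 0 \<and> (\<forall>t. f (l t) = l (t + \<tau>)))"

text \<open>A quasi-axis parametrized compatibly with its \<open>f\<close>-orientation.\<close>

definition oriented_quasi_axis ::
    "real \<Rightarrow> real \<Rightarrow> ('a::metric_space \<Rightarrow> 'a) \<Rightarrow> (real \<Rightarrow> 'a) \<Rightarrow> bool"
  where "oriented_quasi_axis K L f l \<longleftrightarrow> quasi_geodesic K L UNIV l \<and>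
    (\<exists>\<tau>. \<tau> > 0 \<and> (\<forall>t. f (l t) = l (t + \<tau>)))"

definition hyperbolic :: "('a::metric_space \<Rightarrow> 'a) \<Rightarrow> bool"
  where "hyperbolic f \<longleftrightarrow> (\<exists>K L l. quasi_axis K L f l)"

definition rays :: "(real \<Rightarrow> 'a) \<Rightarrow> 'a set set"
  where "rays l = {l ` {a..} | a. True} \<union> {l ` {..a} | a. True}"

definition independent_isometries :: "('a::metric_space \<Rightarrow> 'a) \<Rightarrow> ('a \<Rightarrow> 'a) \<Rightarrow> bool"
  where "independent_isometries f g \<longleftrightarrow> hyperbolic f \<and> hyperbolic g \<and>
    (\<forall>K L l m. quasi_axis K L f l \<and> quasi_axis K L g m \<longrightarrow>
      (\<forall>r\<in>rays l. \<forall>s\<in>rays m. \<not> (\<exists>C. within_distance C r s)))"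


section \<open>Group actions\<close>

definition isometric_action ::
    "('g, 'b) monoid_scheme \<Rightarrow> ('g \<Rightarrow> 'a::metric_space \<Rightarrow> 'a) \<Rightarrow> bool"
  where "isometric_action G \<Phi> \<longleftrightarrow> group_action G UNIV \<Phi> \<and>
    (\<forall>g\<in>carrier G. \<forall>x y. dist (\<Phi> g x) (\<Phi> g y) = dist x y)"

definition nonelementary_action ::
    "('g, 'b) monoid_scheme \<Rightarrow> ('g \<Rightarrow> 'a::metric_space \<Rightarrow> 'a) \<Rightarrow> bool"
  where "nonelementary_action G \<Phi> \<longleftrightarrow>
    (\<exists>g\<in>carrier G. \<exists>h\<in>carrier G. independent_isometries (\<Phi> g) (\<Phi> h))"

text \<open>The orientation of a long arc \<open>\<phi>\<close> on \<open>{a..b}\<close> lying in the \<open>B\<close>-neighbourhood of the axis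
  \<open>l\<close>, where \<open>l\<close> is parametrized in the positive direction: \<open>\<phi>\<close> runs from its initial endpoint
  \<open>\<phi> a\<close> to its terminal endpoint \<open>\<phi> b\<close> in that orientation. For arcs that are long compared with
  \<open>B\<close>, any choice of \<open>s\<close> and \<open>t\<close> gives the same answer.\<close>

definition positively_oriented_along ::
    "real \<Rightarrow> (real \<Rightarrow> 'a::metric_space) \<Rightarrow> real \<Rightarrow> real \<Rightarrow> (real \<Rightarrow> 'a) \<Rightarrow> bool"
  where "positively_oriented_along B \<phi> a b l \<longleftrightarrow>
    (\<exists>s t. dist (l s) (\<phi> a) \<le> B \<and> dist (l t) (\<phi> b) \<le> B \<and> s < t)"

text \<open>The relation \<open>g\<^sub>1 \<sim> g\<^sub>2\<close>, for \<open>(K, L)\<close> such that both elements have \<open>(K, L)\<close>-quasi-axes. The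
  segment \<open>J\<close> is \<open>l\<^sub>1 ` {a..b}\<close>. The constant \<open>B\<close> does not depend on the length \<open>N\<close>; enlarging it
  only weakens the condition, so \<open>\<exists>B\<close> says that the condition holds for all large \<open>B\<close>.\<close>

definition axis_equivalent ::
    "('g, 'b) monoid_scheme \<Rightarrow> ('g \<Rightarrow> 'a::metric_space \<Rightarrow> 'a) \<Rightarrow> real \<Rightarrow> real \<Rightarrow> 'g \<Rightarrow> 'g \<Rightarrow> bool"
  where "axis_equivalent G \<Phi> K L g\<^sub>1 g\<^sub>2 \<longleftrightarrow>
    (\<exists>B. stability_constant TYPE('a) K L B \<and>
      (\<forall>N. \<exists>l\<^sub>1 l\<^sub>2 a b. \<exists>g\<in>carrier G.
        oriented_quasi_axis K L (\<Phi> g\<^sub>1) l\<^sub>1 \<and> oriented_quasi_axis K L (\<Phi> g\<^sub>2) l\<^sub>2 \<and>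
        a < b \<and> N \<le> b - a \<and>
        \<Phi> g ` l\<^sub>1 ` {a..b} \<subseteq> nbhd B (range l\<^sub>2) \<and>
        positively_oriented_along B (\<Phi> g \<circ> l\<^sub>1) a b l\<^sub>2))"

end

theory Submission
  imports Defs "HOL-Real_Asymp.Real_Asymp"
begin

text \<open>
  Fix a pair of points \<open>(p, q)\<close> and give every translate of it a discount \<open>W\<close>: the distance
  \<open>D x y\<close> is the infimum of the lengths of paths from \<open>x\<close> to \<open>y\<close>, minus \<open>W\<close> for each jump from
  \<open>g p\<close> to \<open>g q\<close>. If \<open>dist p q\<close> is at least \<open>2 * W + 1\<close>, near-minimal paths stay close to geodesics,
  so \<open>D\<close> is additive along geodesics up to a constant, and comparing the three sides of a triangle
  with its center shows that \<open>D v (g v) - D (g v) v\<close> is a quasi-homomorphism in \<open>g\<close>. Moreover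
  \<open>D x y\<close> is the original distance unless some translate of \<open>(p, q)\<close> runs, in the right direction,
  along the geodesic from \<open>x\<close> to \<open>y\<close>.

  Apply this to \<open>p = v\<close>, \<open>q = f i v\<close> with \<open>f i = g1 ^ a * g2 ^ b i * g1 ^ c * g2 ^ d\<close>. As \<open>g1\<close> and \<open>g2\<close>
  are independent, the orbit of \<open>v\<close> along powers of \<open>f i\<close> is a quasi-geodesic. As \<open>g1\<close> is not equivalent
  to \<open>g2\<close>, a transition between the two generators cannot lie in the middle of a long power of \<open>g1\<close>,
  \<open>g2\<close> or their inverses; hence exponents of suitable sizes prevent copies of \<open>f i\<close> along the axis of
  \<open>f j\<close>, \<open>j \<noteq> i\<close>, in either direction and along its own axis in the backward direction. So the \<open>i\<close>-th
  quasi-homomorphism grows linearly on the powers of \<open>f i\<close> and vanishes on those of the other \<open>f j\<close>.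
  Homomorphisms are detected by two spare words on which all the quasi-homomorphisms in question
  vanish.
\<close>

section \<open>Graphs as geodesic spaces\<close>

text \<open>The constants of \<open>mdist_almost_additive\<close> and \<open>mdist_less_dist\<close>
  are chosen after \<open>W\<close> but before the pair \<open>(p, q)\<close>. This breaks a circle:
  the exponents of a word have to be separated relative to the error \<open>e\<close>, while the
  word itself defines the pair that is discounted. So \<open>W\<close> comes first, then
  \<open>e\<close>, then the words. The value \<open>W = 2 * turn + 1\<close> comes from the growth
  estimate: a period of a word may lose \<open>2 * turn\<close> of length at its junction, while a
  jump saves \<open>W\<close>. The condition \<open>2 * W + 1 \<le> dist p q\<close> leaves every
  jump a cost of at least half its length. This keeps the new metric comparable with
  \<open>dist\<close>, and since jumps cost at least 1 it bounds the number of steps of near-minimal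
  chains, which is what the Morse argument needs. The new metric depends on the direction of travel;
  this asymmetry is all that the quasi-homomorphism records.\<close>

lemma piecewise_linear_path_nonneg: "piecewise_linear_path E x y r \<Longrightarrow> 0 \<le> r"
  by (induction rule: piecewise_linear_path.induct) auto

lemma piecewise_linear_path_attains_Inf:
  fixes E :: "(real \<Rightarrow> 'a::metric_space) set"
  assumes graph: "connected_metric_graph V E"
  shows "piecewise_linear_path E x y (dist x y)"
proof (cases "\<exists>e\<in>E. \<exists>s\<in>{0..1}. x = e s")
  case False
  have "y = x \<and> r = 0" if "piecewise_linear_path E x y r" for y r
    using that False
  proof (induction rule: piecewise_linear_path.induct)
    case (step x e s r t)
    then have "x = e s" by blast
    then show ?case using step.prems step.hyps by blast
  qed auto
  then have "y = x"
    using graph unfolding connected_metric_graph_def by meson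
  then show ?thesis by (simp add: piecewise_linear_path.refl)
next
  case True
  then obtain e0 s0 where e0: "e0 \<in> E" "0 \<le> s0" "s0 \<le> 1" "x = e0 s0" by auto
  have edges: "\<forall>e\<in>E. e 0 \<in> V \<and> e 1 \<in> V \<and> inj_on e {0<..<1} \<and> e ` {0<..<1} \<inter> V = {}"
    and disjoint: "\<forall>e\<in>E. \<forall>e'\<in>E. e \<noteq> e' \<longrightarrow> e ` {0<..<1} \<inter> e' ` {0<..<1} = {}"
    and dist: "\<forall>x y. (\<exists>r. piecewise_linear_path E x y r) \<and> dist x y = Inf {r. piecewise_linear_path E x y r}"
    using graph unfolding connected_metric_graph_def by - (elim conjE, assumption)+
  have ends: "e 0 \<in> V" "e 1 \<in> V" if "e \<in> E" for e
    using edges that by auto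
  have inner_not_V: "e t \<notin> V" if "e \<in> E" "0 < t" "t < 1" for e t
  proof -
    have "e ` {0<..<1} \<inter> V = {}" using edges that(1) by blast
    moreover have "e t \<in> e ` {0<..<1}" using that by auto
    ultimately show ?thesis by blast
  qed
  have inner_unique: "e = e' \<and> t = t'"
    if "e \<in> E" "e' \<in> E" "0 < t" "t < 1" "0 < t'" "t' < 1" "e t = e' t'" for e e' t t'
  proof -
    have "e = e'"
    proof (rule ccontr)
      assume "e \<noteq> e'"
      then have "e ` {0<..<1} \<inter> e' ` {0<..<1} = {}"
        using disjoint that(1,2) by blast
      moreover have "e t \<in> e ` {0<..<1}" "e' t' \<in> e' ` {0<..<1}" using that(3-6) by auto
      ultimately show False using that(7) by auto
    qed
    moreover have "inj_on e {0<..<1}"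
      using edges that(1) by blast
    ultimately show ?thesis using that(3-7) by (auto simp: inj_on_def)
  qed
  let ?P = "piecewise_linear_path E"
  \<comment> \<open>Leaving the initial edge through its two ends costs \<open>s0\<close> and
    \<open>1 - s0\<close>; whole edges follow until a vertex is reached.\<close>
  define D where "D = (\<lambda>r. \<exists>n::nat. r = n \<or> r = n + s0 \<or> r = n + (1 - s0))"
  define VR where "VR = (\<lambda>v r. v \<in> V \<and> ?P x v r \<and> D r)"
  define IR where "IR = (\<lambda>e t r. e \<in> E \<and> 0 < t \<and> t < 1 \<and>
    (VR (e 0) (r - t) \<or> VR (e 1) (r - (1 - t)) \<or> e = e0 \<and> r = \<bar>s0 - t\<bar>))"
  define Q where "Q = (\<lambda>y r. \<exists>r'\<le>r. VR y r' \<or> (\<exists>e t. y = e t \<and> IR e t r'))"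
  have VR_step: "VR (e t) (r + 1)" if "VR (e s) r" "e \<in> E" "s \<in> {0,1}" "t \<in> {0,1}" "s \<noteq> t" for e s t r
  proof -
    have "?P x (e t) (r + \<bar>s - t\<bar>)" using that by (intro piecewise_linear_path.step) (auto simp: VR_def)
    moreover have "\<bar>s - t\<bar> = 1" using that by auto
    moreover have "D (r + 1)" using that(1) unfolding VR_def D_def
      by (metis add.assoc add.commute of_nat_Suc)
    ultimately show ?thesis using that ends by (auto simp: VR_def)
  qed
  have D0: "D 0" "D s0" "D (1 - s0)" unfolding D_def by (metis of_nat_0 add_0)+
  have P0: "?P x (e0 t) \<bar>s0 - t\<bar>" if "0 \<le> t" "t \<le> 1" for t
    using piecewise_linear_path.step[OF _ e0(1), of x s0 0 t] e0 that piecewise_linear_path.refl[of E x] by auto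
  have v0: "VR (e0 0) s0" "VR (e0 1) (1 - s0)"
    using P0[of 0] P0[of 1] e0 ends D0 by (auto simp: VR_def)

  have Q_mono: "Q y r" if "Q y r1" "r1 \<le> r" for y r r1
  proof -
    obtain r' where "r' \<le> r1" "VR y r' \<or> (\<exists>e t. y = e t \<and> IR e t r')"
      using \<open>Q y r1\<close> unfolding Q_def by blast
    then show ?thesis using that(2) unfolding Q_def by (intro exI[of _ r']) auto
  qed
  have from_vertex: "Q (e t) (\<rho> + \<bar>t - a\<bar>)"
    if "VR (e a) \<rho>" "e \<in> E" "a \<in> {0,1}" "0 \<le> t" "t \<le> 1" for e t a \<rho>
  proof (cases "0 < t \<and> t < 1")
    case True
    then have "IR e t (\<rho> + \<bar>t - a\<bar>)" using that by (auto simp: IR_def)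
    then show ?thesis unfolding Q_def by blast
  next
    case False
    then have "t = 0 \<or> t = 1" using that by auto
    then have "VR (e t) (\<rho> + \<bar>t - a\<bar>)"
      using that VR_step[of e a \<rho> t] by (cases "a = t") auto
    then show ?thesis unfolding Q_def by blast
  qed
  have direct: "Q (e0 t) \<bar>s0 - t\<bar>" if "0 \<le> t" "t \<le> 1" for t
  proof (cases "0 < t \<and> t < 1")
    case True
    then have "IR e0 t \<bar>s0 - t\<bar>" using e0 by (auto simp: IR_def)
    then show ?thesis unfolding Q_def by blast
  next
    case False
    then have "t = 0 \<or> t = 1" using that by auto
    then have "VR (e0 t) \<bar>s0 - t\<bar>" using v0 e0 by auto
    then show ?thesis unfolding Q_def by blast
  qed

  have main: "Q y r" if "?P x' y r" "x' = x" for x' y r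
    using that
  proof (induction rule: piecewise_linear_path.induct)
    case (refl x')
    then show ?case using direct[of s0] e0 by simp
  next
    case (step x' e s r t)
    then obtain r' where r': "r' \<le> r" "VR (e s) r' \<or> (\<exists>e1 s1. e s = e1 s1 \<and> IR e1 s1 r')"
      unfolding Q_def by blast
    \<comment> \<open>However \<open>e s\<close> was reached, the route came from an end of
      \<open>e\<close> or from the start on \<open>e0\<close>. Going from there straight to
      \<open>e t\<close> is no longer than passing through \<open>e s\<close>.\<close>
    have "(\<exists>a\<in>{0,1}. \<exists>\<rho>. VR (e a) \<rho> \<and> \<rho> + \<bar>s - a\<bar> = r') \<or> e = e0 \<and> r' = \<bar>s0 - s\<bar>"
    proof (cases "0 < s \<and> s < 1")
      case True
      then have "\<not> VR (e s) r'" using inner_not_V[OF step.hyps(2)] by (auto simp: VR_def)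
      then obtain e1 s1 where e1: "e s = e1 s1" "IR e1 s1 r'" using r' by blast
      moreover have "e1 \<in> E" "0 < s1" "s1 < 1" using e1(2) by (simp_all add: IR_def)
      then have "e = e1 \<and> s = s1"
        using inner_unique[of e e1 s s1] True step.hyps(2) e1(1) by blast
      ultimately have "IR e s r'" by simp
      then consider "VR (e 0) (r' - s)" | "VR (e 1) (r' - (1 - s))" | "e = e0 \<and> r' = \<bar>s0 - s\<bar>"
        by (auto simp: IR_def)
      then show ?thesis
      proof cases
        case 1
        then show ?thesis using True by (intro disjI1 bexI[of _ 0] exI[of _ "r' - s"]) auto
      next
        case 2
        then show ?thesis using True by (intro disjI1 bexI[of _ 1] exI[of _ "r' - (1 - s)"]) auto
      qed auto
    next
      case False
      then have s: "s = 0 \<or> s = 1" using step.hyps by auto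
      then have "e s \<in> V" using ends step.hyps by auto
      then have "VR (e s) r'" using r'(2) inner_not_V unfolding IR_def by fastforce
      then show ?thesis using s by auto
    qed
    then show ?case
    proof
      assume "\<exists>a\<in>{0,1}. \<exists>\<rho>. VR (e a) \<rho> \<and> \<rho> + \<bar>s - a\<bar> = r'"
      then obtain a \<rho> where a: "a \<in> {0,1}" "VR (e a) \<rho>" "\<rho> + \<bar>s - a\<bar> = r'" by blast
      have "Q (e t) (\<rho> + \<bar>t - a\<bar>)" using from_vertex a step.hyps by auto
      moreover have "\<rho> + \<bar>t - a\<bar> \<le> r + \<bar>s - t\<bar>" using a r' by linarith
      ultimately show ?thesis by (rule Q_mono)
    next
      assume a: "e = e0 \<and> r' = \<bar>s0 - s\<bar>"
      then have "Q (e t) \<bar>s0 - t\<bar>" using direct step.hyps by auto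
      moreover have "\<bar>s0 - t\<bar> \<le> r + \<bar>s - t\<bar>" using a r' by linarith
      ultimately show ?thesis by (rule Q_mono)
    qed
  qed
  define R where "R = (\<lambda>r. VR y r \<or> (\<exists>e t. y = e t \<and> IR e t r))"
  have R_path: "?P x y r" if "R r" for r
  proof -
    consider "VR y r" | e t where "y = e t" "IR e t r" using \<open>R r\<close> unfolding R_def by blast
    then show ?thesis
    proof cases
      case 2
      note et = 2
      then consider "VR (e 0) (r - t)" | "VR (e 1) (r - (1 - t))" | "e = e0 \<and> r = \<bar>s0 - t\<bar>"
        by (auto simp: IR_def)
      then show ?thesis
      proof cases
        case 1
        then show ?thesis using et piecewise_linear_path.step[of E x e 0 "r - t" t] by (auto simp: IR_def VR_def)
      next
        case 2
        then show ?thesis using et piecewise_linear_path.step[of E x e 1 "r - (1 - t)" t] by (auto simp: IR_def VR_def)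
      next
        case 3
        then show ?thesis using et P0[of t] by (auto simp: IR_def)
      qed
    qed (auto simp: VR_def)
  qed
  \<comment> \<open>If \<open>y\<close> lies inside an edge, its parameter is unique; for a vertex
    any \<open>t0\<close> will do.\<close>
  obtain t0 where t0: "t = t0" if "y = e t" "IR e t r" for e t r
  proof (cases "\<exists>e t r. y = e t \<and> IR e t r")
    case True
    then obtain e t r where et: "y = e t" "IR e t r" by blast
    have "t' = t" if "y = e' t'" "IR e' t' r'" for e' t' r'
    proof -
      have "e' \<in> E" "0 < t'" "t' < 1" "e \<in> E" "0 < t" "t < 1" "e' t' = e t"
        using that et by (simp_all add: IR_def)
      then show ?thesis using inner_unique by blast
    qed
    then show ?thesis using that by blast
  qed (use that in blast)
  \<comment> \<open>Each offset for leaving the edge of \<open>x\<close> is combined with each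
    offset for entering the edge of \<open>y\<close>; the last element is the direct route inside
    one edge.\<close>
  define C where "C = (\<lambda>(a,b). a + b) ` ({0, s0, 1 - s0} \<times> {0, t0, 1 - t0}) \<union> {\<bar>s0 - t0\<bar>}"
  have R_disc: "\<exists>c\<in>C. \<exists>n::nat. r = n + c" if "R r" for r
  proof -
    have D: "\<exists>c\<in>C. \<exists>n::nat. r = n + c" if "D (r - b)" "b \<in> {0, t0, 1 - t0}" for r b
    proof -
      obtain n :: nat and a :: real where "r - b = n + a" "a \<in> {0, s0, 1 - s0}"
        using \<open>D (r - b)\<close> unfolding D_def by (metis add.right_neutral insertCI)
      then have "r = n + (a + b)" "a + b \<in> C" using that(2) unfolding C_def by (auto simp: image_iff)
      then show ?thesis by blast
    qed
    show ?thesis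
    proof (cases "VR y r")
      case True
      then show ?thesis using D[of r 0] by (auto simp: VR_def)
    next
      case False
      then obtain e where "IR e t0 r" using \<open>R r\<close> t0 unfolding R_def by blast
      then consider "D (r - t0)" | "D (r - (1 - t0))" | "r = \<bar>s0 - t0\<bar>" by (auto simp: IR_def VR_def)
      then show ?thesis
      proof cases
        case 3
        then have "r = of_nat 0 + \<bar>s0 - t0\<bar>" "\<bar>s0 - t0\<bar> \<in> C" by (auto simp: C_def)
        then show ?thesis by blast
      qed (use D in auto)
    qed
  qed
  obtain r0 where "?P x y r0" using dist by blast
  then obtain r1 where r1: "R r1" "r1 \<le> r0" using main unfolding Q_def R_def by blast
  define S where "S = {r. R r \<and> r \<le> r1}"
  have finC: "finite C" by (auto simp: C_def)
  define b where "b = (\<Sum>c\<in>C. \<bar>c\<bar>)"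
  have "S \<subseteq> (\<lambda>(n::nat, c). n + c) ` ({..nat \<lceil>r1 + b\<rceil>} \<times> C)"
  proof
    fix r assume r: "r \<in> S"
    then have "R r" by (simp add: S_def)
    then obtain c and n :: nat where c: "c \<in> C" "r = of_nat n + c" using R_disc by blast
    have "\<bar>c\<bar> \<le> b" unfolding b_def using c finC by (intro member_le_sum) auto
    then have "n \<le> nat \<lceil>r1 + b\<rceil>" using r c unfolding S_def by simp linarith
    then show "r \<in> (\<lambda>(n::nat, c). n + c) ` ({..nat \<lceil>r1 + b\<rceil>} \<times> C)" using c by auto
  qed
  then have finS: "finite S" using finC by (meson finite_SigmaI finite_atMost finite_imageI finite_subset)
  have "S \<noteq> {}" using r1 by (auto simp: S_def)
  then have min: "Min S \<in> S" "\<And>r. r \<in> S \<Longrightarrow> Min S \<le> r" using finS by auto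
  have "Min S \<le> r" if "?P x y r" for r
  proof -
    obtain r' where "R r'" "r' \<le> r" using main[OF \<open>?P x y r\<close> HOL.refl] unfolding Q_def R_def by blast
    then show ?thesis using min(2)[of r'] min(2)[of r1] r1 by (cases "r' \<le> r1") (auto simp: S_def)
  qed
  then have "Inf {r. ?P x y r} = Min S"
    using R_path min(1) by (intro cInf_eq_minimum) (auto simp: S_def)
  then have "dist x y = Min S" using dist by simp
  then show ?thesis using R_path min(1) by (auto simp: S_def)
qed

text \<open>The Gromov product of \<open>x\<close> and \<open>y\<close> at \<open>w\<close>: in a
  hyperbolic space it is, up to a constant, the distance from \<open>w\<close> to a geodesic from
  \<open>x\<close> to \<open>y\<close>.\<close>

definition gp :: "'a::metric_space \<Rightarrow> 'a \<Rightarrow> 'a \<Rightarrow> real"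
  where "gp w x y = (dist w x + dist w y - dist x y) / 2"

definition geodesic_curve :: "(real \<Rightarrow> 'a::metric_space) \<Rightarrow> 'a \<Rightarrow> 'a \<Rightarrow> bool"
  where "geodesic_curve c x y \<longleftrightarrow> c 0 = x \<and> c (dist x y) = y \<and>
    (\<forall>s\<in>{0..dist x y}. \<forall>t\<in>{0..dist x y}. dist (c s) (c t) = \<bar>s - t\<bar>)"

lemma geodesic_curve_arc: "geodesic_curve c x y \<Longrightarrow> geodesic_arc x y (c ` {0..dist x y})"
  unfolding geodesic_arc_def geodesic_curve_def by blast

lemma geodesic_curve_on:
  assumes "geodesic_curve c x y" "0 \<le> t" "t \<le> dist x y"
  shows "dist x (c t) = t" "dist (c t) y = dist x y - t"
proof -
  have c: "dist (c u) (c v) = \<bar>u - v\<bar>" if "u \<in> {0..dist x y}" "v \<in> {0..dist x y}" for u v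
    using assms(1) that unfolding geodesic_curve_def by blast
  have "dist (c 0) (c t) = t" "dist (c t) (c (dist x y)) = dist x y - t"
    using assms(2,3) by (simp_all add: c)
  moreover have "c 0 = x" "c (dist x y) = y" using assms(1) unfolding geodesic_curve_def by auto
  ultimately show "dist x (c t) = t" "dist (c t) y = dist x y - t" by simp_all
qed

lemma piecewise_linear_path_curve:
  assumes graph: "connected_metric_graph V E" and "piecewise_linear_path E x y r"
  shows "\<exists>c. c 0 = x \<and> c r = y \<and> (\<forall>s\<in>{0..r}. \<forall>t\<in>{0..r}. dist (c s) (c t) \<le> \<bar>s - t\<bar>)"
  using assms(2)
proof (induction rule: piecewise_linear_path.induct)
  case (refl x)
  then show ?case by (auto intro!: exI[of _ "\<lambda>_. x"])
next
  case (step x e s r t)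
  have dist_le: "dist a b \<le> r" if "piecewise_linear_path E a b r" for a b r
  proof -
    have "bdd_below {r. piecewise_linear_path E a b r}"
      using piecewise_linear_path_nonneg by (intro bdd_belowI[of _ 0]) auto
    then have "Inf {r. piecewise_linear_path E a b r} \<le> r" using that by (intro cInf_lower) auto
    then show ?thesis using graph unfolding connected_metric_graph_def by simp
  qed
  have edge: "dist (e u) (e v) \<le> \<bar>u - v\<bar>" if "u \<in> {0..1}" "v \<in> {0..1}" for u v
    using piecewise_linear_path.step[OF piecewise_linear_path.refl, of e E u v] that step.hyps
    by (intro dist_le) auto
  have r: "0 \<le> r" using step.hyps(1) by (rule piecewise_linear_path_nonneg)
  obtain c where c: "c 0 = x" "c r = e s"
    and cd: "\<And>u v. 0 \<le> u \<Longrightarrow> u \<le> r \<Longrightarrow> 0 \<le> v \<Longrightarrow> v \<le> r \<Longrightarrow> dist (c u) (c v) \<le> \<bar>u - v\<bar>"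
    using step.IH by auto
  \<comment> \<open>\<open>f\<close> runs along the new edge from \<open>s\<close> towards
    \<open>t\<close> at unit speed, starting at time \<open>r\<close>.\<close>
  define f where "f = (\<lambda>u. if s \<le> t then s + (u - r) else s - (u - r))"
  define c' where "c' = (\<lambda>u. if u \<le> r then c u else e (f u))"
  have f: "f u \<in> {0..1}" "\<bar>f u - f v\<bar> = \<bar>u - v\<bar>" "f r = s"
    if "r \<le> u" "u \<le> r + \<bar>s - t\<bar>" for u v
    using that step.hyps by (auto simp: f_def split: if_splits)
  have c'2: "c' u = e (f u)" if "r \<le> u" "u \<le> r + \<bar>s - t\<bar>" for u
    using that c(2) f(3)[OF that] by (cases "u = r") (auto simp: c'_def)
  have lip: "dist (c' u) (c' v) \<le> v - u" if uv: "0 \<le> u" "u \<le> v" "v \<le> r + \<bar>s - t\<bar>" for u v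
  proof -
    consider "v \<le> r" | "r \<le> u" | "u \<le> r" "r \<le> v" by linarith
    then show ?thesis
    proof cases
      case 1
      then show ?thesis using cd[of u v] uv by (simp add: c'_def)
    next
      case 2
      then show ?thesis using edge[OF f(1) f(1), of u v] f(2)[of u v] c'2[of u] c'2[of v] uv by auto
    next
      case 3
      have "dist (c' u) (c r) \<le> r - u" using cd[of u r] uv 3 by (simp add: c'_def)
      moreover have "dist (c r) (c' v) \<le> v - r"
        using edge[OF f(1) f(1), of r v] f(2)[of r v] f(3)[of r] c'2[of v] c(2) uv 3 by auto
      ultimately show ?thesis using dist_triangle[of "c' u" "c' v" "c r"] by linarith
    qed
  qed
  have "dist (c' u) (c' v) \<le> \<bar>u - v\<bar>"
    if "u \<in> {0..r + \<bar>s - t\<bar>}" "v \<in> {0..r + \<bar>s - t\<bar>}" for u v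
    using lip[of u v] lip[of v u] that by (cases "u \<le> v") (auto simp: dist_commute)
  moreover have "c' 0 = x" using c r by (simp add: c'_def)
  moreover have "c' (r + \<bar>s - t\<bar>) = e t" using c'2[of "r + \<bar>s - t\<bar>"] by (auto simp: f_def)
  ultimately show ?case by blast
qed

text \<open>A 1-Lipschitz curve whose parameter length is exactly the distance of its ends cannot
  lose distance anywhere, so it is isometric. This is where the attained infimum is used.\<close>

lemma connected_metric_graph_geodesic:
  fixes x y :: "'a::metric_space" and V :: "'a set"
  assumes "connected_metric_graph V E"
  shows "\<exists>c. geodesic_curve c x y"
proof -
  let ?d = "dist x y"
  obtain c where c: "c 0 = x" "c ?d = y"
    and lip: "\<And>s t. s \<in> {0..?d} \<Longrightarrow> t \<in> {0..?d} \<Longrightarrow> dist (c s) (c t) \<le> \<bar>s - t\<bar>"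
    using piecewise_linear_path_curve[OF assms piecewise_linear_path_attains_Inf[OF assms], of x y] by blast
  have le: "dist (c s) (c t) = t - s" if st: "0 \<le> s" "s \<le> t" "t \<le> ?d" for s t
  proof -
    have "dist x y \<le> dist x (c s) + dist (c s) (c t) + dist (c t) y" by metric
    moreover have "dist x (c s) \<le> s" "dist (c t) y \<le> ?d - t" "dist (c s) (c t) \<le> t - s"
      using lip[of 0 s] lip[of t ?d] lip[of s t] c st by auto
    ultimately show ?thesis by linarith
  qed
  have "dist (c s) (c t) = \<bar>s - t\<bar>" if "s \<in> {0..?d}" "t \<in> {0..?d}" for s t
    using le[of s t] le[of t s] that by (cases "s \<le> t") (auto simp: dist_commute)
  then show ?thesis using c unfolding geodesic_curve_def by blast
qed

text \<open>The geodesic starts next to the side from \<open>w\<close> to \<open>x\<close> and ends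
  next to the side from \<open>w\<close> to \<open>z\<close>. Where it changes sides it is close to
  both, and adding the two resulting inequalities isolates \<open>dist w (c t)\<close>.\<close>

lemma thin_triangle_point:
  assumes geo: "\<And>x y::'a::metric_space. \<exists>c. geodesic_curve c x y"
    and hyp: "delta_hyperbolic TYPE('a) \<delta>" and c: "geodesic_curve c x (z::'a)"
  shows "\<exists>t\<in>{0..dist x z}. dist w (c t) \<le> gp w x z + 2 * \<delta> + 1"
proof -
  obtain a where a: "geodesic_curve a z w" using geo by blast
  obtain b where b: "geodesic_curve b w x" using geo by blast
  define A where "A = a ` {0..dist z w}"
  define B where "B = b ` {0..dist w x}"
  have "c ` {0..dist x z} \<subseteq> nbhd \<delta> (A \<union> B)"
    using hyp geodesic_curve_arc[OF c] geodesic_curve_arc[OF a] geodesic_curve_arc[OF b]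
    unfolding delta_hyperbolic_def A_def B_def by blast
  then have cover: "(\<exists>p\<in>A. dist p (c t) \<le> \<delta>) \<or> (\<exists>p\<in>B. dist p (c t) \<le> \<delta>)" if "0 \<le> t" "t \<le> dist x z" for t
    using that unfolding nbhd_def by fastforce
  have A: "dist w (c t) + dist (c t) z \<le> dist w z + 2 * r" if pA: "p \<in> A" "dist p (c t) \<le> r" for p t r
  proof -
    have "dist z p + dist p w = dist z w" using pA(1) geodesic_curve_on[OF a] unfolding A_def by force
    moreover have "dist w (c t) \<le> dist w p + dist p (c t)" "dist (c t) z \<le> dist p (c t) + dist p z" by metric+
    ultimately show ?thesis using pA(2) by (simp add: dist_commute)
  qed
  have B: "dist w (c t) + dist x (c t) \<le> dist w x + 2 * r" if pB: "p \<in> B" "dist p (c t) \<le> r" for p t r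
  proof -
    have "dist w p + dist p x = dist w x" using pB(1) geodesic_curve_on[OF b] unfolding B_def by force
    moreover have "dist w (c t) \<le> dist w p + dist p (c t)" "dist x (c t) \<le> dist p (c t) + dist p x" by metric+
    ultimately show ?thesis using pB(2) by (simp add: dist_commute)
  qed
  have cx: "c 0 = x" "c (dist x z) = z" using c unfolding geodesic_curve_def by auto
  have \<delta>: "0 \<le> \<delta>"
    using cover[of 0] zero_le_dist order_trans by (metis order.refl)
  define T where "T = {t \<in> {0..dist x z}. \<exists>p\<in>B. dist p (c t) \<le> \<delta>}"
  have "b (dist w x) \<in> B" unfolding B_def by auto
  then have "x \<in> B" using b unfolding geodesic_curve_def by simp
  then have T0: "0 \<in> T" using \<delta> cx(1) by (auto simp: T_def intro!: bexI[of _ x])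
  have bdd: "bdd_above T" by (rule bdd_aboveI[of _ "dist x z"]) (auto simp: T_def)
  then have "Sup T - 1/2 < Sup T" by simp
  \<comment> \<open>A last time near \<open>B\<close> need not exist, so \<open>t\<close> is taken
    within 1/2 of the supremum; \<open>t + 1\<close> is then past it, which costs the extra
    1.\<close>
  then obtain t where t: "t \<in> T" "Sup T - 1/2 < t" using T0 less_cSupE by blast
  obtain p where p: "p \<in> B" "dist p (c t) \<le> \<delta>" using t by (auto simp: T_def)
  have t': "0 \<le> t" "t \<le> dist x z" using t by (auto simp: T_def)
  have "dist w (c t) + dist (c t) z \<le> dist w z + 2 * (\<delta> + 1)"
  proof (cases "t + 1 \<le> dist x z")
    case True
    then have "t + 1 \<notin> T" using cSup_upper[OF _ bdd, of "t + 1"] t by fastforce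
    then obtain q where q: "q \<in> A" "dist q (c (t + 1)) \<le> \<delta>" using cover[of "t + 1"] True t' by (auto simp: T_def)
    have "dist (c (t + 1)) (c t) = 1" using c True t' unfolding geodesic_curve_def by auto
    then have "dist q (c t) \<le> \<delta> + 1" using q dist_triangle[of q "c t" "c (t + 1)"] by linarith
    then show ?thesis using A q by blast
  next
    case False
    have "dist (c t) z \<le> 1" using geodesic_curve_on[OF c t'] False by simp
    then show ?thesis using \<delta> dist_triangle[of w "c t" z] by (simp add: dist_commute)
  qed
  moreover have "dist w (c t) + dist x (c t) \<le> dist w x + 2 * \<delta>" using B p by blast
  ultimately have "dist w (c t) \<le> gp w x z + 2 * \<delta> + 1"
    using geodesic_curve_on[OF c t'] unfolding gp_def by (simp add: field_simps)
  then show ?thesis using t' by auto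
qed

text \<open>The point of \<open>c\<close> supplied by \<open>thin_triangle_point\<close> is
  \<delta>-close to one of the other two sides, and a point of a geodesic is never closer to
  \<open>w\<close> than the Gromov product of its ends.\<close>

lemma delta_hyperbolic_four_points:
  assumes geo: "\<And>x y::'a::metric_space. \<exists>c. geodesic_curve c x y"
    and hyp: "delta_hyperbolic TYPE('a) \<delta>"
  shows "min (gp w x y) (gp w y z) \<le> gp (w::'a) x z + 3 * \<delta> + 1"
proof -
  obtain c where c: "geodesic_curve c x z" using geo by blast
  obtain a where a: "geodesic_curve a z y" using geo by blast
  obtain b where b: "geodesic_curve b y x" using geo by blast
  obtain t where t: "t \<in> {0..dist x z}" "dist w (c t) \<le> gp w x z + 2 * \<delta> + 1"
    using thin_triangle_point[OF geo hyp c] by blast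
  have "c ` {0..dist x z} \<subseteq> nbhd \<delta> (a ` {0..dist z y} \<union> b ` {0..dist y x})"
    using hyp geodesic_curve_arc[OF c] geodesic_curve_arc[OF a] geodesic_curve_arc[OF b]
    unfolding delta_hyperbolic_def by blast
  then have "c t \<in> nbhd \<delta> (a ` {0..dist z y} \<union> b ` {0..dist y x})" using t(1) by blast
  then obtain q where q: "q \<in> a ` {0..dist z y} \<union> b ` {0..dist y x}" "dist q (c t) \<le> \<delta>"
    unfolding nbhd_def mem_cball UN_iff by metis
  have w: "dist w q \<le> gp w x z + 3 * \<delta> + 1" using q(2) t(2) dist_triangle[of w q "c t"] by (simp add: dist_commute)
  have *: "gp w u v \<le> dist w q" if "dist u q + dist q v = dist u v" for u v
    using that dist_triangle[of w u q] dist_triangle[of w v q] unfolding gp_def by (simp add: dist_commute field_simps)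
  have "gp w z y \<le> dist w q" if "q \<in> a ` {0..dist z y}"
    using that geodesic_curve_on[OF a] by (intro *) auto
  moreover have "gp w y x \<le> dist w q" if "q \<in> b ` {0..dist y x}"
    using that geodesic_curve_on[OF b] by (intro *) auto
  ultimately have "gp w z y \<le> dist w q \<or> gp w y x \<le> dist w q" using q(1) by blast
  moreover have "gp w z y = gp w y z" "gp w y x = gp w x y" unfolding gp_def by (simp_all add: dist_commute)
  ultimately show ?thesis using w by linarith
qed

section \<open>Gromov hyperbolic geodesic spaces\<close>

definition between :: "'a::metric_space \<Rightarrow> 'a \<Rightarrow> 'a \<Rightarrow> bool"
  where "between x m y \<longleftrightarrow> dist x m + dist m y = dist x y"

lemma gp_nonneg: "0 \<le> gp w x y"
  using dist_triangle[of x y w] unfolding gp_def by (simp add: dist_commute)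

lemma gp_commute: "gp w x y = gp w y x"
  unfolding gp_def by (simp add: dist_commute)

lemma gp_le_dist: "gp w x y \<le> dist w x" "gp w x y \<le> dist w y"
  using dist_triangle[of w x y] dist_triangle[of w y x] unfolding gp_def by (simp_all add: dist_commute)

lemma gp_move: "gp w x y \<le> gp w' x y + dist w w'"
  using dist_triangle[of w x w'] dist_triangle[of w y w'] unfolding gp_def by (simp add: field_simps)

lemma gp_move_ends: "gp w x y \<le> gp w x' y' + dist x x' + dist y y'"
proof -
  have "dist w x \<le> dist w x' + dist x x'" "dist w y \<le> dist w y' + dist y y'"
    by metric+
  moreover have "dist x' y' \<le> dist x x' + dist x y + dist y y'" by metric
  moreover have "2 * gp w x y = dist w x + dist w y - dist x y" "2 * gp w x' y' = dist w x' + dist w y' - dist x' y'"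
    by (simp_all add: gp_def)
  ultimately show ?thesis by linarith
qed

lemma dist_le_gp: "dist w x \<le> gp w x y + dist x y"
  using dist_triangle[of w x y] unfolding gp_def by (simp add: dist_commute field_simps)

text \<open>With \<open>k\<close> about \<open>log 2 (\<alpha> * D + \<beta>)\<close> the hypothesis
  bounds \<open>D\<close> by a logarithm of itself. This is how exponential divergence of geodesics
  turns into a constant.\<close>

lemma log_bound:
  fixes \<alpha> \<beta> \<gamma> \<delta> :: real
  assumes "0 \<le> \<delta>" "0 \<le> \<alpha>" "1 \<le> \<beta>"
  shows "\<exists>R. \<forall>D\<ge>0. (\<forall>k::nat. \<alpha> * D + \<beta> \<le> 2 ^ k \<longrightarrow> D \<le> \<gamma> + \<delta> * k) \<longrightarrow> D \<le> R"
proof -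
  have "filterlim (\<lambda>D::real. D - \<gamma> - \<delta> * (log 2 (\<alpha> * D + \<beta>) + 1)) at_top at_top"
  proof (cases "\<delta> = 0")
    case True
    then show ?thesis by simp real_asymp
  next
    case \<delta>: False
    show ?thesis
    proof (cases "\<alpha> = 0")
      case True
      then show ?thesis by simp real_asymp
    next
      case False
      then have "0 < \<alpha>" "0 < \<delta>" using assms \<delta> by auto
      then show ?thesis by real_asymp
    qed
  qed
  then have "eventually (\<lambda>D. 0 < D - \<gamma> - \<delta> * (log 2 (\<alpha> * D + \<beta>) + 1)) at_top"
    unfolding filterlim_at_top_dense by (rule spec)
  then obtain R where R: "\<And>D. R \<le> D \<Longrightarrow> 0 < D - \<gamma> - \<delta> * (log 2 (\<alpha> * D + \<beta>) + 1)"
    by (auto simp: eventually_at_top_linorder)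
  have "D \<le> R" if D: "0 \<le> D" "\<forall>k::nat. \<alpha> * D + \<beta> \<le> 2 ^ k \<longrightarrow> D \<le> \<gamma> + \<delta> * k" for D
  proof (rule ccontr)
    assume "\<not> D \<le> R"
    define k where "k = nat \<lceil>log 2 (\<alpha> * D + \<beta>)\<rceil>"
    have ge1: "1 \<le> \<alpha> * D + \<beta>" using assms D by (simp add: add_increasing)
    then have l0: "0 \<le> log 2 (\<alpha> * D + \<beta>)" by (simp add: zero_le_log_cancel_iff)
    have "\<alpha> * D + \<beta> = 2 powr (log 2 (\<alpha> * D + \<beta>))" using ge1 by simp
    also have "\<dots> \<le> 2 powr (real k)" unfolding k_def by (intro powr_mono) linarith+
    finally have "D \<le> \<gamma> + \<delta> * k" using D by (simp add: powr_realpow)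
    moreover have "\<delta> * k \<le> \<delta> * (log 2 (\<alpha> * D + \<beta>) + 1)"
      using assms l0 unfolding k_def by (intro mult_left_mono) linarith+
    ultimately show False using R[of D] \<open>\<not> D \<le> R\<close> by simp
  qed
  then show ?thesis by blast
qed

text \<open>Geodesics enter only through points at prescribed distances, and \<delta> is now the
  constant of the four-point inequality: a \<delta>-hyperbolic graph is an instance with
  \<open>3 * \<delta> + 1\<close>.\<close>

locale hyperbolic_space =
  fixes X :: "'a::metric_space itself" and \<delta> :: real
  assumes point_on: "\<And>(x::'a) y t. 0 \<le> t \<Longrightarrow> t \<le> dist x y \<Longrightarrow> \<exists>m. dist x m = t \<and> dist m y = dist x y - t"
    and hyp: "\<And>w x y z::'a. min (gp w x y) (gp w y z) \<le> gp w x z + \<delta>"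
begin

lemma \<delta>_nonneg: "0 \<le> \<delta>"
  using hyp[of "undefined::'a" undefined undefined undefined] by simp

lemma four_points:
  fixes x y z w :: 'a
  shows "dist x z + dist y w \<le> max (dist x y + dist z w) (dist x w + dist y z) + 2 * \<delta>"
  using hyp[of w x y z] unfolding gp_def by (auto simp: dist_commute min_def max_def field_simps split: if_splits)

lemma near_segment:
  fixes w x y :: 'a
  shows "\<exists>m. between x m y \<and> dist w m \<le> gp w x y + 2 * \<delta>"
proof -
  obtain m where m: "dist x m = gp x w y" "dist m y = dist x y - gp x w y"
    using point_on[of "gp x w y" x y] gp_nonneg gp_le_dist by metis
  have "dist w m \<le> gp w x y + 2 * \<delta>"
    using four_points[of w m x y] m unfolding gp_def by (auto simp: dist_commute max_def field_simps split: if_splits)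
  moreover have "between x m y" using m by (simp add: between_def)
  ultimately show ?thesis by blast
qed

text \<open>The place on the segment from \<open>x\<close> to \<open>y\<close> where the comparison
  tripod of the triangle branches is close to all three sides; small Gromov products express this
  without choosing geodesics.\<close>

lemma center:
  fixes x y z :: 'a
  shows "\<exists>m. gp m x y \<le> \<delta> \<and> gp m y z \<le> \<delta> \<and> gp m x z \<le> \<delta>"
proof -
  obtain m where m: "dist x m = gp x z y" "dist m y = dist x y - gp x z y"
    using point_on[of "gp x z y" x y] gp_nonneg gp_le_dist by metis
  have "dist z m \<le> gp z x y + 2 * \<delta>"
    using four_points[of z m x y] m unfolding gp_def by (auto simp: dist_commute max_def field_simps split: if_splits)
  then show ?thesis using m \<delta>_nonneg
    by (intro exI[of _ m]) (auto simp: gp_def dist_commute field_simps)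
qed

text \<open>Halving the chain costs one \<delta> per level, so the loss is logarithmic in the number
  of steps instead of linear.\<close>

lemma gp_chain:
  fixes u :: "nat \<Rightarrow> 'a"
  assumes "0 < n" "n \<le> 2 ^ k" "\<And>i. i < n \<Longrightarrow> c \<le> gp w (u (i0 + i)) (u (Suc (i0 + i)))"
  shows "c - k * \<delta> \<le> gp w (u i0) (u (i0 + n))"
  using assms
proof (induction k arbitrary: n i0)
  case 0
  then have "n = 1" by simp
  then show ?case using 0(3)[of 0] by simp
next
  case (Suc k)
  show ?case
  proof (cases "n \<le> 2 ^ k")
    case True
    then have "c - k * \<delta> \<le> gp w (u i0) (u (i0 + n))" using Suc by blast
    then show ?thesis using \<delta>_nonneg by (simp add: algebra_simps)
  next
    case False
    have "c - k * \<delta> \<le> gp w (u i0) (u (i0 + 2 ^ k))"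
      using Suc.prems(3) False by (intro Suc.IH) auto
    moreover have "c - k * \<delta> \<le> gp w (u (i0 + 2 ^ k)) (u ((i0 + 2 ^ k) + (n - 2 ^ k)))"
      using False Suc.prems(2) Suc.prems(3)[of "2 ^ k + _"] by (intro Suc.IH) (auto simp: add.assoc)
    moreover have "(i0 + 2 ^ k) + (n - 2 ^ k) = i0 + n" using False by simp
    ultimately show ?thesis
      using hyp[of w "u i0" "u (i0 + 2 ^ k)" "u (i0 + n)"] by (simp add: algebra_simps)
  qed
qed

lemma min4: "min (gp w a b) (min (gp w b c) (gp w c d)) \<le> gp w a (d::'a) + 2 * \<delta>"
  using hyp[of w a b c] hyp[of w a c d] \<delta>_nonneg by (auto simp: min_def split: if_splits)

text \<open>The form of the Morse lemma used for quasi-geodesics and for the near-minimal chains of the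
  modified metric below. The steps \<open>[u i, u (i + 1)]\<close> may be arbitrarily long; only their number
  is controlled. If \<open>D\<close> bounds the distance from points of the geodesic to the chain and is almost
  attained at \<open>w\<close>, a detour around the ball of radius \<open>D\<close> about \<open>w\<close> uses \<open>O(D)\<close> steps, whereas
  hyperbolicity forces exponentially many.\<close>

lemma chain_near_segment:
  assumes A: "0 \<le> A" and C: "0 \<le> C"
  shows "\<exists>R\<ge>0. \<forall>(u::nat \<Rightarrow> 'a) n w. 0 < n \<and>
      (\<forall>i j m m'. i < j \<and> j < n \<and> between (u i) m (u (Suc i)) \<and> between (u j) m' (u (Suc j)) \<longrightarrow>
        real j - real i \<le> A * dist m m' + C) \<and> between (u 0) w (u n) \<longrightarrow>
      (\<exists>i<n. gp w (u i) (u (Suc i)) \<le> R)"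
proof -
  obtain R0 where R0: "\<And>D. 0 \<le> D \<Longrightarrow>
      (\<And>k::nat. 6 * A * D + (4 * A * \<delta> + C + 3) \<le> 2 ^ k \<Longrightarrow> D \<le> (1 + 4 * \<delta>) + \<delta> * k) \<Longrightarrow> D \<le> R0"
    using log_bound[of \<delta> "6 * A" "4 * A * \<delta> + C + 3" "1 + 4 * \<delta>"] A C \<delta>_nonneg by (auto simp: mult_nonneg_nonneg)
  have "\<exists>i<n. gp w0 (u i) (u (Suc i)) \<le> max R0 0"
    if n: "0 < n" and count: "\<And>i j m m'. i < j \<Longrightarrow> j < n \<Longrightarrow> between (u i) m (u (Suc i)) \<Longrightarrow>
        between (u j) m' (u (Suc j)) \<Longrightarrow> real j - real i \<le> A * dist m m' + C"
      and w0: "between (u 0) w0 (u n)" for u :: "nat \<Rightarrow> 'a" and n w0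
  proof -
    \<comment> \<open>\<open>\<rho> w\<close> plays the part of the distance from \<open>w\<close>
      to the chain. As the steps may be long, each step is represented by a Gromov product and not
      by its endpoints.\<close>
    define \<rho> where "\<rho> = (\<lambda>w. Min ((\<lambda>i. gp w (u i) (u (Suc i))) ` {..<n}))"
    have \<rho>_le: "\<rho> w \<le> gp w (u i) (u (Suc i))" if "i < n" for w i
      unfolding \<rho>_def using that by (intro Min_le) auto
    have \<rho>_ex: "\<exists>i<n. gp w (u i) (u (Suc i)) = \<rho> w" for w
    proof -
      have "\<rho> w \<in> (\<lambda>i. gp w (u i) (u (Suc i))) ` {..<n}" unfolding \<rho>_def using n by (intro Min_in) auto
      then show ?thesis by auto
    qed
    define S where "S = \<rho> ` {w. between (u 0) w (u n)}"
    have bdd: "bdd_above S"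
    proof (rule bdd_aboveI)
      fix r assume "r \<in> S"
      then obtain w where w: "between (u 0) w (u n)" "r = \<rho> w" by (auto simp: S_def)
      have "r \<le> dist w (u 0)" using \<rho>_le[of 0 w] n gp_le_dist(1)[of w "u 0" "u (Suc 0)"] w by simp
      then show "r \<le> dist (u 0) (u n)" using w zero_le_dist[of w "u n"] dist_commute[of w "u 0"] unfolding between_def by linarith
    qed
    have S0: "\<rho> w0 \<in> S" using w0 by (auto simp: S_def)
    define D where "D = Sup S"
    have D_upper: "\<rho> w \<le> D" if "between (u 0) w (u n)" for w
      unfolding D_def using that bdd by (intro cSup_upper) (auto simp: S_def)
    have D_nonneg: "0 \<le> D" using \<rho>_ex[of w0] gp_nonneg D_upper[OF w0] by (metis order_trans)
    have "D - 1 < Sup S" by (simp add: D_def)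
    then obtain w where w: "between (u 0) w (u n)" "D - 1 < \<rho> w"
      using S0 less_cSupE[of "D - 1" S] by (auto simp: S_def)
    have far: "D - 1 \<le> gp w (u i) (u (Suc i))" if "i < n" for i using \<rho>_le[OF that, of w] w by linarith
    \<comment> \<open>On each side of \<open>w\<close> take the point \<open>y\<close> at distance
      \<open>2 * D\<close>, or the end \<open>e\<close> if that is closer. It is near some step of
      the chain; if \<open>y = e\<close>, this is the first or last step \<open>i0\<close>.\<close>
    have side: "\<exists>y i m. i < n \<and> between e y w \<and> between (u i) m (u (Suc i)) \<and> dist y m \<le> D + 2 * \<delta> \<and>
        dist y w \<le> 2 * D \<and> D - 1 - 2 * \<delta> \<le> gp w y m"
      if e: "e = u 0 \<and> i0 = 0 \<or> e = u n \<and> i0 = n - 1" for e i0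
    proof (cases "dist e w \<le> 2 * D")
      case True
      have i0: "i0 < n" "between (u i0) e (u (Suc i0))" using e n by (auto simp: between_def)
      have "D - 1 \<le> gp w e e"
        using far[OF i0(1)] gp_le_dist[of w "u i0" "u (Suc i0)"] e n by (auto simp: gp_def)
      then show ?thesis using i0 True D_nonneg \<delta>_nonneg
        by (intro exI[of _ e] exI[of _ i0]) (auto simp: between_def)
    next
      case False
      then obtain y where y: "dist w y = 2 * D" "dist y e = dist w e - 2 * D"
        using point_on[of "2 * D" w e] D_nonneg by (auto simp: dist_commute)
      have "between (u 0) y (u n)"
        using e w(1) y dist_triangle[of "u 0" y w] dist_triangle[of "u n" y w] dist_triangle[of "u 0" "u n" y]
        unfolding between_def by (auto simp: dist_commute)
      then obtain i where i: "i < n" "gp y (u i) (u (Suc i)) \<le> D" using D_upper \<rho>_ex by metis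
      then obtain m where m: "between (u i) m (u (Suc i))" "dist y m \<le> D + 2 * \<delta>"
        using near_segment[of "u i" "u (Suc i)" y] by force
      have "D - 1 - 2 * \<delta> \<le> gp w y m"
        using m(2) y(1) dist_triangle[of w y m] unfolding gp_def by (simp add: dist_commute field_simps)
      moreover have "between e y w" using y by (simp add: between_def dist_commute)
      ultimately show ?thesis using i(1) m y(1)
        by (intro exI[of _ y] exI[of _ i] exI[of _ m]) (auto simp: dist_commute)
    qed
    obtain y i m where y: "i < n" "between (u 0) y w" "between (u i) m (u (Suc i))"
        "dist y m \<le> D + 2 * \<delta>" "dist y w \<le> 2 * D" "D - 1 - 2 * \<delta> \<le> gp w y m"
      using side[of "u 0" 0] by blast
    obtain y' j m' where y': "j < n" "between (u n) y' w" "between (u j) m' (u (Suc j))"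
        "dist y' m' \<le> D + 2 * \<delta>" "dist y' w \<le> 2 * D" "D - 1 - 2 * \<delta> \<le> gp w y' m'"
      using side[of "u n" "n - 1"] by blast
    have mm': "dist m m' \<le> 6 * D + 4 * \<delta>"
    proof -
      have "dist m m' \<le> dist y m + dist y w + dist y' w + dist y' m'" by metric
      then show ?thesis using y y' by linarith
    qed
    have yy': "gp w y y' = 0"
    proof -
      have "dist (u 0) (u n) \<le> dist (u 0) y + dist y y' + dist y' (u n)" by metric
      then have "dist y w + dist y' w \<le> dist y y'"
        using w(1) y(2) y'(2) unfolding between_def by (simp add: dist_commute)
      then show ?thesis using gp_nonneg[of w y y'] unfolding gp_def by (simp add: dist_commute)
    qed
    have on_step: "D - 1 \<le> gp w m (u (Suc i))" "D - 1 \<le> gp w m (u i)"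
      if "i < n" "between (u i) m (u (Suc i))" for i m
      using far[OF that(1)] that(2) dist_triangle[of w "u i" m] dist_triangle[of w "u (Suc i)" m]
      unfolding gp_def between_def by (simp_all add: dist_commute field_simps)
    \<comment> \<open>Every step between \<open>i\<close> and \<open>j\<close> has product at least
      \<open>D - 1\<close> at \<open>w\<close>, and there are at most \<open>2 ^ k\<close> of them.
      So the product of \<open>m\<close> and \<open>m'\<close> loses at most
      \<open>k * \<delta>\<close> along the chain and \<open>2 * \<delta>\<close> at its two
      ends.\<close>
    have link: "D - 1 - k * \<delta> - 2 * \<delta> \<le> gp w m m'"
      if ij: "i < j" "j < n" and m: "between (u i) m (u (Suc i))" "between (u j) m' (u (Suc j))"
        and k: "A * dist m m' + C \<le> 2 ^ k" for i j m m' and k :: nat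
    proof -
      have "D - 1 - k * \<delta> \<le> gp w (u (Suc i)) (u j)"
      proof (cases "Suc i = j")
        case True
        have "D - 1 \<le> dist w (u j)" using far[OF ij(2)] gp_le_dist by (meson order_trans)
        moreover have "0 \<le> k * \<delta>" using \<delta>_nonneg by simp
        ultimately show ?thesis using True by (simp add: gp_def)
      next
        case False
        have "real (j - Suc i) \<le> real (2 ^ k)" using count[OF ij m] k ij by (simp add: of_nat_diff)
        then have "j - Suc i \<le> 2 ^ k" by (simp only: of_nat_le_iff)
        then have "D - 1 - k * \<delta> \<le> gp w (u (Suc i)) (u (Suc i + (j - Suc i)))"
          using False ij far by (intro gp_chain) auto
        then show ?thesis using ij by simp
      qed
      moreover have "0 \<le> k * \<delta>" using \<delta>_nonneg by simp
      moreover have "D - 1 \<le> gp w m (u (Suc i))" "D - 1 \<le> gp w (u j) m'"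
        using on_step ij m by (auto simp: gp_commute)
      ultimately show ?thesis using min4[of w m "u (Suc i)" "u j" m'] by linarith
    qed
    have "D \<le> (1 + 4 * \<delta>) + \<delta> * k" if k: "6 * A * D + (4 * A * \<delta> + C + 3) \<le> 2 ^ k" for k :: nat
    proof -
      have "A * dist m m' \<le> A * (6 * D + 4 * \<delta>)" using mm' A by (rule mult_left_mono)
      then have k': "A * dist m m' + C \<le> 2 ^ k" using k by (simp add: algebra_simps)
      have k\<delta>: "0 \<le> k * \<delta>" using \<delta>_nonneg by simp
      have "D - 1 - k * \<delta> - 2 * \<delta> \<le> gp w m m'"
      proof (cases i j rule: linorder_cases)
        case less
        then show ?thesis using link y y' k' by blast
      next
        case equal
        then have "D - 1 \<le> gp w m (u i)" "D - 1 \<le> gp w (u i) m'"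
          using on_step y y' by (auto simp: gp_commute)
        then show ?thesis using hyp[of w m "u i" m'] k\<delta> \<delta>_nonneg by linarith
      next
        case greater
        then show ?thesis using link[of j i m' m k] y y' k' by (simp add: gp_commute dist_commute)
      qed
      \<comment> \<open>As \<open>w\<close> lies between \<open>y\<close> and \<open>y'\<close>,
        their product at \<open>w\<close> is 0; the route through \<open>m\<close> and
        \<open>m'\<close> bounds it below by \<open>D - 1 - (k + 4) * \<delta>\<close>.\<close>
      then show ?thesis
        using min4[of w y m m' y'] yy' y(6) y'(6) k\<delta> by (simp add: gp_commute algebra_simps min_def split: if_splits)
    qed
    then have "D \<le> R0" using R0 D_nonneg by blast
    then have "\<rho> w0 \<le> R0" using D_upper[OF w0] by simp
    then show ?thesis using \<rho>_ex[of w0] by (metis max.coboundedI1)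
  qed
  then show ?thesis by (intro exI[of _ "max R0 0"]) auto
qed

end

section \<open>Quasi-geodesics: stability, common ends at infinity, and broken geodesics\<close>

lemma quasi_geodesic_subset:
  "quasi_geodesic K L I \<phi> \<Longrightarrow> J \<subseteq> I \<Longrightarrow> is_interval J \<Longrightarrow> quasi_geodesic K L J \<phi>"
  unfolding quasi_geodesic_def by blast

lemma quasi_geodesic_bounds:
  assumes "quasi_geodesic K L I \<phi>"
  shows "1 \<le> K" "0 \<le> L"
    "s \<in> I \<Longrightarrow> t \<in> I \<Longrightarrow> \<bar>s - t\<bar> \<le> K * (dist (\<phi> s) (\<phi> t) + L)"
    "s \<in> I \<Longrightarrow> t \<in> I \<Longrightarrow> dist (\<phi> s) (\<phi> t) \<le> K * \<bar>s - t\<bar> + L"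
proof -
  show KL: "1 \<le> K" "0 \<le> L" using assms unfolding quasi_geodesic_def by auto
  show "dist (\<phi> s) (\<phi> t) \<le> K * \<bar>s - t\<bar> + L" if "s \<in> I" "t \<in> I"
    using assms that unfolding quasi_geodesic_def by blast
  have "1 / K * \<bar>s - t\<bar> - L \<le> dist (\<phi> s) (\<phi> t)" if "s \<in> I" "t \<in> I"
    using assms that unfolding quasi_geodesic_def by blast
  then show "\<bar>s - t\<bar> \<le> K * (dist (\<phi> s) (\<phi> t) + L)" if "s \<in> I" "t \<in> I"
    using that KL by (simp add: field_simps)
qed

context hyperbolic_space
begin

text \<open>Quasi-geodesics need not be continuous, so the Morse lemma is applied to samples at unit
  time steps; the lower quasi-geodesic bound controls the number of samples.\<close>

lemma quasi_geodesic_near_segment: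
  assumes KL: "1 \<le> K" "0 \<le> L"
  shows "\<exists>R\<ge>0. \<forall>(\<phi>::real \<Rightarrow> 'a) a b w c. quasi_geodesic K L {a..b} \<phi> \<and> a \<le> b \<and> gp w (\<phi> a) (\<phi> b) \<le> c
    \<longrightarrow> (\<exists>t\<in>{a..b}. dist w (\<phi> t) \<le> R + c)"
proof -
  \<comment> \<open>The 1 accounts for the last sample, which may be cut off at \<open>b\<close>;
    \<open>2 * (K + L)\<close> is the cost of replacing \<open>m\<close> and \<open>m'\<close> by
    samples.\<close>
  define C where "C = 1 + K * (2 * (K + L) + L)"
  have "0 \<le> K" "0 \<le> C" using KL by (auto simp: C_def)
  then obtain R0 where R0: "0 \<le> R0" "\<forall>(u::nat \<Rightarrow> 'a) n w. 0 < n \<and>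
      (\<forall>i j m m'. i < j \<and> j < n \<and> between (u i) m (u (Suc i)) \<and> between (u j) m' (u (Suc j)) \<longrightarrow>
        real j - real i \<le> K * dist m m' + C) \<and> between (u 0) w (u n) \<longrightarrow>
      (\<exists>i<n. gp w (u i) (u (Suc i)) \<le> R0)"
    using chain_near_segment[of K C] by blast
  have "\<exists>t\<in>{a..b}. dist w (\<phi> t) \<le> (R0 + K + L + 2 * \<delta>) + c"
    if qg: "quasi_geodesic K L {a..b} \<phi>" and ab: "a \<le> b" and c: "gp w (\<phi> a) (\<phi> b) \<le> c"
    for \<phi> :: "real \<Rightarrow> 'a" and a b w c
  proof -
    define s where "s = (\<lambda>i::nat. min (a + i) b)"
    define n where "n = Suc (nat \<lceil>b - a\<rceil>)"
    have s: "s i \<in> {a..b}" for i using ab by (auto simp: s_def)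
    have ends: "s 0 = a" "s n = b" using ab unfolding s_def n_def by (auto simp: min_def) linarith
    have step: "dist (\<phi> (s i)) (\<phi> (s (Suc i))) \<le> K + L" for i
    proof -
      have "\<bar>s i - s (Suc i)\<bar> \<le> 1" by (auto simp: s_def min_def)
      then have "K * \<bar>s i - s (Suc i)\<bar> \<le> K" using KL by (simp add: mult_left_le)
      then show ?thesis using quasi_geodesic_bounds(4)[OF qg s s, of i "Suc i"] by linarith
    qed
    have count: "real j - real i \<le> K * dist m m' + C"
      if "i < j" "j < n" "between (\<phi> (s i)) m (\<phi> (s (Suc i)))" "between (\<phi> (s j)) m' (\<phi> (s (Suc j)))" for i j m m'
    proof -
      have "a + j < b + 1" using \<open>j < n\<close> ab unfolding n_def by linarith
      then have "real j - 1 - real i \<le> \<bar>s i - s j\<bar>" unfolding s_def by linarith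
      also have "\<dots> \<le> K * (dist (\<phi> (s i)) (\<phi> (s j)) + L)" by (rule quasi_geodesic_bounds(3)[OF qg s s])
      also have "\<dots> \<le> K * (dist m m' + 2 * (K + L) + L)"
      proof (intro mult_left_mono add_right_mono)
        have "dist (\<phi> (s i)) m \<le> K + L" "dist (\<phi> (s j)) m' \<le> K + L"
          using that(3,4) step[of i] step[of j] zero_le_dist[of m] zero_le_dist[of m'] unfolding between_def
          by (smt (verit) zero_le_dist)+
        moreover have "dist (\<phi> (s i)) (\<phi> (s j)) \<le> dist (\<phi> (s i)) m + dist m m' + dist (\<phi> (s j)) m'" by metric
        ultimately show "dist (\<phi> (s i)) (\<phi> (s j)) \<le> dist m m' + 2 * (K + L)" by argo
      qed (use KL in auto)
      finally show ?thesis by (simp add: C_def algebra_simps)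
    qed
    obtain m where m: "between (\<phi> a) m (\<phi> b)" "dist w m \<le> c + 2 * \<delta>"
      using near_segment[of "\<phi> a" "\<phi> b" w] c by force
    have "\<exists>i<n. gp m ((\<phi> \<circ> s) i) ((\<phi> \<circ> s) (Suc i)) \<le> R0"
      using count m(1) ends by (intro R0(2)[rule_format]) (auto simp: n_def)
    then obtain i where i: "gp m (\<phi> (s i)) (\<phi> (s (Suc i))) \<le> R0" by auto
    have "dist m (\<phi> (s i)) \<le> R0 + K + L"
      using dist_le_gp[of m "\<phi> (s i)" "\<phi> (s (Suc i))"] i step[of i] by linarith
    then have "dist w (\<phi> (s i)) \<le> (R0 + K + L + 2 * \<delta>) + c"
      using m(2) dist_triangle[of w "\<phi> (s i)" m] by linarith
    then show ?thesis using s by blast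
  qed
  then show ?thesis using R0(1) KL \<delta>_nonneg by (intro exI[of _ "R0 + K + L + 2 * \<delta>"]) auto
qed

text \<open>A center of the triangle spanned by \<open>\<phi> a\<close>, \<open>\<phi> t\<close>, \<open>\<phi> b\<close> is near \<open>\<phi>\<close> both before and after
  time \<open>t\<close>, hence near \<open>\<phi> t\<close>.\<close>

lemma quasi_geodesic_gp:
  assumes KL: "1 \<le> K" "0 \<le> L"
  shows "\<exists>M\<ge>0. \<forall>(\<phi>::real \<Rightarrow> 'a) a b t. quasi_geodesic K L {a..b} \<phi> \<and> t \<in> {a..b} \<longrightarrow> gp (\<phi> t) (\<phi> a) (\<phi> b) \<le> M"
proof -
  obtain R where R: "0 \<le> R" "\<And>(\<phi>::real \<Rightarrow> 'a) a b w c. quasi_geodesic K L {a..b} \<phi> \<Longrightarrow> a \<le> b \<Longrightarrow>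
      gp w (\<phi> a) (\<phi> b) \<le> c \<Longrightarrow> \<exists>t\<in>{a..b}. dist w (\<phi> t) \<le> R + c"
    using quasi_geodesic_near_segment[OF KL] by blast
  define M where "M = \<delta> + (R + \<delta>) + (K * (K * (2 * (R + \<delta>) + L)) + L)"
  have "gp (\<phi> t) (\<phi> a) (\<phi> b) \<le> M" if qg: "quasi_geodesic K L {a..b} \<phi>" and t: "t \<in> {a..b}"
    for \<phi> :: "real \<Rightarrow> 'a" and a b t
  proof -
    obtain m where m: "gp m (\<phi> a) (\<phi> b) \<le> \<delta>" "gp m (\<phi> t) (\<phi> b) \<le> \<delta>" "gp m (\<phi> a) (\<phi> t) \<le> \<delta>"
      using center[of "\<phi> a" "\<phi> b" "\<phi> t"] by (auto simp: gp_commute)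
    obtain t1 where t1: "t1 \<in> {a..t}" "dist m (\<phi> t1) \<le> R + \<delta>"
      using R(2)[OF quasi_geodesic_subset[OF qg, of "{a..t}"], of m \<delta>] t m by (auto simp: is_interval_cc)
    obtain t2 where t2: "t2 \<in> {t..b}" "dist m (\<phi> t2) \<le> R + \<delta>"
      using R(2)[OF quasi_geodesic_subset[OF qg, of "{t..b}"], of m \<delta>] t m by (auto simp: is_interval_cc)
    have "dist (\<phi> t1) (\<phi> t2) \<le> 2 * (R + \<delta>)"
      using t1(2) t2(2) dist_triangle3[of "\<phi> t1" "\<phi> t2" m] by argo
    then have "K * (dist (\<phi> t1) (\<phi> t2) + L) \<le> K * (2 * (R + \<delta>) + L)" using KL by (intro mult_left_mono) auto
    then have "\<bar>t - t1\<bar> \<le> K * (2 * (R + \<delta>) + L)"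
      using quasi_geodesic_bounds(3)[OF qg, of t1 t2] t1(1) t2(1) t by auto
    then have "K * \<bar>t - t1\<bar> \<le> K * (K * (2 * (R + \<delta>) + L))" using KL by (intro mult_left_mono) auto
    then have "dist (\<phi> t) (\<phi> t1) \<le> K * (K * (2 * (R + \<delta>) + L)) + L"
      using quasi_geodesic_bounds(4)[OF qg, of t t1] t1(1) t by auto
    then have "dist (\<phi> t) m \<le> (R + \<delta>) + (K * (K * (2 * (R + \<delta>) + L)) + L)"
      using t1(2) dist_triangle2[of "\<phi> t" m "\<phi> t1"] by linarith
    then show ?thesis using gp_move[of "\<phi> t" "\<phi> a" "\<phi> b" m] m(1) unfolding M_def by linarith
  qed
  moreover have "0 \<le> M" using R(1) \<delta>_nonneg KL by (simp add: M_def)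
  ultimately show ?thesis by blast
qed

text \<open>Provides an admissible \<open>B\<close> for \<open>axis_equivalent\<close>. A point of
  one quasi-geodesic has a small Gromov product with respect to two points far out on either side,
  and these are equal or close to points of the other quasi-geodesic.\<close>

lemma stability_constant_exists:
  assumes KL: "1 \<le> K" "0 \<le> L"
  shows "\<exists>B. stability_constant TYPE('a) K L B"
proof -
  obtain R where R: "0 \<le> R" "\<And>(\<phi>::real \<Rightarrow> 'a) a b w c. quasi_geodesic K L {a..b} \<phi> \<Longrightarrow> a \<le> b \<Longrightarrow>
      gp w (\<phi> a) (\<phi> b) \<le> c \<Longrightarrow> \<exists>t\<in>{a..b}. dist w (\<phi> t) \<le> R + c"
    using quasi_geodesic_near_segment[OF KL] by blast
  obtain M where M: "0 \<le> M" "\<And>(\<phi>::real \<Rightarrow> 'a) a b t. quasi_geodesic K L {a..b} \<phi> \<Longrightarrow> t \<in> {a..b} \<Longrightarrow>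
      gp (\<phi> t) (\<phi> a) (\<phi> b) \<le> M"
    using quasi_geodesic_gp[OF KL] by blast
  define B where "B = R + M + 2 * \<delta>"
  have finite_case: "\<phi> ` {a..b} \<subseteq> nbhd B (\<psi> ` {c..d})"
    if cd: "c \<le> d" and \<phi>: "quasi_geodesic K L {a..b} \<phi>" and \<psi>: "quasi_geodesic K L {c..d} \<psi>"
      and ends: "\<phi> a = \<psi> c" "\<phi> b = \<psi> d"
    for \<phi> \<psi> :: "real \<Rightarrow> 'a" and a b c d
  proof
    fix x assume "x \<in> \<phi> ` {a..b}"
    then obtain t where t: "t \<in> {a..b}" "x = \<phi> t" by blast
    then have "gp x (\<psi> c) (\<psi> d) \<le> M" using M(2)[OF \<phi> t(1)] ends by simp
    then obtain s where "s \<in> {c..d}" "dist x (\<psi> s) \<le> R + M" using R(2)[OF \<psi> cd] by blast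
    then show "x \<in> nbhd B (\<psi> ` {c..d})"
      using \<delta>_nonneg by (auto simp: nbhd_def B_def dist_commute intro!: bexI[of _ s])
  qed
  have infinite_case: "range \<phi> \<subseteq> nbhd B (range \<psi>)"
    if \<phi>: "quasi_geodesic K L UNIV \<phi>" and \<psi>: "quasi_geodesic K L UNIV \<psi>" and r: "range \<phi> \<subseteq> nbhd r (range \<psi>)"
    for \<phi> \<psi> :: "real \<Rightarrow> 'a" and r
  proof
    fix x assume "x \<in> range \<phi>"
    then obtain t where t: "x = \<phi> t" by blast
    \<comment> \<open>\<open>T\<close> puts \<open>\<phi> (t - T)\<close> and
      \<open>\<phi> (t + T)\<close> so far from \<open>x\<close> that replacing them by points of
      \<psi> within \<open>r\<close> raises the product at \<open>x\<close> by at most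
      \<open>2 * \<delta>\<close>.\<close>
    define T where "T = K * ((r + M + 2 * \<delta> + 1) + L)"
    have close: "\<exists>s. dist (\<phi> u) (\<psi> s) \<le> r" for u
    proof -
      have "\<phi> u \<in> nbhd r (range \<psi>)" using r by blast
      then show ?thesis by (auto simp: nbhd_def dist_commute)
    qed
    then have r0: "0 \<le> r" using zero_le_dist order_trans by metis
    then have T0: "0 \<le> T" using KL M(1) \<delta>_nonneg by (simp add: T_def)
    have far: "r + M + 2 * \<delta> + 1 \<le> dist x (\<phi> u)" if "\<bar>t - u\<bar> = T" for u
    proof -
      have "K * ((r + M + 2 * \<delta> + 1) + L) \<le> K * (dist x (\<phi> u) + L)"
        using quasi_geodesic_bounds(3)[OF \<phi>, of t u] that t by (simp add: T_def)
      then show ?thesis using KL by (simp add: mult_le_cancel_left)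
    qed
    obtain s1 where s1: "dist (\<phi> (t - T)) (\<psi> s1) \<le> r" using close by blast
    obtain s2 where s2: "dist (\<phi> (t + T)) (\<psi> s2) \<le> r" using close by blast
    have "gp x (\<phi> (t - T)) (\<phi> (t + T)) \<le> M"
      using M(2)[OF quasi_geodesic_subset[OF \<phi>], of "t - T" "t + T" t] T0 t by (auto simp: is_interval_cc)
    moreover have "M + 2 * \<delta> + 1 \<le> gp x (\<phi> (t - T)) (\<psi> s1)" "M + 2 * \<delta> + 1 \<le> gp x (\<psi> s2) (\<phi> (t + T))"
      using far[of "t - T"] far[of "t + T"] T0 s1 s2 dist_le_gp[of x "\<phi> (t - T)" "\<psi> s1"]
        dist_le_gp[of x "\<phi> (t + T)" "\<psi> s2"] by (auto simp: gp_commute)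
    ultimately have gp12: "gp x (\<psi> s1) (\<psi> s2) \<le> M + 2 * \<delta>"
      using min4[of x "\<phi> (t - T)" "\<psi> s1" "\<psi> s2" "\<phi> (t + T)"] by (auto simp: min_def split: if_splits)
    have "\<exists>s. dist x (\<psi> s) \<le> R + (M + 2 * \<delta>)"
    proof (cases "s1 \<le> s2")
      case True
      then show ?thesis using R(2)[OF quasi_geodesic_subset[OF \<psi>] True gp12] by (auto simp: is_interval_cc)
    next
      case False
      then have "s2 \<le> s1" by simp
      then show ?thesis
        using R(2)[OF quasi_geodesic_subset[OF \<psi>] _ gp12[unfolded gp_commute[of x "\<psi> s1"]]] by (auto simp: is_interval_cc)
    qed
    then show "x \<in> nbhd B (range \<psi>)" by (auto simp: nbhd_def B_def dist_commute add.assoc)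
  qed
  have "stability_constant TYPE('a) K L B"
    unfolding stability_constant_def within_distance_def
    using finite_case infinite_case by (metis order.refl)
  then show ?thesis by blast
qed

text \<open>Unbounded products say that both rays tend to the same point at infinity. For
  \<open>z\<close> on \<rho>, suitable far points \<open>\<rho> a\<close> and
  \<open>\<sigma> b\<close> are interchangeable as seen from \<open>p\<close>, up to one
  \<delta>.\<close>

lemma ray_in_nbhd:
  fixes \<rho> \<sigma> :: "real \<Rightarrow> 'a"
  assumes \<rho>: "quasi_geodesic K L {0..} \<rho>" and \<sigma>: "quasi_geodesic K' L' {0..} \<sigma>"
    and unbounded: "\<And>T. \<exists>a\<ge>0. \<exists>b\<ge>0. T \<le> gp p (\<rho> a) (\<sigma> b)"
  shows "\<exists>C. \<rho> ` {0..} \<subseteq> nbhd C (\<sigma> ` {0..})"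
proof -
  note KL = quasi_geodesic_bounds(1,2)[OF \<rho>]
  obtain R where R: "0 \<le> R" "\<And>(\<phi>::real \<Rightarrow> 'a) a b w c. quasi_geodesic K' L' {a..b} \<phi> \<Longrightarrow> a \<le> b \<Longrightarrow>
      gp w (\<phi> a) (\<phi> b) \<le> c \<Longrightarrow> \<exists>t\<in>{a..b}. dist w (\<phi> t) \<le> R + c"
    using quasi_geodesic_near_segment[OF quasi_geodesic_bounds(1,2)[OF \<sigma>]] by blast
  obtain M where M: "0 \<le> M" "\<And>(\<phi>::real \<Rightarrow> 'a) a b t. quasi_geodesic K L {a..b} \<phi> \<Longrightarrow> t \<in> {a..b} \<Longrightarrow>
      gp (\<phi> t) (\<phi> a) (\<phi> b) \<le> M"
    using quasi_geodesic_gp[OF KL] by blast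
  define e where "e = dist (\<rho> 0) p"
  define C where "C = R + (M + e + \<delta> + dist (\<sigma> 0) p)"
  have "\<rho> t \<in> nbhd C (\<sigma> ` {0..})" if t: "0 \<le> t" for t
  proof -
    define z where "z = \<rho> t"
    obtain a b where ab: "0 \<le> a" "0 \<le> b" "dist p z + K * t + L + e + 1 \<le> gp p (\<rho> a) (\<sigma> b)"
      using unbounded by blast
    have "K * t \<le> K * a"
    proof -
      have "dist p (\<rho> a) \<le> e + dist (\<rho> 0) (\<rho> a)" unfolding e_def by metric
      moreover have "dist (\<rho> 0) (\<rho> a) \<le> K * a + L" using quasi_geodesic_bounds(4)[OF \<rho>, of 0 a] ab by simp
      ultimately show ?thesis using ab(3) gp_le_dist(1)[of p "\<rho> a" "\<sigma> b"] zero_le_dist[of p z] by linarith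
    qed
    then have "t \<le> a" using KL by simp
    then have "gp z (\<rho> 0) (\<rho> a) \<le> M"
      using M(2)[OF quasi_geodesic_subset[OF \<rho>], of 0 a t] t by (auto simp: is_interval_cc z_def)
    then have "gp z p (\<rho> a) \<le> M + e"
      using gp_move_ends[of z p "\<rho> a" "\<rho> 0" "\<rho> a"] by (simp add: e_def dist_commute)
    then have "dist p z - (M + e) \<le> gp p z (\<rho> a)" unfolding gp_def by (simp add: dist_commute field_simps)
    moreover have "dist p z - (M + e) \<le> gp p (\<rho> a) (\<sigma> b)"
    proof -
      have "0 \<le> K * t" "0 \<le> e" using KL t by (auto simp: e_def)
      then show ?thesis using ab(3) M(1) KL by linarith
    qed
    ultimately have "dist p z - (M + e) - \<delta> \<le> gp p z (\<sigma> b)"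
      using hyp[of p z "\<rho> a" "\<sigma> b"] by (auto simp: min_def split: if_splits)
    then have "gp z p (\<sigma> b) \<le> M + e + \<delta>" unfolding gp_def by (simp add: dist_commute field_simps)
    then have "gp z (\<sigma> 0) (\<sigma> b) \<le> M + e + \<delta> + dist (\<sigma> 0) p"
      using gp_move_ends[of z "\<sigma> 0" "\<sigma> b" p "\<sigma> b"] by simp
    then obtain s where "s \<in> {0..b}" "dist z (\<sigma> s) \<le> C"
      using R(2)[OF quasi_geodesic_subset[OF \<sigma>] ab(2), of z "M + e + \<delta> + dist (\<sigma> 0) p"]
      unfolding C_def by (auto simp: is_interval_cc)
    then show ?thesis by (auto simp: nbhd_def z_def dist_commute intro!: bexI[of _ s])
  qed
  then show ?thesis by blast
qed

text \<open>Induction along the path: the last edge is long and the turn at its start is small, so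
  from its end the directions to \<open>y i\<close> and to the previous vertex almost agree. The
  local turn bound therefore carries over with one extra \<delta>.\<close>

lemma broken_geodesic_step:
  fixes y :: "nat \<Rightarrow> 'a"
  assumes a: "0 \<le> a" and turn: "\<And>i. Suc (Suc i) \<le> n \<Longrightarrow> gp (y (Suc i)) (y i) (y (Suc (Suc i))) \<le> a"
    and long: "\<And>i. i < n \<Longrightarrow> 2 * a + 3 * \<delta> < dist (y i) (y (Suc i))" and "i \<le> j" "j < n"
  shows "gp (y j) (y i) (y (Suc j)) \<le> a + \<delta>"
  using \<open>i \<le> j\<close> \<open>j < n\<close>
proof (induction j rule: dec_induct)
  case base
  then show ?case using a \<delta>_nonneg by (simp add: gp_def)
next
  case (step k)
  have "gp (y k) (y i) (y (Suc k)) \<le> a + \<delta>" using step by simp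
  moreover have "2 * a + 3 * \<delta> < dist (y k) (y (Suc k))" using long step by simp
  ultimately have "a + \<delta> < gp (y (Suc k)) (y k) (y i)"
    using \<delta>_nonneg unfolding gp_def by (simp add: dist_commute field_simps)
  moreover have "gp (y (Suc k)) (y k) (y (Suc (Suc k))) \<le> a" using turn step by simp
  ultimately show ?case using hyp[of "y (Suc k)" "y k" "y i" "y (Suc (Suc k))"] by (auto simp: min_def split: if_splits)
qed

lemma broken_geodesic:
  fixes y :: "nat \<Rightarrow> 'a"
  assumes a: "0 \<le> a" and turn: "\<And>i. Suc (Suc i) \<le> n \<Longrightarrow> gp (y (Suc i)) (y i) (y (Suc (Suc i))) \<le> a"
    and long: "\<And>i. i < n \<Longrightarrow> 2 * a + 3 * \<delta> < dist (y i) (y (Suc i))" and ijk: "i \<le> j" "j \<le> k" "k \<le> n"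
  shows "gp (y j) (y i) (y k) \<le> a + 2 * \<delta>"
proof (cases "j = k")
  case True
  then show ?thesis using a \<delta>_nonneg by (simp add: gp_def dist_commute)
next
  case False
  then have jk: "Suc j \<le> k" "j < n" using ijk by auto
  have 1: "gp (y j) (y i) (y (Suc j)) \<le> a + \<delta>"
    using turn long ijk(1) jk(2) by (intro broken_geodesic_step[OF a, where n = n]) auto
  \<comment> \<open>The reversed path gives the same estimate at \<open>y (Suc j)\<close>, between
    \<open>y k\<close> and \<open>y j\<close>.\<close>
  have "gp (y (n - (n - Suc j))) (y (n - (n - k))) (y (n - Suc (n - Suc j))) \<le> a + \<delta>"
  proof (rule broken_geodesic_step[OF a, where n = n and y = "\<lambda>i. y (n - i)"])
    fix i assume "Suc (Suc i) \<le> n"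
    then show "gp (y (n - Suc i)) (y (n - i)) (y (n - Suc (Suc i))) \<le> a"
      using turn[of "n - Suc (Suc i)"] by (simp add: Suc_diff_Suc gp_commute Suc_diff_le)
  next
    fix i assume "i < n"
    then show "2 * a + 3 * \<delta> < dist (y (n - i)) (y (n - Suc i))"
      using long[of "n - Suc i"] by (simp add: Suc_diff_Suc dist_commute)
  qed (use jk ijk in auto)
  moreover have "n - (n - Suc j) = Suc j" "n - (n - k) = k" "n - Suc (n - Suc j) = j" using jk ijk by auto
  ultimately have "gp (y (Suc j)) (y k) (y j) \<le> a + \<delta>" by simp
  then have "a + 2 * \<delta> < gp (y j) (y k) (y (Suc j))"
    using long[OF jk(2)] unfolding gp_def by (simp add: dist_commute field_simps)
  then show ?thesis using hyp[of "y j" "y i" "y k" "y (Suc j)"] 1 by (auto simp: min_def split: if_splits)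
qed

end

section \<open>A discounted metric\<close>

lemma dist_le_sum: "dist (u 0) (u n) \<le> (\<Sum>i<n. dist (u i) (u (Suc i)))" for u :: "nat \<Rightarrow> 'a::metric_space"
proof (induction n)
  case (Suc n)
  then show ?case using dist_triangle[of "u 0" "u (Suc n)" "u n"] by simp
qed simp

lemma sum_odd: "a \<le> b \<Longrightarrow> (\<Sum>l=a..<b. if odd l then 1 else 0 :: real) = real (b div 2) - real (a div 2)"
proof (induction b rule: dec_induct)
  case (step b)
  have "real (Suc b div 2) = real (b div 2) + (if odd b then 1 else 0)" by auto
  then show ?case using step by (simp add: sum.atLeastLessThan_Suc)
qed simp

locale hyperbolic_action = hyperbolic_space X \<delta> + group G
  for X :: "'a::metric_space itself" and \<delta> :: real and G :: "('g, 'b) monoid_scheme" (structure) +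
  fixes \<Phi> :: "'g \<Rightarrow> 'a \<Rightarrow> 'a"
  assumes act_dist [simp]: "\<And>g x y. g \<in> carrier G \<Longrightarrow> dist (\<Phi> g x) (\<Phi> g y) = dist x y"
    and act_mult: "\<And>g h x. g \<in> carrier G \<Longrightarrow> h \<in> carrier G \<Longrightarrow> \<Phi> (g \<otimes> h) x = \<Phi> g (\<Phi> h x)"
    and act_one [simp]: "\<And>x. \<Phi> \<one> x = x"
begin

text \<open>Chains from \<open>x\<close> to \<open>y\<close> alternate between arbitrary moves (even steps) and jumps along
  translates of the pair \<open>(p, q)\<close> (odd steps). Every jump earns a discount \<open>W\<close>.\<close>

definition chain :: "'a \<Rightarrow> 'a \<Rightarrow> 'a \<Rightarrow> 'a \<Rightarrow> nat \<Rightarrow> (nat \<Rightarrow> 'a) \<Rightarrow> bool"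
  where "chain p q x y n u \<longleftrightarrow> u 0 = x \<and> u (2 * n + 1) = y \<and>
    (\<forall>k<n. \<exists>g\<in>carrier G. u (2 * k + 1) = \<Phi> g p \<and> u (2 * k + 2) = \<Phi> g q)"

definition step_cost :: "real \<Rightarrow> (nat \<Rightarrow> 'a) \<Rightarrow> nat \<Rightarrow> real"
  where "step_cost W u i = dist (u i) (u (Suc i)) - (if odd i then W else 0)"

definition cost :: "real \<Rightarrow> nat \<Rightarrow> (nat \<Rightarrow> 'a) \<Rightarrow> real"
  where "cost W n u = (\<Sum>i<2 * n + 1. step_cost W u i)"

definition mdist :: "real \<Rightarrow> 'a \<Rightarrow> 'a \<Rightarrow> 'a \<Rightarrow> 'a \<Rightarrow> real"
  where "mdist W p q x y = Inf {cost W n u | n u. chain p q x y n u}"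

text \<open>A jump then costs at least \<open>W + 1\<close> and at least half its length, so
  discounts neither make costs negative nor shrink distances by more than a factor 2.\<close>

definition admissible :: "real \<Rightarrow> 'a \<Rightarrow> 'a \<Rightarrow> bool"
  where "admissible W p q \<longleftrightarrow> 1 \<le> W \<and> 2 * W + 1 \<le> dist p q"

lemma chain_jump:
  assumes "chain p q x y n u" "i < 2 * n + 1" "odd i"
  shows "\<exists>g\<in>carrier G. u i = \<Phi> g p \<and> u (Suc i) = \<Phi> g q" "dist (u i) (u (Suc i)) = dist p q"
proof -
  obtain k where k: "i = 2 * k + 1" using \<open>odd i\<close> by (rule oddE)
  then have "k < n" using assms(2) by simp
  then show "\<exists>g\<in>carrier G. u i = \<Phi> g p \<and> u (Suc i) = \<Phi> g q"
    using assms(1) k unfolding chain_def by simp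
  then show "dist (u i) (u (Suc i)) = dist p q" by auto
qed

lemma step_cost_ge_half:
  assumes "admissible W p q" "chain p q x y n u" "i < 2 * n + 1"
  shows "dist (u i) (u (Suc i)) / 2 \<le> step_cost W u i"
  using chain_jump(2)[OF assms(2,3)] assms(1) unfolding step_cost_def admissible_def by (auto simp: field_simps)

lemma cost_ge_half:
  assumes "admissible W p q" "chain p q x y n u"
  shows "dist x y / 2 \<le> cost W n u"
proof -
  have "dist x y \<le> (\<Sum>i<2 * n + 1. dist (u i) (u (Suc i)))"
    using dist_le_sum[of u "2 * n + 1"] assms(2) unfolding chain_def by simp
  then have "dist x y / 2 \<le> (\<Sum>i<2 * n + 1. dist (u i) (u (Suc i)) / 2)" by (simp add: sum_divide_distrib[symmetric] divide_right_mono)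
  also have "\<dots> \<le> cost W n u" unfolding cost_def using step_cost_ge_half[OF assms] by (intro sum_mono) auto
  finally show ?thesis .
qed

lemma chain_trivial: "chain p q x y 0 (\<lambda>i. if i = 0 then x else y)" "cost W 0 (\<lambda>i. if i = 0 then x else y) = dist x y"
  by (auto simp: chain_def cost_def step_cost_def)

lemma mdist_le_cost:
  assumes "admissible W p q" "chain p q x y n u"
  shows "mdist W p q x y \<le> cost W n u"
proof -
  have "bdd_below {cost W n u | n u. chain p q x y n u}"
    using cost_ge_half[OF assms(1)] by (intro bdd_belowI[of _ "dist x y / 2"]) auto
  then show ?thesis unfolding mdist_def using assms(2) by (intro cInf_lower) auto
qed

lemma mdist_approx:
  assumes "admissible W p q" "0 < e"
  obtains n u where "chain p q x y n u" "cost W n u < mdist W p q x y + e"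
proof -
  have "{cost W n u | n u. chain p q x y n u} \<noteq> {}" using chain_trivial by blast
  moreover have "Inf {cost W n u | n u. chain p q x y n u} < mdist W p q x y + e" using assms by (simp add: mdist_def)
  ultimately show ?thesis using cInf_lessD that by (smt (verit) mem_Collect_eq)
qed

lemma mdist_le_dist: "admissible W p q \<Longrightarrow> mdist W p q x y \<le> dist x y"
  using mdist_le_cost[OF _ chain_trivial(1)] chain_trivial(2) by metis

lemma mdist_ge_half:
  assumes "admissible W p q"
  shows "dist x y / 2 \<le> mdist W p q x y"
  unfolding mdist_def
proof (rule cInf_greatest)
  show "{cost W n u | n u. chain p q x y n u} \<noteq> {}" using chain_trivial by blast
qed (use cost_ge_half[OF assms] in blast)

lemma mdist_jump:
  assumes "admissible W p q" "g \<in> carrier G"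
  shows "mdist W p q (\<Phi> g p) (\<Phi> g q) \<le> dist p q - W"
proof -
  define u where "u = (\<lambda>i::nat. if i \<le> 1 then \<Phi> g p else \<Phi> g q)"
  have "chain p q (\<Phi> g p) (\<Phi> g q) 1 u" using assms(2) by (auto simp: chain_def u_def)
  moreover have "cost W 1 u = dist p q - W"
    using assms(2) by (simp add: cost_def step_cost_def u_def eval_nat_numeral)
  ultimately show ?thesis using mdist_le_cost[OF assms(1)] by metis
qed

lemma mdist_triangle:
  assumes adm: "admissible W p q"
  shows "mdist W p q x z \<le> mdist W p q x y + mdist W p q y z"
proof (rule field_le_epsilon)
  fix e :: real assume "0 < e"
  then have e: "0 < e / 2" by simp
  obtain n u where u: "chain p q x y n u" "cost W n u < mdist W p q x y + e / 2"
    by (rule mdist_approx[OF adm e])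
  obtain m v where v: "chain p q y z m v" "cost W m v < mdist W p q y z + e / 2"
    by (rule mdist_approx[OF adm e])
  \<comment> \<open>The last free move of \<open>u\<close> and the first one of \<open>v\<close> are
    merged into one. This preserves the parity that distinguishes free moves from jumps.\<close>
  define w where "w = (\<lambda>i. if i \<le> 2 * n then u i else v (i - 2 * n))"
  have "chain p q x z (n + m) w"
    unfolding chain_def
  proof (intro conjI allI impI)
    show "w 0 = x" "w (2 * (n + m) + 1) = z" using u v by (auto simp: chain_def w_def)
    fix k assume k: "k < n + m"
    show "\<exists>g\<in>carrier G. w (2 * k + 1) = \<Phi> g p \<and> w (2 * k + 2) = \<Phi> g q"
    proof (cases "k < n")
      case True
      then show ?thesis using u(1) by (auto simp: chain_def w_def)
    next
      case False
      then have "\<exists>g\<in>carrier G. v (2 * (k - n) + 1) = \<Phi> g p \<and> v (2 * (k - n) + 2) = \<Phi> g q"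
        using v(1) k unfolding chain_def by auto
      moreover have "2 * k + 1 - 2 * n = 2 * (k - n) + 1" "2 * k + 2 - 2 * n = 2 * (k - n) + 2" using False by auto
      ultimately show ?thesis using False by (simp add: w_def)
    qed
  qed
  then have "mdist W p q x z \<le> cost W (n + m) w" by (rule mdist_le_cost[OF adm])
  also have "cost W (n + m) w \<le> cost W n u + cost W m v"
  proof -
    have "cost W (n + m) w = (\<Sum>i<2 * n. step_cost W w i) + (\<Sum>i=2 * n..<2 * n + (2 * m + 1). step_cost W w i)"
      unfolding cost_def by (simp add: sum.atLeastLessThan_concat[symmetric] lessThan_atLeast0 add.assoc)
    also have "(\<Sum>i<2 * n. step_cost W w i) = (\<Sum>i<2 * n. step_cost W u i)"
      by (intro sum.cong) (auto simp: step_cost_def w_def)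
    also have "(\<Sum>i=2 * n..<2 * n + (2 * m + 1). step_cost W w i) = (\<Sum>i<2 * m + 1. step_cost W w (2 * n + i))"
      using sum.shift_bounds_nat_ivl[of "step_cost W w" 0 "2 * n" "2 * m + 1"]
      by (simp add: lessThan_atLeast0 add.commute)
    also have "\<dots> = step_cost W w (2 * n) + (\<Sum>i<2 * m. step_cost W w (2 * n + Suc i))"
      by (simp add: sum.lessThan_Suc_shift del: sum.lessThan_Suc)
    also have "(\<Sum>i<2 * m. step_cost W w (2 * n + Suc i)) = (\<Sum>i<2 * m. step_cost W v (Suc i))"
      by (intro sum.cong) (auto simp: step_cost_def w_def)
    also have "step_cost W w (2 * n) \<le> step_cost W u (2 * n) + step_cost W v 0"
    proof -
      have "dist (u (2 * n)) (v 1) \<le> dist (u (2 * n)) (u (2 * n + 1)) + dist (v 0) (v 1)"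
        using u(1) v(1) dist_triangle[of "u (2 * n)" "v 1" y] by (simp add: chain_def)
      then show ?thesis by (simp add: step_cost_def w_def)
    qed
    finally show ?thesis by (simp add: cost_def sum.lessThan_Suc_shift[of _ "2 * m"] del: sum.lessThan_Suc)
        (simp add: sum.lessThan_Suc)
  qed
  finally show "mdist W p q x z \<le> mdist W p q x y + mdist W p q y z + e" using u v by simp
qed

lemma mdist_act_le:
  assumes adm: "admissible W p q" and h: "h \<in> carrier G"
  shows "mdist W p q (\<Phi> h x) (\<Phi> h y) \<le> mdist W p q x y"
proof (rule field_le_epsilon)
  fix e :: real assume e: "0 < e"
  obtain n u where u: "chain p q x y n u" "cost W n u < mdist W p q x y + e"
    by (rule mdist_approx[OF adm e])
  have "chain p q (\<Phi> h x) (\<Phi> h y) n (\<lambda>i. \<Phi> h (u i))"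
    unfolding chain_def
  proof (intro conjI allI impI)
    fix k assume "k < n"
    then obtain g where "g \<in> carrier G" "u (2 * k + 1) = \<Phi> g p \<and> u (2 * k + 2) = \<Phi> g q"
      using u(1) unfolding chain_def by blast
    then show "\<exists>g\<in>carrier G. \<Phi> h (u (2 * k + 1)) = \<Phi> g p \<and> \<Phi> h (u (2 * k + 2)) = \<Phi> g q"
      using h by (intro bexI[of _ "h \<otimes> g"]) (auto simp: act_mult)
  qed (use u(1) in \<open>auto simp: chain_def\<close>)
  moreover have "cost W n (\<lambda>i. \<Phi> h (u i)) = cost W n u" using h by (simp add: cost_def step_cost_def)
  ultimately show "mdist W p q (\<Phi> h x) (\<Phi> h y) \<le> mdist W p q x y + e" using mdist_le_cost[OF adm] u(2) by (metis less_imp_le order_trans)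
qed

lemma act_inv [simp]: "g \<in> carrier G \<Longrightarrow> \<Phi> (inv g) (\<Phi> g x) = x" "g \<in> carrier G \<Longrightarrow> \<Phi> g (\<Phi> (inv g) x) = x"
  by (simp_all add: act_mult[symmetric])

lemma mdist_act:
  assumes "admissible W p q" "h \<in> carrier G"
  shows "mdist W p q (\<Phi> h x) (\<Phi> h y) = mdist W p q x y"
  using mdist_act_le[OF assms, of x y] mdist_act_le[OF assms(1), of "inv h" "\<Phi> h x" "\<Phi> h y"] assms(2) by simp

lemma mdist_chain_segment:
  assumes adm: "admissible W p q" and u: "chain p q x y n u" and "i \<le> j" "j \<le> 2 * n + 1"
  shows "mdist W p q (u i) (u j) \<le> (\<Sum>l=i..<j. step_cost W u l)"
  using \<open>i \<le> j\<close> \<open>j \<le> 2 * n + 1\<close>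
proof (induction j rule: dec_induct)
  case base
  then show ?case using mdist_le_dist[OF adm, of "u i" "u i"] by simp
next
  case (step j)
  have "mdist W p q (u j) (u (Suc j)) \<le> step_cost W u j"
  proof (cases "odd j")
    case True
    then obtain g where "g \<in> carrier G" "u j = \<Phi> g p" "u (Suc j) = \<Phi> g q"
      using chain_jump(1)[OF u, of j] step by auto
    then show ?thesis using mdist_jump[OF adm] True by (simp add: step_cost_def)
  next
    case False
    then show ?thesis using mdist_le_dist[OF adm] by (simp add: step_cost_def)
  qed
  then show ?case using step mdist_triangle[OF adm, of "u i" "u (Suc j)" "u j"] by simp
qed

lemma cost_split:
  assumes "i \<le> j" "j \<le> 2 * n + 1"
  shows "cost W n u = (\<Sum>l=0..<i. step_cost W u l) + (\<Sum>l=i..<j. step_cost W u l) + (\<Sum>l=j..<2 * n + 1. step_cost W u l)"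
  using assms unfolding cost_def lessThan_atLeast0
  by (simp add: sum.atLeastLessThan_concat del: sum.op_ivl_Suc)

text \<open>A shortcut through \<open>m\<close> and \<open>m'\<close> saves less than 1 against a
  near-minimal chain. Every second step is a jump of cost at least 1, so the part that the shortcut
  skips has few steps.\<close>

lemma near_minimal_count:
  assumes adm: "admissible W p q" and u: "chain p q x y n u" and min: "cost W n u < mdist W p q x y + 1"
    and ij: "i < j" "j < 2 * n + 1" and m: "between (u i) m (u (Suc i))" "between (u j) m' (u (Suc j))"
  shows "real j - real i \<le> 2 * dist m m' + (4 * W + 4)"
proof -
  let ?s = "step_cost W u" and ?d = "mdist W p q"
  have W: "1 \<le> W" "2 * W + 1 \<le> dist p q" using adm by (auto simp: admissible_def)
  have "?d x y \<le> ?d x (u i) + ?d (u i) m + ?d m m' + ?d m' (u (Suc j)) + ?d (u (Suc j)) y"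
    using mdist_triangle[OF adm, of x y "u i"] mdist_triangle[OF adm, of "u i" y m]
      mdist_triangle[OF adm, of m y m'] mdist_triangle[OF adm, of m' y "u (Suc j)"] by linarith
  moreover have "?d x (u i) \<le> (\<Sum>l=0..<i. ?s l)" "?d (u (Suc j)) y \<le> (\<Sum>l=Suc j..<2 * n + 1. ?s l)"
    using mdist_chain_segment[OF adm u, of 0 i] mdist_chain_segment[OF adm u, of "Suc j" "2 * n + 1"] ij u
    by (auto simp: chain_def)
  moreover have "?d (u i) m \<le> dist (u i) m" "?d m m' \<le> dist m m'" "?d m' (u (Suc j)) \<le> dist m' (u (Suc j))"
    using mdist_le_dist[OF adm] by auto
  moreover have "cost W n u = (\<Sum>l=0..<i. ?s l) + (\<Sum>l=i..<Suc j. ?s l) + (\<Sum>l=Suc j..<2 * n + 1. ?s l)"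
    using ij by (intro cost_split) auto
  ultimately have "(\<Sum>l=i..<Suc j. ?s l) < dist (u i) m + dist m m' + dist m' (u (Suc j)) + 1"
    using min by linarith
  moreover have "(\<Sum>l=i..<Suc j. ?s l) = ?s i + (\<Sum>l=Suc i..<j. ?s l) + ?s j"
    using ij by (simp add: sum.atLeast_Suc_lessThan)
  moreover have "dist (u i) m - W \<le> ?s i" "dist m' (u (Suc j)) - W \<le> ?s j"
  proof -
    have "dist (u i) m \<le> dist (u i) (u (Suc i))" "dist m' (u (Suc j)) \<le> dist (u j) (u (Suc j))"
      using m unfolding between_def by (metis zero_le_dist le_add_same_cancel1 le_add_same_cancel2)+
    then show "dist (u i) m - W \<le> ?s i" "dist m' (u (Suc j)) - W \<le> ?s j"
      using W unfolding step_cost_def by auto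
  qed
  moreover have "(\<Sum>l=Suc i..<j. if odd l then 1 else 0) \<le> (\<Sum>l=Suc i..<j. ?s l)"
  proof (intro sum_mono)
    fix l assume "l \<in> {Suc i..<j}"
    then show "(if odd l then 1 else 0) \<le> ?s l"
      using chain_jump(2)[OF u, of l] ij W by (auto simp: step_cost_def)
  qed
  moreover have "(\<Sum>l=Suc i..<j. if odd l then 1 else 0 :: real) = real (j div 2) - real (Suc i div 2)"
    using ij by (intro sum_odd) auto
  moreover have "real j \<le> 2 * real (j div 2) + 1" "2 * real (Suc i div 2) \<le> real i + 1" by linarith+
  ultimately show ?thesis by argo
qed

text \<open>A near-minimal chain has a step close to \<open>z\<close>; cutting it there costs the
  detour to \<open>z\<close> and at most the discount of that step. That \<open>C\<close> precedes
  \<open>p\<close> and \<open>q\<close> is essential for the later choice of words.\<close>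

lemma mdist_almost_additive:
  assumes W: "1 \<le> W"
  shows "\<exists>C\<ge>0. \<forall>p q x y z c. admissible W p q \<and> gp z x y \<le> c \<longrightarrow>
    mdist W p q x z + mdist W p q z y \<le> mdist W p q x y + C + 2 * c"
proof -
  have "(0::real) \<le> 2" "0 \<le> 4 * W + 4" using W by auto
  then obtain R where R: "0 \<le> R" "\<forall>(u::nat \<Rightarrow> 'a) n w. 0 < n \<and>
      (\<forall>i j m m'. i < j \<and> j < n \<and> between (u i) m (u (Suc i)) \<and> between (u j) m' (u (Suc j)) \<longrightarrow>
        real j - real i \<le> 2 * dist m m' + (4 * W + 4)) \<and> between (u 0) w (u n) \<longrightarrow>
      (\<exists>i<n. gp w (u i) (u (Suc i)) \<le> R)"
    using chain_near_segment[of 2 "4 * W + 4"] by blast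
  define C where "C = 1 + W + 2 * R + 4 * \<delta>"
  have "mdist W p q x z + mdist W p q z y \<le> mdist W p q x y + C + 2 * c"
    if adm: "admissible W p q" and c: "gp z x y \<le> c" for p q x y z c
  proof -
    let ?s = "step_cost W" and ?d = "mdist W p q"
    obtain n u where u: "chain p q x y n u" "cost W n u < ?d x y + 1"
      by (rule mdist_approx[OF adm zero_less_one])
    obtain w where w: "between x w y" "dist z w \<le> gp z x y + 2 * \<delta>" using near_segment by blast
    have "\<exists>i<2 * n + 1. gp w (u i) (u (Suc i)) \<le> R"
      using near_minimal_count[OF adm u] w(1) u(1)
      by (intro R(2)[rule_format]) (auto simp: chain_def)
    then obtain i where i: "i < 2 * n + 1" "gp w (u i) (u (Suc i)) \<le> R" by blast
    then have "gp z (u i) (u (Suc i)) \<le> R + c + 2 * \<delta>"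
      using gp_move[of z "u i" "u (Suc i)" w] w(2) c by linarith
    then have "dist (u i) z + dist z (u (Suc i)) \<le> dist (u i) (u (Suc i)) + 2 * (R + c + 2 * \<delta>)"
      unfolding gp_def by (simp add: dist_commute field_simps)
    moreover have "dist (u i) (u (Suc i)) \<le> ?s u i + W" using W by (simp add: step_cost_def)
    moreover have "?d x z \<le> (\<Sum>l=0..<i. ?s u l) + dist (u i) z"
      using mdist_triangle[OF adm, of x z "u i"] mdist_chain_segment[OF adm u(1), of 0 i] mdist_le_dist[OF adm, of "u i" z]
        i(1) u(1) by (simp add: chain_def)
    moreover have "?d z y \<le> dist z (u (Suc i)) + (\<Sum>l=Suc i..<2 * n + 1. ?s u l)"
      using mdist_triangle[OF adm, of z y "u (Suc i)"] mdist_chain_segment[OF adm u(1), of "Suc i" "2 * n + 1"]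
        mdist_le_dist[OF adm, of z "u (Suc i)"] i(1) u(1) by (simp add: chain_def)
    moreover have "cost W n u = (\<Sum>l=0..<i. ?s u l) + (\<Sum>l=i..<Suc i. ?s u l) + (\<Sum>l=Suc i..<2 * n + 1. ?s u l)"
      using i(1) by (intro cost_split) auto
    ultimately show ?thesis using u(2) unfolding C_def by simp
  qed
  moreover have "0 \<le> C" using W R(1) \<delta>_nonneg by (simp add: C_def)
  ultimately show ?thesis by blast
qed

text \<open>A geometric form of the Brooks counting quasi-homomorphism: \<open>dist\<close> is
  symmetric and cancels, leaving what is saved on the way back to \<open>v\<close> minus what is
  saved on the way out.\<close>

definition brooks :: "real \<Rightarrow> 'a \<Rightarrow> 'a \<Rightarrow> 'a \<Rightarrow> 'g \<Rightarrow> real"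
  where "brooks W p q v g = mdist W p q v (\<Phi> g v) - mdist W p q (\<Phi> g v) v"

text \<open>Splitting each of the six directed sides of the triangle at its center costs at most
  \<open>C + 2 * \<delta>\<close>, and the twelve legs cancel.\<close>

lemma brooks_quasi_hom:
  assumes adm: "admissible W p q"
  shows "\<exists>C. \<forall>g\<in>carrier G. \<forall>h\<in>carrier G. \<bar>brooks W p q v (g \<otimes> h) - brooks W p q v g - brooks W p q v h\<bar> \<le> C"
proof -
  let ?d = "mdist W p q"
  have W: "1 \<le> W" using adm by (simp add: admissible_def)
  obtain C where C: "0 \<le> C" "\<And>p q x y z c. admissible W p q \<Longrightarrow> gp z x y \<le> c \<Longrightarrow>
      mdist W p q x z + mdist W p q z y \<le> mdist W p q x y + C + 2 * c"
    using mdist_almost_additive[OF W] by blast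
  have "\<bar>brooks W p q v (g \<otimes> h) - brooks W p q v g - brooks W p q v h\<bar> \<le> 6 * (C + 2 * \<delta>)"
    if g: "g \<in> carrier G" and h: "h \<in> carrier G" for g h
  proof -
    define y z where "y = \<Phi> g v" and "z = \<Phi> (g \<otimes> h) v"
    have h': "brooks W p q v h = ?d y z - ?d z y"
      unfolding brooks_def y_def z_def using g h by (simp add: act_mult mdist_act[OF adm])
    obtain m where m: "gp m v y \<le> \<delta>" "gp m y z \<le> \<delta>" "gp m v z \<le> \<delta>" using center by blast
    have *: "\<bar>?d a m + ?d m b - ?d a b\<bar> \<le> C + 2 * \<delta>" if "gp m a b \<le> \<delta>" for a b
      using C(2)[OF adm that] mdist_triangle[OF adm, of a b m] C(1) \<delta>_nonneg by (auto simp: abs_le_iff)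
    have **: "\<bar>?d a m + ?d m b - ?d a b\<bar> \<le> C + 2 * \<delta>" "\<bar>?d b m + ?d m a - ?d b a\<bar> \<le> C + 2 * \<delta>"
      if "gp m a b \<le> \<delta>" for a b using * that by (auto simp: gp_commute)
    show ?thesis
      using **[OF m(1)] **[OF m(2)] **[OF m(3)] h'
      unfolding brooks_def y_def[symmetric] z_def[symmetric] by argo
  qed
  then show ?thesis by blast
qed

text \<open>A chain that beats \<open>dist\<close> contains a jump. The endpoints of this jump are
  close to a geodesic from \<open>x\<close> to \<open>y\<close>: almost additivity at a center of
  the triangle bounds the round trip between them and that center.\<close>

lemma mdist_less_dist:
  assumes W: "1 \<le> W"
  shows "\<exists>e\<ge>0. \<forall>p q x y. admissible W p q \<and> mdist W p q x y \<noteq> dist x y \<longrightarrow>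
    (\<exists>g\<in>carrier G. dist x (\<Phi> g p) + dist p q + dist (\<Phi> g q) y \<le> dist x y + e)"
proof -
  obtain C where C: "0 \<le> C" "\<And>p q x y z c. admissible W p q \<Longrightarrow> gp z x y \<le> c \<Longrightarrow>
      mdist W p q x z + mdist W p q z y \<le> mdist W p q x y + C + 2 * c"
    using mdist_almost_additive[OF W] by blast
  define e where "e = \<delta> + 1 + 2 * (C + 2 * \<delta>)"
  have turn: "gp z x y \<le> e"
    if adm: "admissible W p q" and z: "mdist W p q x z + mdist W p q z y \<le> mdist W p q x y + 1" for p q x y z
  proof -
    let ?d = "mdist W p q"
    obtain m where m: "gp m x y \<le> \<delta>" "gp m y z \<le> \<delta>" "gp m x z \<le> \<delta>" using center by blast
    have "?d x m + ?d m z \<le> ?d x z + C + 2 * \<delta>" "?d z m + ?d m y \<le> ?d z y + C + 2 * \<delta>"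
      using C(2)[OF adm] m by (auto simp: gp_commute)
    moreover have "?d x y \<le> ?d x m + ?d m y" by (rule mdist_triangle[OF adm])
    moreover have "dist m z / 2 \<le> ?d m z" "dist m z / 2 \<le> ?d z m"
      using mdist_ge_half[OF adm, of m z] mdist_ge_half[OF adm, of z m] by (simp_all add: dist_commute)
    ultimately have "dist z m \<le> 1 + 2 * (C + 2 * \<delta>)" using z unfolding dist_commute[of z m] by argo
    then show ?thesis using m(1) gp_move[of z x y m] unfolding e_def by linarith
  qed
  have "\<exists>g\<in>carrier G. dist x (\<Phi> g p) + dist p q + dist (\<Phi> g q) y \<le> dist x y + 4 * e"
    if adm: "admissible W p q" and ne: "mdist W p q x y \<noteq> dist x y" for p q x y
  proof -
    let ?d = "mdist W p q" and ?s = "step_cost W"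
    \<comment> \<open>An error below the saving keeps the cost below \<open>dist x y\<close>, which
      rules out chains without jumps; an error below 1 keeps the chain near-minimal.\<close>
    have "0 < min 1 (dist x y - ?d x y)" using mdist_le_dist[OF adm, of x y] ne by auto
    then obtain n u where u: "chain p q x y n u" "cost W n u < ?d x y + min 1 (dist x y - ?d x y)"
      by (rule mdist_approx[OF adm])
    have n: "n \<noteq> 0"
    proof
      assume "n = 0"
      then have "cost W n u = dist x y" using u(1) by (simp add: chain_def cost_def step_cost_def)
      then show False using u(2) by linarith
    qed
    then obtain g where g: "g \<in> carrier G" "u 1 = \<Phi> g p" "u 2 = \<Phi> g q"
      using chain_jump(1)[OF u(1), of 1] by (auto simp: eval_nat_numeral)
    have "cost W n u = (\<Sum>l=0..<1. ?s u l) + (\<Sum>l=1..<2. ?s u l) + (\<Sum>l=2..<2 * n + 1. ?s u l)"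
      using n by (intro cost_split) auto
    moreover have "?d x (u 1) \<le> (\<Sum>l=0..<1. ?s u l)" "?d (u 1) (u 2) \<le> (\<Sum>l=1..<2. ?s u l)"
      "?d (u 2) y \<le> (\<Sum>l=2..<2 * n + 1. ?s u l)"
      using mdist_chain_segment[OF adm u(1), of 0 1] mdist_chain_segment[OF adm u(1), of 1 2]
        mdist_chain_segment[OF adm u(1), of 2 "2 * n + 1"] n u(1) by (auto simp: chain_def)
    ultimately have total: "?d x (u 1) + ?d (u 1) (u 2) + ?d (u 2) y \<le> ?d x y + 1" using u(2) by linarith
    have "gp (u 2) x y \<le> e"
      using total mdist_triangle[OF adm, of x "u 2" "u 1"] by (intro turn[OF adm]) linarith
    moreover have "gp (u 1) x (u 2) \<le> e"
      using total mdist_triangle[OF adm, of x y "u 2"] by (intro turn[OF adm]) linarith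
    ultimately have "dist x (u 1) + dist (u 1) (u 2) + dist (u 2) y \<le> dist x y + 4 * e"
      unfolding gp_def by (simp add: dist_commute field_simps)
    then show ?thesis using g by auto
  qed
  moreover have "0 \<le> 4 * e" using C(1) \<delta>_nonneg by (simp add: e_def)
  ultimately show ?thesis by blast
qed

end

section \<open>Words in two inequivalent elements\<close>

lemma discrete_ivt:
  fixes f :: "nat \<Rightarrow> real"
  assumes "\<And>j. j < J \<Longrightarrow> \<bar>f (Suc j) - f j\<bar> \<le> s" "f 0 \<le> t" "t \<le> f J" "0 \<le> s"
  shows "\<exists>j\<le>J. \<bar>f j - t\<bar> \<le> s"
proof -
  define j where "j = (LEAST j. t \<le> f j)"
  have j: "t \<le> f j" "j \<le> J" unfolding j_def using assms(3) by (auto intro: LeastI Least_le)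
  show ?thesis
  proof (cases j)
    case 0
    then show ?thesis using j assms by (intro exI[of _ 0]) auto
  next
    case (Suc i)
    then have "\<not> t \<le> f i" using not_less_Least[of i "\<lambda>j. t \<le> f j"] unfolding j_def by simp
    then show ?thesis using j Suc assms(1)[of i] by (intro exI[of _ j]) auto
  qed
qed

lemma discrete_ivt_decreasing:
  fixes f :: "nat \<Rightarrow> real"
  assumes "\<And>j. j < J \<Longrightarrow> \<bar>f (Suc j) - f j\<bar> \<le> s" "t \<le> f 0" "f J \<le> t" "0 \<le> s"
  shows "\<exists>j\<le>J. \<bar>f j - t\<bar> \<le> s"
proof -
  have "\<exists>j\<le>J. \<bar>(- f j) - (- t)\<bar> \<le> s"
    using assms by (intro discrete_ivt) (auto simp: abs_minus_commute)
  then show ?thesis by (auto simp: abs_minus_commute)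
qed

context hyperbolic_action
begin

definition displ :: "'a \<Rightarrow> 'g \<Rightarrow> real"
  where "displ v g = dist v (\<Phi> g v)"

lemma displ_nonneg: "0 \<le> displ v g"
  by (simp add: displ_def)

lemma displ_one [simp]: "displ v \<one> = 0"
  by (simp add: displ_def)

lemma displ_mult: "g \<in> carrier G \<Longrightarrow> h \<in> carrier G \<Longrightarrow> displ v (g \<otimes> h) \<le> displ v g + displ v h"
  using dist_triangle[of v "\<Phi> g (\<Phi> h v)" "\<Phi> g v"] by (simp add: displ_def act_mult)

lemma dist_act_move: "g \<in> carrier G \<Longrightarrow> dist x (\<Phi> g y) = dist (\<Phi> (inv g) x) y"
  using act_dist[of "inv g" x "\<Phi> g y"] by simp

lemma dist_act_right: "g \<in> carrier G \<Longrightarrow> h \<in> carrier G \<Longrightarrow> dist (\<Phi> g v) (\<Phi> (g \<otimes> h) v) = displ v h"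
  by (simp add: displ_def act_mult)

lemma displ_inv [simp]: "g \<in> carrier G \<Longrightarrow> displ v (inv g) = displ v g"
  using act_dist[of g v "\<Phi> (inv g) v"] by (simp add: displ_def dist_commute)

lemma displ_pow_inv [simp]: "g \<in> carrier G \<Longrightarrow> displ v (inv g [^] (n::nat)) = displ v (g [^] n)"
  by (simp add: nat_pow_inv)

lemma displ_pow_le: "g \<in> carrier G \<Longrightarrow> displ v (g [^] (n::nat)) \<le> n * displ v g"
proof (induction n)
  case (Suc n)
  then show ?case using displ_mult[of "g [^] n" g v] by (simp add: algebra_simps)
qed simp

lemma close_points:
  fixes x y z z' :: 'a
  assumes "dist x z + dist z y \<le> dist x y + e" "dist x z' + dist z' y \<le> dist x y + e"
    "\<bar>dist x z - dist x z'\<bar> \<le> s"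
  shows "dist z z' \<le> s + e + 2 * \<delta>"
  using four_points[of z z' x y] assms by (auto simp: dist_commute max_def split: if_splits)

end

text \<open>Inequivalence and independence of \<open>g1\<close> and \<open>g2\<close>, expressed by the orbit of the base point
  \<open>v\<close>: assumption \<open>inequivalent\<close> says that long positive powers of \<open>g1\<close> are never coarsely parallel
  to positive powers of \<open>g2\<close>.\<close>

locale inequivalent_pair = hyperbolic_action X \<delta> G \<Phi>
  for X :: "'a::metric_space itself" and \<delta> :: real and G :: "('g, 'b) monoid_scheme" (structure)
    and \<Phi> :: "'g \<Rightarrow> 'a \<Rightarrow> 'a" +
  fixes v :: 'a and g1 g2 :: 'g and A :: real
  assumes closed [simp]: "g1 \<in> carrier G" "g2 \<in> carrier G"
    and growth: "\<And>u T. u \<in> {g1, g2} \<Longrightarrow> \<exists>n0. \<forall>n\<ge>n0. T \<le> displ v (u [^] (n::nat))"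
    and superadditive: "\<And>u m n. u \<in> {g1, g2} \<Longrightarrow>
      displ v (u [^] (m::nat)) + displ v (u [^] (n::nat)) \<le> displ v (u [^] (m + n)) + 2 * A"
    and transverse:
      "\<And>m n. displ v (g1 [^] (m::nat)) + displ v (g2 [^] (n::nat)) \<le> displ v (g1 [^] m \<otimes> g2 [^] n) + 2 * A"
      "\<And>m n. displ v (g2 [^] (m::nat)) + displ v (g1 [^] (n::nat)) \<le> displ v (g2 [^] m \<otimes> g1 [^] n) + 2 * A"
    and inequivalent: "\<And>R. \<exists>N. \<forall>g\<in>carrier G. \<forall>n\<ge>N. \<forall>m.
      \<not> (displ v g \<le> R \<and> dist (\<Phi> g (\<Phi> (g1 [^] (n::nat)) v)) (\<Phi> (g2 [^] (m::nat)) v) \<le> R)"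
begin

abbreviation pt :: "'g \<Rightarrow> 'a" where "pt g \<equiv> \<Phi> g v"
abbreviation nm :: "'g \<Rightarrow> real" where "nm g \<equiv> displ v g"

definition letters :: "'g set"
  where "letters = {g1, g2, inv g1, inv g2}"

lemma letters_closed [simp]: "u \<in> letters \<Longrightarrow> u \<in> carrier G"
  by (auto simp: letters_def)

lemma A_nonneg: "0 \<le> A"
  using superadditive[of g1 0 0] by simp

text \<open>The summand 1 makes this bound positive, so that it can be cancelled to compare
  exponents.\<close>

definition speed :: real
  where "speed = nm g1 + nm g2 + 1"

lemma speed_pos: "0 < speed"
  using displ_nonneg[of v g1] displ_nonneg[of v g2] by (simp add: speed_def)

lemma nm_letter: "u \<in> letters \<Longrightarrow> nm u \<le> speed"
  using displ_nonneg[of v g1] displ_nonneg[of v g2] by (auto simp: letters_def speed_def)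

lemma nm_letter_pow: "u \<in> letters \<Longrightarrow> nm (u [^] (n::nat)) \<le> n * speed"
  using displ_pow_le[of u v n] mult_left_mono[OF nm_letter[of u], of n] by simp

lemma long_letter_pow: "\<exists>n. \<forall>u\<in>letters. T \<le> nm (u [^] (n::nat))"
proof -
  obtain n1 n2 where "\<forall>n\<ge>n1. T \<le> nm (g1 [^] (n::nat))" "\<forall>n\<ge>n2. T \<le> nm (g2 [^] (n::nat))"
    using growth[of g1 T] growth[of g2 T] by auto
  then show ?thesis by (intro exI[of _ "max n1 n2"]) (auto simp: letters_def)
qed

text \<open>A translate of a long \<open>\<tau>\<close>-segment cannot follow \<open>\<alpha>\<close> up to a point and \<open>\<beta>\<close> after it, where
  \<open>{\<alpha>, \<beta>} = {g1, g2}\<close>: shifting the segment by a power of \<open>\<tau>\<close> would make \<open>\<alpha>\<close> parallel to \<open>\<beta>\<close>.\<close>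

lemma no_double_parallel:
  assumes \<alpha>\<beta>: "\<alpha> = g1 \<and> \<beta> = g2 \<or> \<alpha> = g2 \<and> \<beta> = g1" and t: "t \<in> carrier G" and h: "h \<in> carrier G" and b: "b \<in> carrier G"
    and N: "\<And>g n m. g \<in> carrier G \<Longrightarrow> N \<le> n \<Longrightarrow>
      \<not> (nm g \<le> 2 * r \<and> dist (\<Phi> g (pt (g1 [^] (n::nat)))) (pt (g2 [^] (m::nat))) \<le> 2 * r)"
    and n: "N \<le> n" "N \<le> n'"
    and near: "dist (pt h) (pt b) \<le> r" "dist (\<Phi> h (pt (inv (\<alpha> [^] n)))) (\<Phi> b (pt (inv t))) \<le> r"
      "dist (\<Phi> h (pt (\<beta> [^] n'))) (\<Phi> b (pt t)) \<le> r"
  shows False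
proof -
  have c [simp]: "\<alpha> \<in> carrier G" "\<beta> \<in> carrier G" using \<alpha>\<beta> by auto
  note [simp] = t h b
  \<comment> \<open>\<open>s\<close> shifts the segment back by \<open>t\<close>, which carries the
    part following \<beta> onto the part following \<alpha>; \<open>k\<close> is the same motion
    brought to the base point.\<close>
  define s where "s = b \<otimes> inv t \<otimes> inv b"
  define k where "k = \<alpha> [^] n \<otimes> inv h \<otimes> s \<otimes> h"
  have s [simp]: "s \<in> carrier G" by (simp add: s_def)
  have k: "k \<in> carrier G" by (simp add: k_def)
  have s_act: "\<Phi> s (\<Phi> b x) = \<Phi> b (\<Phi> (inv t) x)" for x by (simp add: s_def act_mult)
  have k_act: "dist (\<Phi> (\<alpha> [^] n) x) (\<Phi> k y) = dist (\<Phi> h x) (\<Phi> s (\<Phi> h y))" for x y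
  proof -
    have "dist (\<Phi> (\<alpha> [^] n) x) (\<Phi> k y) = dist x (\<Phi> (inv h) (\<Phi> s (\<Phi> h y)))" by (simp add: k_def act_mult)
    then show ?thesis by (simp add: dist_act_move)
  qed
  have "dist (\<Phi> h (pt (inv (\<alpha> [^] n)))) (\<Phi> s (pt h)) \<le> r + dist (\<Phi> s (pt b)) (\<Phi> s (pt h))"
    using near(2) dist_triangle[of "\<Phi> h (pt (inv (\<alpha> [^] n)))" "\<Phi> s (pt h)" "\<Phi> s (pt b)"] by (simp add: s_act)
  then have k1: "nm k \<le> 2 * r"
    using near(1) k_act[of "pt (inv (\<alpha> [^] n))" v] by (simp add: displ_def dist_commute)
  have "dist (pt h) (\<Phi> s (\<Phi> h (pt (\<beta> [^] n')))) \<le> r + dist (\<Phi> s (\<Phi> b (pt t))) (\<Phi> s (\<Phi> h (pt (\<beta> [^] n'))))"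
    using near(1) dist_triangle[of "pt h" "\<Phi> s (\<Phi> h (pt (\<beta> [^] n')))" "pt b"] by (simp add: s_act)
  then have k2: "dist (pt (\<alpha> [^] n)) (\<Phi> k (pt (\<beta> [^] n'))) \<le> 2 * r"
    using near(3) by (simp add: k_act dist_commute)
  \<comment> \<open>The excluded pattern has \<open>g1\<close> on the moved side: \<open>k\<close>
    itself fits if \<beta> is \<open>g1\<close>, its inverse if \<alpha> is.\<close>
  from \<alpha>\<beta> show False
  proof
    assume "\<alpha> = g1 \<and> \<beta> = g2"
    then show False
      using N[of "inv k" n n'] k k1 k2 n dist_act_move[OF k, of "pt (g1 [^] n)" "pt (g2 [^] n')"] by simp
  next
    assume "\<alpha> = g2 \<and> \<beta> = g1"
    then show False using N[OF k n(2), of n] k1 k2 by (simp add: dist_commute)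
  qed
qed

text \<open>The geodesic from \<open>x\<close> to \<open>y\<close> passes close to \<open>pt h\<close>, arriving along \<open>\<alpha>\<close> and leaving along
  \<open>\<beta>\<close>.\<close>

definition corner :: "real \<Rightarrow> 'a \<Rightarrow> 'a \<Rightarrow> 'g \<Rightarrow> 'g \<Rightarrow> nat \<Rightarrow> 'g \<Rightarrow> nat \<Rightarrow> bool"
  where "corner E x y h \<alpha> nA \<beta> nB \<longleftrightarrow> h \<in> carrier G \<and> (\<alpha> = g1 \<and> \<beta> = g2 \<or> \<alpha> = g2 \<and> \<beta> = g1) \<and>
    (\<forall>n\<le>nA. dist x (\<Phi> h (pt (inv (\<alpha> [^] n)))) + nm (\<alpha> [^] n) + dist (pt h) y \<le> dist x y + E) \<and>
    (\<forall>n\<le>nB. dist x (pt h) + nm (\<beta> [^] n) + dist (\<Phi> h (pt (\<beta> [^] n))) y \<le> dist x y + E)"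

text \<open>The case \<open>i = j\<close> keeps the orbit points near a geodesic from
  \<open>x\<close> to \<open>y\<close>; the case \<open>i < j\<close> makes them advance towards
  \<open>y\<close>.\<close>

definition segment :: "real \<Rightarrow> 'a \<Rightarrow> 'a \<Rightarrow> 'g \<Rightarrow> 'g \<Rightarrow> nat \<Rightarrow> bool"
  where "segment E x y h \<tau> J \<longleftrightarrow> h \<in> carrier G \<and> \<tau> \<in> letters \<and> (\<forall>i j. i \<le> j \<and> j \<le> J \<longrightarrow>
    dist x (\<Phi> h (pt (\<tau> [^] i))) + nm (\<tau> [^] (j - i)) + dist (\<Phi> h (pt (\<tau> [^] j))) y \<le> dist x y + E)"

text \<open>Deep inside the segment, long powers of \<tau> would be available on both sides of the
  corner. Matched by their distance from \<open>x\<close>, they follow \<alpha> before the corner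
  and \<beta> after it, which \<open>no_double_parallel\<close> excludes.\<close>

lemma corner_not_inside_segment:
  "\<exists>N\<ge>0. \<forall>x y h \<alpha> nA \<beta> nB h' \<tau> J. corner E x y h \<alpha> nA \<beta> nB \<and> N \<le> nm (\<alpha> [^] nA) \<and> N \<le> nm (\<beta> [^] nB) \<and>
    segment E x y h' \<tau> J \<longrightarrow>
    dist x (pt h) < dist x (pt h') + N \<or> dist x (\<Phi> h' (pt (\<tau> [^] J))) < dist x (pt h) + N"
proof -
  define E' where "E' = max E 0"
  define r where "r = speed + E' + 2 * \<delta>"
  obtain NE :: nat where NE: "\<And>g n m. g \<in> carrier G \<Longrightarrow> NE \<le> n \<Longrightarrow>
      \<not> (nm g \<le> 2 * r \<and> dist (\<Phi> g (pt (g1 [^] (n::nat)))) (pt (g2 [^] (m::nat))) \<le> 2 * r)"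
    using inequivalent[of "2 * r"] by blast
  \<comment> \<open>Displacement \<Lambda> of the shift leaves the matched powers of \<alpha> and
    \<beta> at least \<open>\<Lambda> - 2 * r \<ge> NE * speed\<close>, so their exponents reach
    \<open>NE\<close>. It also exceeds \<open>speed + E'\<close>, which places the shifted points on
    the correct sides of the corner.\<close>
  define \<Lambda> where "\<Lambda> = speed + E' + 2 * r + NE * speed"
  obtain s :: nat where s: "\<And>u. u \<in> letters \<Longrightarrow> \<Lambda> \<le> nm (u [^] s)" using long_letter_pow by blast
  \<comment> \<open>At this depth there is room for \<open>s\<close> letters on either side of the
    matched point, along the segment and also along \<alpha> and \<beta>.\<close>
  define N where "N = real s * speed + 2 * speed + E'"
  have E': "E \<le> E'" "0 \<le> E'" by (auto simp: E'_def)
  have r0: "0 \<le> r" using speed_pos E' \<delta>_nonneg by (simp add: r_def)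
  have key: "dist x (pt h) < dist x (pt h') + N \<or> dist x (\<Phi> h' (pt (\<tau> [^] J))) < dist x (pt h) + N"
    if corner: "corner E x y h \<alpha> nA \<beta> nB" and long: "N \<le> nm (\<alpha> [^] nA)" "N \<le> nm (\<beta> [^] nB)"
      and segment: "segment E x y h' \<tau> J"
    for h h' \<tau> \<alpha> \<beta> nA nB J x y
  proof (rule ccontr)
    assume "\<not> ?thesis"
    then have deep: "dist x (pt h') + N \<le> dist x (pt h)" "dist x (pt h) + N \<le> dist x (\<Phi> h' (pt (\<tau> [^] J)))" by auto
    have h: "h \<in> carrier G" and h': "h' \<in> carrier G" and \<tau>: "\<tau> \<in> letters"
      and \<alpha>\<beta>: "\<alpha> = g1 \<and> \<beta> = g2 \<or> \<alpha> = g2 \<and> \<beta> = g1"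
      using corner segment unfolding corner_def segment_def by blast+
    have before: "dist x (\<Phi> h (pt (inv (\<alpha> [^] n)))) + nm (\<alpha> [^] n) + dist (pt h) y \<le> dist x y + E" if "n \<le> nA" for n
      using corner that unfolding corner_def by blast
    have after: "dist x (pt h) + nm (\<beta> [^] n) + dist (\<Phi> h (pt (\<beta> [^] n))) y \<le> dist x y + E" if "n \<le> nB" for n
      using corner that unfolding corner_def by blast
    have seg: "dist x (\<Phi> h' (pt (\<tau> [^] i))) + nm (\<tau> [^] (j - i)) + dist (\<Phi> h' (pt (\<tau> [^] j))) y \<le> dist x y + E"
      if "i \<le> j" "j \<le> J" for i j using segment that unfolding segment_def by blast
    have \<alpha>: "\<alpha> \<in> letters" "\<beta> \<in> letters" using \<alpha>\<beta> by (auto simp: letters_def)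
    note [simp] = letters_closed[OF \<tau>] letters_closed[OF \<alpha>(1)] letters_closed[OF \<alpha>(2)] h h'
    define f where "f = (\<lambda>j. dist x (\<Phi> h' (pt (\<tau> [^] (j::nat)))))"
    define t where "t = dist x (pt h)"
    have diff: "\<bar>f i - f j\<bar> \<le> real (j - i) * speed" if "i \<le> j" for i j
    proof -
      have "dist (\<Phi> h' (pt (\<tau> [^] i))) (\<Phi> h' (pt (\<tau> [^] j))) = nm (\<tau> [^] (j - i))"
        using that dist_act_right[of "\<tau> [^] i" "\<tau> [^] (j - i)" v] by (simp add: nat_pow_mult)
      then show ?thesis using nm_letter_pow[OF \<tau>, of "j - i"] abs_dist_diff_le[of "\<Phi> h' (pt (\<tau> [^] i))" x "\<Phi> h' (pt (\<tau> [^] j))"]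
        by (simp add: f_def dist_commute)
    qed
    have f0: "f 0 + N \<le> t" "t + N \<le> f J" using deep by (simp_all add: f_def t_def)
    have N_nonneg: "0 \<le> N" using speed_pos E' by (simp add: N_def)
    have "\<exists>j\<le>J. \<bar>f j - t\<bar> \<le> speed"
    proof (rule discrete_ivt)
      show "\<bar>f (Suc j) - f j\<bar> \<le> speed" for j using diff[of j "Suc j"] by (simp add: abs_minus_commute)
    qed (use f0 N_nonneg speed_pos in auto)
    then obtain j where j: "j \<le> J" "\<bar>f j - t\<bar> \<le> speed" by blast
    have big: "s \<le> k" if "N \<le> real k * speed + speed" for k
    proof -
      have "real s * speed \<le> real k * speed" using that E' speed_pos unfolding N_def by linarith
      then show ?thesis using speed_pos by simp
    qed
    have "s \<le> j" using diff[of 0 j] f0 j by (intro big) auto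
    have "s \<le> J - j" using diff[of j J] f0 j by (intro big) auto
    have js: "j + s \<le> J" using \<open>s \<le> J - j\<close> j by simp
    define b where "b = h' \<otimes> \<tau> [^] j"
    have b [simp]: "b \<in> carrier G" by (simp add: b_def)
    have b0: "pt b = \<Phi> h' (pt (\<tau> [^] j))" by (simp add: b_def act_mult)
    have b1: "\<Phi> b (pt (\<tau> [^] s)) = \<Phi> h' (pt (\<tau> [^] (j + s)))"
      by (simp add: b_def act_mult[symmetric] nat_pow_mult m_assoc)
    have "\<tau> [^] j \<otimes> inv (\<tau> [^] s) = \<tau> [^] (j - s)"
      using \<open>s \<le> j\<close> nat_pow_mult[of \<tau> "j - s" s] by (simp add: inv_solve_right')
    then have b2: "\<Phi> b (pt (inv (\<tau> [^] s))) = \<Phi> h' (pt (\<tau> [^] (j - s)))"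
      by (simp add: b_def act_mult[symmetric] m_assoc)
    have nr: "dist x (pt h) + dist (pt h) y \<le> dist x y + E'" using after[of 0] E' by simp
    have nr_seg: "dist x (\<Phi> h' (pt (\<tau> [^] i))) + dist (\<Phi> h' (pt (\<tau> [^] i))) y \<le> dist x y + E'" if "i \<le> J" for i
      using seg[of i i] that E' by simp
    have tri: "dist x y \<le> dist x z + dist z y" for z by (rule dist_triangle)
    have close0: "dist (pt h) (pt b) \<le> r"
      unfolding r_def b0 using nr nr_seg[OF j(1)] j(2) by (intro close_points[of x _ y]) (auto simp: f_def t_def)
    have len: "\<Lambda> \<le> nm (\<tau> [^] s)" "nm (\<tau> [^] s) \<le> real s * speed" using s[OF \<tau>] nm_letter_pow[OF \<tau>] by auto
    have \<Lambda>: "speed + E' \<le> \<Lambda>" using r0 speed_pos by (simp add: \<Lambda>_def)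
    have enough: "NE \<le> n" if "\<Lambda> - 2 * r \<le> nm (u [^] n)" "u \<in> letters" for u n
    proof -
      have "NE * speed \<le> n * speed" using nm_letter_pow[OF that(2), of n] that(1) speed_pos E' unfolding \<Lambda>_def by linarith
      then show ?thesis using speed_pos by simp
    qed
    \<comment> \<open>A discrete intermediate value: some power of \<alpha> behind the corner is
      about as far from \<open>x\<close> as the segment point with exponent
      \<open>j - s\<close>.\<close>
    have "\<exists>n\<le>nA. \<bar>dist x (\<Phi> h (pt (inv (\<alpha> [^] n)))) - f (j - s)\<bar> \<le> speed"
    proof (rule discrete_ivt_decreasing)
      show "\<bar>dist x (\<Phi> h (pt (inv (\<alpha> [^] Suc n)))) - dist x (\<Phi> h (pt (inv (\<alpha> [^] n))))\<bar> \<le> speed" for n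
      proof -
        have "inv (\<alpha> [^] Suc n) = inv (\<alpha> [^] n) \<otimes> inv \<alpha>"
          by (simp add: inv_mult_group[symmetric] nat_pow_Suc2[symmetric] del: nat_pow_Suc)
        then have "dist (\<Phi> h (pt (inv (\<alpha> [^] n)))) (\<Phi> h (pt (inv (\<alpha> [^] Suc n)))) = nm \<alpha>"
          using dist_act_right[of "inv (\<alpha> [^] n)" "inv \<alpha>" v] by simp
        then show ?thesis
          using nm_letter[OF \<alpha>(1)] abs_dist_diff_le[of "\<Phi> h (pt (inv (\<alpha> [^] n)))" x "\<Phi> h (pt (inv (\<alpha> [^] Suc n)))"]
          by (simp add: dist_commute abs_minus_commute)
      qed
      have "f (j - s) \<le> t"
        using seg[of "j - s" j] j \<open>s \<le> j\<close> tri[of "\<Phi> h' (pt (\<tau> [^] j))"] len \<Lambda> E' by (auto simp: f_def abs_le_iff)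
      then show "f (j - s) \<le> dist x (\<Phi> h (pt (inv (\<alpha> [^] (0::nat)))))" by (simp add: t_def)
      have "t - speed - real s * speed \<le> f (j - s)" using diff[of "j - s" j] \<open>s \<le> j\<close> j by (auto simp: abs_le_iff)
      then show "dist x (\<Phi> h (pt (inv (\<alpha> [^] nA)))) \<le> f (j - s)"
        using before[of nA] long(1) tri[of "pt h"] E' speed_pos unfolding N_def t_def by simp
    qed (use speed_pos in simp)
    then obtain n where n: "n \<le> nA" "\<bar>dist x (\<Phi> h (pt (inv (\<alpha> [^] n)))) - f (j - s)\<bar> \<le> speed" by blast
    have near_n: "dist x (\<Phi> h (pt (inv (\<alpha> [^] n)))) + dist (\<Phi> h (pt (inv (\<alpha> [^] n)))) y \<le> dist x y + E'"
    proof -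
      have "dist (\<Phi> h (pt (inv (\<alpha> [^] n)))) (pt h) = nm (\<alpha> [^] n)"
        by (simp add: dist_commute displ_def[symmetric])
      then show ?thesis using before[OF n(1)] E' dist_triangle[of "\<Phi> h (pt (inv (\<alpha> [^] n)))" y "pt h"] by linarith
    qed
    have close1: "dist (\<Phi> h (pt (inv (\<alpha> [^] n)))) (\<Phi> b (pt (inv (\<tau> [^] s)))) \<le> r"
      unfolding r_def b2 using near_n nr_seg[of "j - s"] n(2) j(1) by (intro close_points[of x _ y]) (auto simp: f_def)
    have "\<exists>n\<le>nB. \<bar>dist x (\<Phi> h (pt (\<beta> [^] n))) - f (j + s)\<bar> \<le> speed"
    proof (rule discrete_ivt)
      show "\<bar>dist x (\<Phi> h (pt (\<beta> [^] Suc n))) - dist x (\<Phi> h (pt (\<beta> [^] n)))\<bar> \<le> speed" for n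
      proof -
        have "dist (\<Phi> h (pt (\<beta> [^] n))) (\<Phi> h (pt (\<beta> [^] Suc n))) = nm \<beta>"
          using dist_act_right[of "\<beta> [^] n" "\<beta>" v] by simp
        then show ?thesis
          using nm_letter[OF \<alpha>(2)] abs_dist_diff_le[of "\<Phi> h (pt (\<beta> [^] n))" x "\<Phi> h (pt (\<beta> [^] Suc n))"]
          by (simp add: dist_commute abs_minus_commute)
      qed
      have "t \<le> f (j + s)"
        using seg[of j "j + s"] j js tri[of "\<Phi> h' (pt (\<tau> [^] (j + s)))"] len \<Lambda> E' by (auto simp: f_def abs_le_iff)
      then show "dist x (\<Phi> h (pt (\<beta> [^] (0::nat)))) \<le> f (j + s)" by (simp add: t_def)
      have "f (j + s) \<le> t + speed + real s * speed" using diff[of j "j + s"] j by (auto simp: abs_le_iff)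
      then show "f (j + s) \<le> dist x (\<Phi> h (pt (\<beta> [^] nB)))"
        using after[of nB] long(2) tri[of "\<Phi> h (pt (\<beta> [^] nB))"] E' speed_pos unfolding N_def t_def by simp
    qed (use speed_pos in simp)
    then obtain n' where n': "n' \<le> nB" "\<bar>dist x (\<Phi> h (pt (\<beta> [^] n'))) - f (j + s)\<bar> \<le> speed" by blast
    have near_n': "dist x (\<Phi> h (pt (\<beta> [^] n'))) + dist (\<Phi> h (pt (\<beta> [^] n'))) y \<le> dist x y + E'"
    proof -
      have "dist (pt h) (\<Phi> h (pt (\<beta> [^] n'))) = nm (\<beta> [^] n')" by (simp add: displ_def)
      then show ?thesis using after[OF n'(1)] E' dist_triangle[of x "\<Phi> h (pt (\<beta> [^] n'))" "pt h"] by linarith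
    qed
    have close2: "dist (\<Phi> h (pt (\<beta> [^] n'))) (\<Phi> b (pt (\<tau> [^] s))) \<le> r"
      unfolding r_def b1 using near_n' nr_seg[of "j + s"] n'(2) j(1) \<open>s \<le> J - j\<close>
      by (intro close_points[of x _ y]) (auto simp: f_def)
    have "nm (\<tau> [^] s) \<le> nm (\<alpha> [^] n) + 2 * r"
    proof -
      have "dist (pt b) (\<Phi> b (pt (inv (\<tau> [^] s)))) \<le> dist (pt h) (pt b) + dist (pt h) (\<Phi> h (pt (inv (\<alpha> [^] n))))
          + dist (\<Phi> h (pt (inv (\<alpha> [^] n)))) (\<Phi> b (pt (inv (\<tau> [^] s))))" by metric
      moreover have "dist (pt b) (\<Phi> b (pt (inv (\<tau> [^] s)))) = nm (\<tau> [^] s)" "dist (pt h) (\<Phi> h (pt (inv (\<alpha> [^] n)))) = nm (\<alpha> [^] n)"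
        by (simp_all add: displ_def[symmetric])
      ultimately show ?thesis using close0 close1 by linarith
    qed
    then have "NE \<le> n" using len \<alpha>(1) by (intro enough[of \<alpha>]) auto
    have "nm (\<tau> [^] s) \<le> nm (\<beta> [^] n') + 2 * r"
    proof -
      have "dist (pt b) (\<Phi> b (pt (\<tau> [^] s))) \<le> dist (pt h) (pt b) + dist (pt h) (\<Phi> h (pt (\<beta> [^] n')))
          + dist (\<Phi> h (pt (\<beta> [^] n'))) (\<Phi> b (pt (\<tau> [^] s)))" by metric
      moreover have "dist (pt b) (\<Phi> b (pt (\<tau> [^] s))) = nm (\<tau> [^] s)" "dist (pt h) (\<Phi> h (pt (\<beta> [^] n'))) = nm (\<beta> [^] n')"
        by (simp_all add: displ_def[symmetric])
      ultimately show ?thesis using close0 close2 by linarith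
    qed
    then have "NE \<le> n'" using len \<alpha>(2) by (intro enough[of \<beta>]) auto
    show False
      by (rule no_double_parallel[OF \<alpha>\<beta> _ h b NE \<open>NE \<le> n\<close> \<open>NE \<le> n'\<close> close0 close1 close2]) auto
  qed
  have "0 \<le> N" using speed_pos E' by (simp add: N_def)
  then show ?thesis using key by blast
qed

section \<open>Words in \<open>g1\<close> and \<open>g2\<close> and the paths that they
  trace\<close>

definition gen :: "nat \<Rightarrow> 'g"
  where "gen l = (if even l then g1 else g2)"

fun vertex :: "(nat \<Rightarrow> nat) \<Rightarrow> nat \<Rightarrow> 'g"
  where "vertex w 0 = \<one>"
  | "vertex w (Suc l) = vertex w l \<otimes> gen l [^] w l"

definition turn :: real
  where "turn = A + 2 * \<delta>"

text \<open>This threshold and the constant \<open>turn\<close> are the length hypothesis and the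
  conclusion of \<open>broken_geodesic\<close> for corners bounded by \<open>A\<close>.\<close>

definition long_word :: "(nat \<Rightarrow> nat) \<Rightarrow> bool"
  where "long_word w \<longleftrightarrow> (\<forall>l. 2 * A + 3 * \<delta> < nm (gen l [^] w l))"

lemma gen_letter: "gen l \<in> letters" "inv (gen l) \<in> letters"
  by (auto simp: gen_def letters_def)

lemma gen_closed [simp]: "gen l \<in> carrier G"
  using gen_letter by auto

lemma vertex_closed [simp]: "vertex w l \<in> carrier G"
  by (induction l) auto

lemma turn_nonneg: "0 \<le> turn" "A \<le> turn"
  using A_nonneg \<delta>_nonneg by (auto simp: turn_def)

lemma block_length: "dist (pt (vertex w l)) (pt (vertex w (Suc l))) = nm (gen l [^] w l)"
  by (simp add: dist_act_right)

lemma vertex_turn: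
  assumes "long_word w" "i \<le> j" "j \<le> k"
  shows "gp (pt (vertex w j)) (pt (vertex w i)) (pt (vertex w k)) \<le> turn"
  unfolding turn_def
proof (rule broken_geodesic[where n = k and y = "\<lambda>l. pt (vertex w l)"])
  fix l
  have "dist (pt (vertex w l)) (pt (vertex w (Suc (Suc l)))) = nm (gen l [^] w l \<otimes> gen (Suc l) [^] w (Suc l))"
    by (simp add: m_assoc dist_act_right)
  moreover have "nm (gen l [^] w l) + nm (gen (Suc l) [^] w (Suc l)) \<le> nm (gen l [^] w l \<otimes> gen (Suc l) [^] w (Suc l)) + 2 * A"
    using transverse unfolding gen_def by (cases "even l") auto
  ultimately show "gp (pt (vertex w (Suc l))) (pt (vertex w l)) (pt (vertex w (Suc (Suc l)))) \<le> A"
    using block_length[of w l] block_length[of w "Suc l"] unfolding gp_def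
    by (simp add: dist_commute field_simps del: vertex.simps)
next
  show "2 * A + 3 * \<delta> < dist (pt (vertex w l)) (pt (vertex w (Suc l)))" for l
    using assms(1) unfolding block_length long_word_def by blast
qed (use A_nonneg assms in auto)

lemma vertex_aligned:
  assumes "long_word w" "i \<le> j" "j \<le> m"
  shows "dist v (pt (vertex w i)) + dist (pt (vertex w i)) (pt (vertex w j)) + dist (pt (vertex w j)) (pt (vertex w m))
    \<le> dist v (pt (vertex w m)) + 4 * turn"
  using vertex_turn[OF assms(1), of 0 i m] vertex_turn[OF assms] assms unfolding gp_def
  by (simp add: dist_commute field_simps)

text \<open>The two ends of the block cost \<open>4 * turn\<close>; subdividing it twice by
  \<open>superadditive\<close> costs \<open>4 * A\<close>, which is at most
  \<open>4 * turn\<close>.\<close>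

lemma block_aligned:
  assumes w: "long_word w" and "l < m" and ij: "i \<le> j" "j \<le> w l"
  shows "dist v (pt (vertex w l \<otimes> gen l [^] i)) + nm (gen l [^] (j - i)) + dist (pt (vertex w l \<otimes> gen l [^] j)) (pt (vertex w m))
    \<le> dist v (pt (vertex w m)) + 8 * turn"
proof -
  let ?u = "gen l" and ?q = "vertex w l"
  have "dist v (pt ?q) + nm (?u [^] w l) + dist (pt (vertex w (Suc l))) (pt (vertex w m)) \<le> dist v (pt (vertex w m)) + 4 * turn"
    using vertex_aligned[OF w, of l "Suc l" m] \<open>l < m\<close> block_length[of w l] by (simp del: vertex.simps)
  moreover have "nm (?u [^] i) + nm (?u [^] (j - i)) \<le> nm (?u [^] j) + 2 * A"
    "nm (?u [^] j) + nm (?u [^] (w l - j)) \<le> nm (?u [^] w l) + 2 * A"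
    using superadditive[of ?u i "j - i"] superadditive[of ?u j "w l - j"] ij by (auto simp: gen_def)
  moreover have "dist v (pt (?q \<otimes> ?u [^] i)) \<le> dist v (pt ?q) + nm (?u [^] i)"
    using dist_triangle[of v "pt (?q \<otimes> ?u [^] i)" "pt ?q"] by (simp add: dist_act_right)
  moreover have "dist (pt (?q \<otimes> ?u [^] j)) (pt (vertex w m)) \<le> nm (?u [^] (w l - j)) + dist (pt (vertex w (Suc l))) (pt (vertex w m))"
  proof -
    have "vertex w (Suc l) = (?q \<otimes> ?u [^] j) \<otimes> ?u [^] (w l - j)"
      using ij by (simp add: m_assoc nat_pow_mult)
    then have "dist (pt (?q \<otimes> ?u [^] j)) (pt (vertex w (Suc l))) = nm (?u [^] (w l - j))"
      using dist_act_right[of "?q \<otimes> ?u [^] j" "?u [^] (w l - j)" v] by simp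
    then show ?thesis using dist_triangle[of "pt (?q \<otimes> ?u [^] j)" "pt (vertex w m)" "pt (vertex w (Suc l))"] by linarith
  qed
  ultimately show ?thesis using turn_nonneg by linarith
qed

text \<open>The path has vertices \<open>pt (q l)\<close>, \<open>l \<le> m\<close>, and its block from \<open>q l\<close> to \<open>q (Suc l)\<close> is the power
  \<open>u l [^] e l\<close>; all of it is close to a geodesic from \<open>x\<close> to \<open>y\<close>.\<close>

definition track :: "real \<Rightarrow> 'a \<Rightarrow> 'a \<Rightarrow> nat \<Rightarrow> (nat \<Rightarrow> 'g) \<Rightarrow> (nat \<Rightarrow> 'g) \<Rightarrow> (nat \<Rightarrow> nat) \<Rightarrow> bool"
  where "track E x y m q u e \<longleftrightarrow> pt (q 0) = x \<and> pt (q m) = y \<and>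
    (\<forall>l<m. q (Suc l) = q l \<otimes> u l [^] e l \<and> segment E x y (q l) (u l) (e l)) \<and>
    (\<forall>i j. i \<le> j \<and> j \<le> m \<longrightarrow> dist x (pt (q i)) + dist (pt (q i)) (pt (q j)) + dist (pt (q j)) y \<le> dist x y + E)"

lemma track_forward:
  assumes "long_word w"
  shows "track (8 * turn) v (pt (vertex w m)) m (vertex w) gen w"
  unfolding track_def
proof (intro conjI allI impI)
  fix i j assume "i \<le> j \<and> j \<le> m"
  then show "dist v (pt (vertex w i)) + dist (pt (vertex w i)) (pt (vertex w j)) + dist (pt (vertex w j)) (pt (vertex w m))
      \<le> dist v (pt (vertex w m)) + 8 * turn"
    using vertex_aligned[OF assms, of i j m] turn_nonneg(1) by simp
next
  fix l assume "l < m"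
  then show "segment (8 * turn) v (pt (vertex w m)) (vertex w l) (gen l) (w l)"
    using block_aligned[OF assms] gen_letter unfolding segment_def by (simp add: act_mult)
qed auto

text \<open>The same path read from its end, with inverse letters. Copies in the backward direction
  thus become copies along a track as well.\<close>

lemma track_backward:
  assumes w: "long_word w"
  shows "track (8 * turn) (pt (vertex w m)) v m (\<lambda>l. vertex w (m - l)) (\<lambda>l. inv (gen (m - Suc l))) (\<lambda>l. w (m - Suc l))"
  unfolding track_def
proof (intro conjI allI impI)
  fix i j assume "i \<le> j \<and> j \<le> m"
  then show "dist (pt (vertex w m)) (pt (vertex w (m - i))) + dist (pt (vertex w (m - i))) (pt (vertex w (m - j))) +
      dist (pt (vertex w (m - j))) v \<le> dist (pt (vertex w m)) v + 8 * turn"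
    using vertex_aligned[OF w, of "m - j" "m - i" m] turn_nonneg(1) by (simp add: dist_commute diff_le_mono2)
next
  fix l assume l: "l < m"
  let ?k = "m - Suc l"
  have k: "m - l = Suc ?k" using l by simp
  have pow: "vertex w (m - l) \<otimes> inv (gen ?k) [^] i = vertex w ?k \<otimes> gen ?k [^] (w ?k - i)" if "i \<le> w ?k" for i
  proof -
    have "gen ?k [^] w ?k \<otimes> inv (gen ?k) [^] i = gen ?k [^] (w ?k - i)"
      using that nat_pow_mult[of "gen ?k" "w ?k - i" i] by (simp add: nat_pow_inv inv_solve_right')
    then show ?thesis unfolding k by (simp add: m_assoc)
  qed
  show "vertex w (m - Suc l) = vertex w (m - l) \<otimes> inv (gen ?k) [^] w ?k" using pow[of "w ?k"] by simp
  show "segment (8 * turn) (pt (vertex w m)) v (vertex w (m - l)) (inv (gen ?k)) (w ?k)"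
    unfolding segment_def
  proof (intro conjI allI impI)
    fix i j assume ij: "i \<le> j \<and> j \<le> w ?k"
    then have "w ?k - i - (w ?k - j) = j - i" "w ?k - j \<le> w ?k - i" by auto
    then have "dist (pt (vertex w m)) (pt (vertex w (m - l) \<otimes> inv (gen ?k) [^] i)) + nm (inv (gen ?k) [^] (j - i)) +
        dist (pt (vertex w (m - l) \<otimes> inv (gen ?k) [^] j)) v \<le> dist (pt (vertex w m)) v + 8 * turn"
      using block_aligned[OF w, of ?k m "w ?k - j" "w ?k - i"] ij l by (simp add: pow dist_commute)
    then show "dist (pt (vertex w m)) (\<Phi> (vertex w (m - l)) (pt (inv (gen ?k) [^] i))) + nm (inv (gen ?k) [^] (j - i)) +
        dist (\<Phi> (vertex w (m - l)) (pt (inv (gen ?k) [^] j))) v \<le> dist (pt (vertex w m)) v + 8 * turn"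
      by (simp add: act_mult)
  qed (use gen_letter in auto)
qed auto

lemma track_block_length:
  assumes "track E x y m q u e" "l < m"
  shows "dist (pt (q l)) (pt (q (Suc l))) = nm (u l [^] e l)"
  using assms dist_act_right[of "q l" "u l [^] e l" v] unfolding track_def segment_def by simp

text \<open>The first vertex of the track that is at least as far from \<open>x\<close> as the
  corner ends a block whose range contains the corner, and the corner cannot be deep inside that
  block.\<close>

lemma corner_near_vertex:
  "\<exists>N\<ge>0. \<forall>x y m q u e h \<alpha> \<beta> nA nB. track E x y m q u e \<and> corner E x y h \<alpha> nA \<beta> nB \<and>
    N \<le> nm (\<alpha> [^] nA) \<and> N \<le> nm (\<beta> [^] nB) \<and> 0 < dist x (pt h) \<and> dist x (pt h) \<le> dist x y \<longrightarrow>
    (\<exists>l\<le>m. \<bar>dist x (pt (q l)) - dist x (pt h)\<bar> \<le> N)"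
proof -
  obtain N where N: "0 \<le> N" "\<forall>x y h \<alpha> nA \<beta> nB h' \<tau> J. corner E x y h \<alpha> nA \<beta> nB \<and> N \<le> nm (\<alpha> [^] nA) \<and>
    N \<le> nm (\<beta> [^] nB) \<and> segment E x y h' \<tau> J \<longrightarrow>
    dist x (pt h) < dist x (pt h') + N \<or> dist x (\<Phi> h' (pt (\<tau> [^] J))) < dist x (pt h) + N"
    using corner_not_inside_segment[of E] by blast
  have "\<exists>l\<le>m. \<bar>dist x (pt (q l)) - dist x (pt h)\<bar> \<le> N"
    if T: "track E x y m q u e" and h: "corner E x y h \<alpha> nA \<beta> nB"
      "N \<le> nm (\<alpha> [^] nA)" "N \<le> nm (\<beta> [^] nB)" and t: "0 < dist x (pt h)" "dist x (pt h) \<le> dist x y"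
    for x y m q u e h \<alpha> \<beta> nA nB
  proof -
    define l where "l = (LEAST l. dist x (pt h) \<le> dist x (pt (q l)))"
    have qm: "dist x (pt h) \<le> dist x (pt (q m))" using T t unfolding track_def by simp
    then have l: "dist x (pt h) \<le> dist x (pt (q l))" "l \<le> m" unfolding l_def by (auto intro: LeastI Least_le)
    have "l \<noteq> 0"
    proof
      assume "l = 0"
      then have "dist x (pt (q l)) = 0" using T unfolding track_def by simp
      then show False using l t by simp
    qed
    then obtain k where k: "l = Suc k" using not0_implies_Suc by blast
    then have less: "dist x (pt (q k)) < dist x (pt h)"
      using not_less_Least[of k "\<lambda>l. dist x (pt h) \<le> dist x (pt (q l))"] unfolding l_def by simp
    have seg: "segment E x y (q k) (u k) (e k)" and ql: "q l = q k \<otimes> u k [^] e k"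
      using T l(2) k unfolding track_def by auto
    have "dist x (pt h) < dist x (pt (q k)) + N \<or> dist x (pt (q l)) < dist x (pt h) + N"
      using N(2)[rule_format, of x y h \<alpha> nA \<beta> nB "q k" "u k" "e k"] h seg ql
      by (simp add: act_mult segment_def)
    then show ?thesis
    proof
      assume "dist x (pt h) < dist x (pt (q k)) + N"
      then show ?thesis using less l(2) k by (intro exI[of _ k]) auto
    next
      assume "dist x (pt (q l)) < dist x (pt h) + N"
      then show ?thesis using l by (intro exI[of _ l]) auto
    qed
  qed
  then show ?thesis using N(1) by blast
qed

text \<open>The three inner corners of the copy lie near vertices \<open>l1 < l2 < l3\<close> of the track, so the blocks of
  the track between them are no longer than the second and third block of \<open>w\<close>.\<close>

lemma copy_in_track:
  assumes E0: "0 \<le> E0"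
  shows "\<exists>N\<ge>0. \<forall>w x y m q u e g. long_word w \<and> track (8 * turn) x y m q u e \<and> g \<in> carrier G \<and>
    dist x (pt g) + nm (vertex w 4) + dist (\<Phi> g (pt (vertex w 4))) y \<le> dist x y + E0 \<and>
    (\<forall>l<4. N \<le> nm (gen l [^] w l)) \<longrightarrow>
    (\<exists>l1 l2. l1 < l2 \<and> l2 < m \<and> nm (u l2 [^] e l2) \<le> nm (g1 [^] w 2) + N \<and>
      nm (u (l2 - 1) [^] e (l2 - 1)) \<le> nm (g2 [^] w 1) + N \<and>
      (if l1 = l2 - 1 then nm (g2 [^] w 1) \<le> nm (u (l2 - 1) [^] e (l2 - 1)) + N
        else nm (u (l2 - 2) [^] e (l2 - 2)) \<le> nm (g2 [^] w 1) + N))"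
proof -
  \<comment> \<open>One constant for the track and for the copy: points of the copy inherit
    \<open>8 * turn\<close> from the alignment of the word and \<open>E0\<close> from the position
    of the copy.\<close>
  define E where "E = E0 + 8 * turn"
  obtain N where N: "0 \<le> N" "\<forall>x y m q u e h \<alpha> \<beta> nA nB. track E x y m q u e \<and> corner E x y h \<alpha> nA \<beta> nB \<and>
    N \<le> nm (\<alpha> [^] nA) \<and> N \<le> nm (\<beta> [^] nB) \<and> 0 < dist x (pt h) \<and> dist x (pt h) \<le> dist x y \<longrightarrow>
    (\<exists>l\<le>m. \<bar>dist x (pt (q l)) - dist x (pt h)\<bar> \<le> N)"
    using corner_near_vertex[of E] by blast
  \<comment> \<open>Two matching errors \<open>N\<close>, up to three alignment losses
    \<open>E\<close>, and 1 for strict inequalities.\<close>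
  define N' where "N' = 2 * N + 3 * E + 1"
  have E: "0 \<le> E" "8 * turn \<le> E" using E0 turn_nonneg by (auto simp: E_def)
  have key: "\<exists>l1 l2. l1 < l2 \<and> l2 < m \<and> nm (u l2 [^] e l2) \<le> nm (g1 [^] w 2) + N' \<and>
      nm (u (l2 - 1) [^] e (l2 - 1)) \<le> nm (g2 [^] w 1) + N' \<and>
      (if l1 = l2 - 1 then nm (g2 [^] w 1) \<le> nm (u (l2 - 1) [^] e (l2 - 1)) + N'
        else nm (u (l2 - 2) [^] e (l2 - 2)) \<le> nm (g2 [^] w 1) + N')"
    if w: "long_word w" and T': "track (8 * turn) x y m q u e" and g: "g \<in> carrier G"
      and copy: "dist x (pt g) + nm (vertex w 4) + dist (\<Phi> g (pt (vertex w 4))) y \<le> dist x y + E0"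
      and long: "\<And>l. l < 4 \<Longrightarrow> N' \<le> nm (gen l [^] w l)"
    for w x y m q u e g
  proof -
    have T: "track E x y m q u e"
      unfolding track_def
    proof (intro conjI allI impI)
      fix l assume "l < m"
      then have "segment (8 * turn) x y (q l) (u l) (e l)" using T' unfolding track_def by blast
      then show "segment E x y (q l) (u l) (e l)" using E(2) unfolding segment_def by fastforce
    next
      fix i j assume "i \<le> j \<and> j \<le> m"
      then have "dist x (pt (q i)) + dist (pt (q i)) (pt (q j)) + dist (pt (q j)) y \<le> dist x y + 8 * turn"
        using T' unfolding track_def by blast
      then show "dist x (pt (q i)) + dist (pt (q i)) (pt (q j)) + dist (pt (q j)) y \<le> dist x y + E"
        using E(2) by linarith
    qed (use T' in \<open>auto simp: track_def\<close>)
    define P where "P = (\<lambda>k. g \<otimes> vertex w k)"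
    have P [simp]: "P k \<in> carrier G" for k using g by (simp add: P_def)
    have insert: "dist x (\<Phi> g z) + d + dist (\<Phi> g z') y \<le> dist x y + E"
      if "dist v z + d + dist z' (pt (vertex w 4)) \<le> dist v (pt (vertex w 4)) + 8 * turn" for z z' d
    proof -
      have "dist x (\<Phi> g z) \<le> dist x (pt g) + dist v z"
        using dist_triangle[of x "\<Phi> g z" "pt g"] g by simp
      moreover have "dist (\<Phi> g z') y \<le> dist z' (pt (vertex w 4)) + dist (\<Phi> g (pt (vertex w 4))) y"
        using dist_triangle[of "\<Phi> g z'" y "\<Phi> g (pt (vertex w 4))"] g by simp
      ultimately show ?thesis using that copy unfolding E_def displ_def by linarith
    qed
    have P_aligned: "dist x (pt (P i)) + dist (pt (P i)) (pt (P j)) + dist (pt (P j)) y \<le> dist x y + E"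
      if "i \<le> j" "j \<le> 4" for i j
      using insert[of "pt (vertex w i)" "dist (pt (vertex w i)) (pt (vertex w j))" "pt (vertex w j)"]
        vertex_aligned[OF w that] turn_nonneg(1) g by (simp add: P_def act_mult)
    have after: "dist x (pt (P k)) + nm (gen k [^] n) + dist (\<Phi> (P k) (pt (gen k [^] n))) y \<le> dist x y + E"
      if "k < 4" "n \<le> w k" for k n
      using insert[of "pt (vertex w k)" "nm (gen k [^] n)" "pt (vertex w k \<otimes> gen k [^] n)"]
        block_aligned[OF w that(1), of 0 n] that g by (simp add: P_def act_mult)
    have before: "dist x (\<Phi> (P (Suc k)) (pt (inv (gen k [^] n)))) + nm (gen k [^] n) + dist (pt (P (Suc k))) y \<le> dist x y + E"
      if "k < 4" "n \<le> w k" for k n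
    proof -
      have "gen k [^] w k \<otimes> inv (gen k [^] n) = gen k [^] (w k - n)"
        using that(2) nat_pow_mult[of "gen k" "w k - n" n] by (simp add: inv_solve_right')
      then have "\<Phi> (gen k [^] w k) (pt (inv (gen k [^] n))) = pt (gen k [^] (w k - n))"
        by (metis act_mult gen_closed inv_closed nat_pow_closed)
      then show ?thesis
        using insert[of "pt (vertex w k \<otimes> gen k [^] (w k - n))" "nm (gen k [^] n)" "pt (vertex w (Suc k))"]
          block_aligned[OF w that(1), of "w k - n" "w k"] that g by (simp add: P_def act_mult)
    qed
    define F where "F = (\<lambda>l. dist x (pt (q l)))"
    define p where "p = (\<lambda>k. dist x (pt (P k)))"
    have P_block: "dist (pt (P k)) (pt (P (Suc k))) = nm (gen k [^] w k)" for k
      using g block_length[of w k] by (simp add: P_def act_mult)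
    have p_step: "p k + nm (gen k [^] w k) - E \<le> p (Suc k)" "p (Suc k) \<le> p k + nm (gen k [^] w k)" if "k < 4" for k
    proof -
      show "p k + nm (gen k [^] w k) - E \<le> p (Suc k)"
        using P_aligned[of k "Suc k"] that P_block[of k] dist_triangle[of x y "pt (P (Suc k))"] unfolding p_def by simp
      show "p (Suc k) \<le> p k + nm (gen k [^] w k)"
        using P_block[of k] dist_triangle[of x "pt (P (Suc k))" "pt (P k)"] unfolding p_def by simp
    qed
    have vx: "\<exists>l\<le>m. \<bar>F l - p (Suc k)\<bar> \<le> N" if k: "k < 3" for k
      unfolding F_def p_def
    proof (intro N(2)[rule_format] conjI)
      show "track E x y m q u e" by (rule T)
      show "corner E x y (P (Suc k)) (gen k) (w k) (gen (Suc k)) (w (Suc k))"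
        unfolding corner_def
      proof (intro conjI allI impI)
        show "gen k = g1 \<and> gen (Suc k) = g2 \<or> gen k = g2 \<and> gen (Suc k) = g1" by (auto simp: gen_def)
      qed (use before after k in auto)
      show "N \<le> nm (gen k [^] w k)" "N \<le> nm (gen (Suc k) [^] w (Suc k))"
        using long[of k] long[of "Suc k"] k N(1) E(1) by (auto simp: N'_def)
      show "0 < dist x (pt (P (Suc k)))"
        using p_step(1)[of k] long[of k] k N(1) E(1) zero_le_dist[of x "pt (P k)"] unfolding p_def N'_def by linarith
      show "dist x (pt (P (Suc k))) \<le> dist x y"
      proof -
        have "dist x (pt (P (Suc k))) + nm (gen (Suc k) [^] w (Suc k)) + dist (pt (P (Suc (Suc k)))) y \<le> dist x y + E"
          using P_aligned[of "Suc k" "Suc (Suc k)"] P_block[of "Suc k"] k by simp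
        then show ?thesis
          using long[of "Suc k"] k N(1) E(1) zero_le_dist[of "pt (P (Suc (Suc k)))" y] unfolding N'_def by linarith
      qed
    qed
    obtain l1 where l1: "l1 \<le> m" "\<bar>F l1 - p 1\<bar> \<le> N" using vx[of 0] by auto
    obtain l2 where l2: "l2 \<le> m" "\<bar>F l2 - p 2\<bar> \<le> N" using vx[of 1] by (auto simp: numeral_2_eq_2)
    obtain l3 where l3: "l3 \<le> m" "\<bar>F l3 - p 3\<bar> \<le> N" using vx[of 2] by (auto simp: numeral_3_eq_3)
    have F_step: "F i + dist (pt (q i)) (pt (q j)) - E \<le> F j" if "i \<le> j" "j \<le> m" for i j
    proof -
      have "dist x (pt (q i)) + dist (pt (q i)) (pt (q j)) + dist (pt (q j)) y \<le> dist x y + E"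
        using T that unfolding track_def by blast
      then show ?thesis using dist_triangle[of x y "pt (q j)"] unfolding F_def by linarith
    qed
    have F_mono: "F i - E \<le> F j" if "i \<le> j" "j \<le> m" for i j
      using F_step[OF that] zero_le_dist[of "pt (q i)" "pt (q j)"] by linarith
    have F_block: "F i + nm (u k [^] e k) - 3 * E \<le> F j" if "i \<le> k" "k < j" "j \<le> m" for i j k
      using F_mono[of i k] F_step[of k "Suc k"] F_mono[of "Suc k" j] track_block_length[OF T, of k] that E(1) by auto
    have gens: "gen 1 = g2" "gen 2 = g1" by (simp_all add: gen_def)
    have p12: "p 1 + nm (g2 [^] w 1) - E \<le> p 2" "p 2 \<le> p 1 + nm (g2 [^] w 1)"
      and p23: "p 2 + nm (g1 [^] w 2) - E \<le> p 3" "p 3 \<le> p 2 + nm (g1 [^] w 2)"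
      using p_step[of 1] p_step[of 2] gens by (simp_all add: numeral_2_eq_2 numeral_3_eq_3)
    have "l1 < l2"
    proof (rule ccontr)
      assume "\<not> l1 < l2"
      then show False using F_mono[of l2 l1] l1 l2 p12(1) long[of 1] gens E(1) N(1) unfolding N'_def by (simp add: abs_le_iff)
    qed
    have "l2 < l3"
    proof (rule ccontr)
      assume "\<not> l2 < l3"
      then show False using F_mono[of l3 l2] l2 l3 p23(1) long[of 2] gens E(1) N(1) unfolding N'_def by (simp add: abs_le_iff)
    qed
    show ?thesis
    proof (intro exI conjI)
      show "l1 < l2" by fact
      show "l2 < m" using \<open>l2 < l3\<close> l3 by simp
      show "nm (u l2 [^] e l2) \<le> nm (g1 [^] w 2) + N'"
        using F_block[of l2 l2 l3] \<open>l2 < l3\<close> l3 l2 p23(2) by (simp add: N'_def abs_le_iff)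
      show "nm (u (l2 - 1) [^] e (l2 - 1)) \<le> nm (g2 [^] w 1) + N'"
      proof -
        have "l1 \<le> l2 - 1" "l2 - 1 < l2" using \<open>l1 < l2\<close> by auto
        from F_block[OF this l2(1)] show ?thesis using l1(2) l2(2) p12(2) unfolding N'_def by linarith
      qed
      \<comment> \<open>Either a single block of the track matches the second block of
        \<open>w\<close>, and then it is not much shorter either, or at least two blocks of the
        track fit into that length.\<close>
      show "if l1 = l2 - 1 then nm (g2 [^] w 1) \<le> nm (u (l2 - 1) [^] e (l2 - 1)) + N'
        else nm (u (l2 - 2) [^] e (l2 - 2)) \<le> nm (g2 [^] w 1) + N'"
      proof (cases "l1 = l2 - 1")
        case True
        then have l2': "l2 = Suc l1" using \<open>l1 < l2\<close> by simp
        have "F l2 \<le> F l1 + nm (u l1 [^] e l1)"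
          using track_block_length[OF T, of l1] l2 l2' dist_triangle[of x "pt (q l2)" "pt (q l1)"] by (simp add: F_def)
        then have "nm (g2 [^] w 1) \<le> nm (u l1 [^] e l1) + N'"
          using l1(2) l2(2) p12(1) N(1) E(1) unfolding N'_def by linarith
        then show ?thesis unfolding l2' by simp
      next
        case False
        then have "l1 \<le> l2 - 2" "l2 - 2 < l2" using \<open>l1 < l2\<close> by auto
        from F_block[OF this l2(1)] have "nm (u (l2 - 2) [^] e (l2 - 2)) \<le> nm (g2 [^] w 1) + N'"
          using l1(2) l2(2) p12(2) unfolding N'_def by linarith
        then show ?thesis using False by simp
      qed
    qed
  qed
  have "0 \<le> N'" using N(1) E(1) by (simp add: N'_def)
  then show ?thesis
    by (intro exI[of _ N'] conjI allI impI, assumption) (elim conjE, rule key; (assumption | blast))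
qed

end

section \<open>Periodic words, their exponents, and independence\<close>

lemma nat_multiples_bounded:
  fixes r C :: real
  assumes "\<And>k::nat. k * r \<le> C"
  shows "r \<le> 0"
proof (rule ccontr)
  assume "\<not> r \<le> 0"
  then obtain n :: nat where "C < n * r" using reals_Archimedean3[of r] by auto
  then show False using assms[of n] by simp
qed

context inequivalent_pair
begin

lemma vertex_add_period:
  assumes "\<And>l. w (4 + l) = w l"
  shows "vertex w (4 + l) = vertex w 4 \<otimes> vertex w l"
proof (induction l)
  case (Suc l)
  have "gen (4 + l) = gen l" by (simp add: gen_def)
  moreover have "vertex w (4 + Suc l) = vertex w (4 + l) \<otimes> gen (4 + l) [^] w (4 + l)"
    by (simp only: add_Suc_right vertex.simps)
  ultimately show ?case using Suc assms[of l] by (simp add: m_assoc)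
qed simp

lemma vertex_periodic:
  assumes "\<And>l. w (4 + l) = w l"
  shows "vertex w (4 * k) = vertex w 4 [^] k"
proof (induction k)
  case (Suc k)
  have "vertex w (4 * Suc k) = vertex w (4 + 4 * k)" by simp
  also have "\<dots> = vertex w 4 \<otimes> vertex w 4 [^] k" using vertex_add_period[of w "4 * k"] assms Suc by simp
  also have "\<dots> = vertex w 4 [^] Suc k" by (rule nat_pow_Suc2[symmetric]) simp
  finally show ?case .
qed simp

text \<open>Each junction with one more period loses at most \<open>2 * turn\<close>.\<close>

lemma displ_period_ge:
  assumes w: "long_word w" and per: "\<And>l. w (4 + l) = w l"
  shows "real k * (nm (vertex w 4) - 2 * turn) \<le> nm (vertex w 4 [^] (k::nat))"
proof (induction k)
  case (Suc k)
  let ?f = "vertex w 4"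
  have f: "vertex w (4 * k) = ?f [^] k" "vertex w (4 * Suc k) = ?f [^] Suc k" using vertex_periodic[of w] per by blast+
  have "dist (pt (?f [^] k)) (pt (?f [^] Suc k)) = nm ?f" by (simp add: dist_act_right)
  moreover have "gp (pt (?f [^] k)) (pt (vertex w 0)) (pt (?f [^] Suc k)) \<le> turn"
    using vertex_turn[OF w, of 0 "4 * k" "4 * Suc k"] unfolding f by simp
  ultimately have "nm (?f [^] k) + nm ?f \<le> nm (?f [^] Suc k) + 2 * turn"
    unfolding gp_def displ_def by (simp add: dist_commute field_simps)
  then show ?case using Suc by (simp add: algebra_simps)
qed simp

text \<open>Consecutive orbit points under the powers of \<open>f\<close> are joined by a single
  jump.\<close>

lemma mdist_period_le:
  assumes adm: "admissible W v (pt f)" and f: "f \<in> carrier G"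
  shows "mdist W v (pt f) v (pt (f [^] (k::nat))) \<le> k * (nm f - W)"
proof (induction k)
  case 0
  then show ?case using mdist_le_dist[OF adm, of v v] by simp
next
  case (Suc k)
  have "mdist W v (pt f) (pt (f [^] k)) (pt (f [^] Suc k)) \<le> nm f - W"
    using mdist_jump[OF adm, of "f [^] k"] f by (simp add: act_mult displ_def)
  then show ?case using Suc mdist_triangle[OF adm, of v "pt (f [^] Suc k)" "pt (f [^] k)"]
    by (simp add: algebra_simps)
qed

text \<open>The negation of the conclusion of \<open>mdist_less_dist\<close> for the pair
  \<open>v\<close>, \<open>pt f\<close>; it forces the discounted distance from \<open>x\<close> to
  \<open>y\<close> to be \<open>dist x y\<close>.\<close>

definition copy_free :: "real \<Rightarrow> 'a \<Rightarrow> 'a \<Rightarrow> 'g \<Rightarrow> bool"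
  where "copy_free e x y f \<longleftrightarrow>
    (\<forall>g\<in>carrier G. dist x y + e < dist x (pt g) + nm f + dist (\<Phi> g (pt f)) y)"

definition word :: "nat \<Rightarrow> nat \<Rightarrow> nat \<Rightarrow> nat \<Rightarrow> nat \<Rightarrow> nat"
  where "word a b c d l = [a, b, c, d] ! (l mod 4)"

lemma word_period: "word a b c d (4 + l) = word a b c d l"
  by (simp add: word_def)

lemma mod_4_cases: "l mod 4 = 0 \<or> l mod 4 = 1 \<or> l mod 4 = 2 \<or> l mod 4 = (3::nat)"
  by linarith

lemma word_block:
  "l mod 4 = 0 \<Longrightarrow> gen l [^] word a b c d l = g1 [^] a"
  "l mod 4 = 1 \<Longrightarrow> gen l [^] word a b c d l = g2 [^] b"
  "l mod 4 = 2 \<Longrightarrow> gen l [^] word a b c d l = g1 [^] c"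
  "l mod 4 = 3 \<Longrightarrow> gen l [^] word a b c d l = g2 [^] d"
proof -
  have "even l \<longleftrightarrow> l mod 4 = 0 \<or> l mod 4 = 2" by presburger
  then have gen: "gen l = (if l mod 4 = 0 \<or> l mod 4 = 2 then g1 else g2)" by (simp add: gen_def)
  show "l mod 4 = 0 \<Longrightarrow> gen l [^] word a b c d l = g1 [^] a"
    "l mod 4 = 1 \<Longrightarrow> gen l [^] word a b c d l = g2 [^] b"
    "l mod 4 = 2 \<Longrightarrow> gen l [^] word a b c d l = g1 [^] c"
    "l mod 4 = 3 \<Longrightarrow> gen l [^] word a b c d l = g2 [^] d"
    by (simp_all add: gen word_def)
qed

lemma hom_word:
  assumes hom: "\<And>g h. g \<in> carrier G \<Longrightarrow> h \<in> carrier G \<Longrightarrow> \<phi> (g \<otimes> h) = \<phi> g + (\<phi> h :: real)"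
  shows "g \<in> carrier G \<Longrightarrow> \<phi> (g [^] (n::nat)) = n * \<phi> g"
    "\<phi> (vertex (word a b c d) 4) = (a + c) * \<phi> g1 + (b + d) * \<phi> g2"
proof -
  have one: "\<phi> \<one> = 0" using hom[of \<one> \<one>] by simp
  show pow: "\<phi> (g [^] (n::nat)) = n * \<phi> g" if "g \<in> carrier G" for g n
    by (induction n) (use that in \<open>simp_all add: one hom algebra_simps\<close>)
  have "vertex (word a b c d) (Suc (Suc (Suc (Suc 0)))) = g1 [^] a \<otimes> g2 [^] b \<otimes> g1 [^] c \<otimes> g2 [^] d"
    using word_block(1)[of 0 a b c d] word_block(2)[of "Suc 0" a b c d] word_block(3)[of "Suc (Suc 0)" a b c d]
      word_block(4)[of "Suc (Suc (Suc 0))" a b c d] by simp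
  then show "\<phi> (vertex (word a b c d) 4) = (a + c) * \<phi> g1 + (b + d) * \<phi> g2"
    by (simp add: numeral_eq_Suc hom pow algebra_simps del: vertex.simps)
qed

text \<open>Choose \<open>c\<close> much shorter than the \<open>b i\<close>, the \<open>b i\<close> well separated, and \<open>a\<close>, \<open>d\<close> much longer than
  the \<open>b i\<close>. In a copy of the \<open>i\<close>-th word along a track, the shortest block \<open>c\<close> can only match a block
  \<open>c\<close>; the block before it has to match \<open>b i\<close>, but it is \<open>b j\<close> in the forward direction and \<open>d\<close> in the
  backward direction.\<close>

lemma separated_words:
  assumes e: "0 \<le> e"
  shows "\<exists>f. (\<forall>i\<le>Suc n. long_word (f i) \<and> (\<forall>l. f i (4 + l) = f i l) \<and> T \<le> nm (vertex (f i) 4)) \<and>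
    (\<forall>i\<le>Suc n. \<forall>j\<le>Suc n. \<forall>k::nat.
      (i \<noteq> j \<longrightarrow> copy_free e v (pt (vertex (f j) 4 [^] k)) (vertex (f i) 4)) \<and>
      copy_free e (pt (vertex (f j) 4 [^] k)) v (vertex (f i) 4)) \<and>
    (\<exists>a b c d. f = (\<lambda>i. word a (b i) c d) \<and> inj_on b {..Suc n} \<and> 0 < a)"
proof -
  obtain N where N: "0 \<le> N" "\<forall>w x y m q u ee g. long_word w \<and> track (8 * turn) x y m q u ee \<and> g \<in> carrier G \<and>
    dist x (pt g) + nm (vertex w 4) + dist (\<Phi> g (pt (vertex w 4))) y \<le> dist x y + e \<and>
    (\<forall>l<4. N \<le> nm (gen l [^] w l)) \<longrightarrow>
    (\<exists>l1 l2. l1 < l2 \<and> l2 < m \<and> nm (u l2 [^] ee l2) \<le> nm (g1 [^] w 2) + N \<and>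
      nm (u (l2 - 1) [^] ee (l2 - 1)) \<le> nm (g2 [^] w 1) + N \<and>
      (if l1 = l2 - 1 then nm (g2 [^] w 1) \<le> nm (u (l2 - 1) [^] ee (l2 - 1)) + N
        else nm (u (l2 - 2) [^] ee (l2 - 2)) \<le> nm (g2 [^] w 1) + N))"
    using copy_in_track[OF e] by blast
  \<comment> \<open>A margin of \<open>S\<close> settles all comparisons at once: it exceeds the
    matching error \<open>N\<close> and the threshold of \<open>long_word\<close>, and it absorbs
    the loss \<open>4 * turn\<close> in the bound by \<open>T\<close>.\<close>
  define S where "S = N + 2 * A + 3 * \<delta> + 4 * turn + \<bar>T\<bar> + 1"
  have S: "N < S" "2 * A + 3 * \<delta> < S" "T + 4 * turn \<le> S" "0 < S"
    using N(1) A_nonneg \<delta>_nonneg turn_nonneg(1) by (auto simp: S_def)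
  have ex1: "\<exists>n. r \<le> nm (g1 [^] (n::nat))" and ex2: "\<exists>n. r \<le> nm (g2 [^] (n::nat))" for r
    using long_letter_pow[of r] by (auto simp: letters_def)
  obtain c where c: "S \<le> nm (g1 [^] (c::nat))" using ex1 by blast
  have "\<exists>b. \<forall>k. nm (g1 [^] c) + S \<le> nm (g2 [^] (b k :: nat)) \<and> nm (g2 [^] b k) + S \<le> nm (g2 [^] b (Suc k))"
  proof (rule dependent_nat_choice)
    show "\<exists>x. nm (g1 [^] c) + S \<le> nm (g2 [^] (x::nat))" by (rule ex2)
    fix x :: nat and k :: nat
    assume "nm (g1 [^] c) + S \<le> nm (g2 [^] x)"
    moreover obtain y :: nat where "nm (g2 [^] x) + S \<le> nm (g2 [^] y)" using ex2 by blast
    ultimately show "\<exists>y. nm (g1 [^] c) + S \<le> nm (g2 [^] (y::nat)) \<and> nm (g2 [^] x) + S \<le> nm (g2 [^] y)"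
      using S(4) by (intro exI[of _ y]) auto
  qed
  then obtain b :: "nat \<Rightarrow> nat" where b: "\<And>k. nm (g1 [^] c) + S \<le> nm (g2 [^] b k)" "\<And>k. nm (g2 [^] b k) + S \<le> nm (g2 [^] b (Suc k))"
    by blast
  have b_less: "nm (g2 [^] b i) + S \<le> nm (g2 [^] b j)" if "i < j" for i j
    using that
  proof (induction rule: strict_inc_induct)
    case (base i)
    then show ?case using b(2)[of i] by simp
  next
    case (step i)
    then show ?case using b(2)[of i] S(4) by linarith
  qed
  \<comment> \<open>\<open>M\<close> exceeds the length of every block \<open>b i\<close>, including
    those of the spare words, by at least \<open>S\<close>; \<open>a\<close> and \<open>d\<close>
    are taken beyond it.\<close>
  define M where "M = nm (g2 [^] b (Suc n)) + S"
  have b_le: "nm (g2 [^] b i) + S \<le> M" if "i \<le> Suc n" for i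
    using b_less[of i "Suc n"] that S(4) by (cases "i = Suc n") (auto simp: M_def)
  obtain a where a: "M \<le> nm (g1 [^] (a::nat))" using ex1 by blast
  obtain d where d: "M \<le> nm (g2 [^] (d::nat))" using ex2 by blast
  define f where "f = (\<lambda>i. word a (b i) c d)"
  have blocks: "S \<le> nm (gen l [^] f i l)" if "i \<le> Suc n" for i l
    using mod_4_cases[of l] word_block[of l a "b i" c d] a d c b(1)[of i] b_le[OF that] displ_nonneg[of v "g1 [^] c"] S(4)
    unfolding f_def by (elim disjE) auto
  have C_less: "nm (g1 [^] c) + N < M" using b(1)[of 0] b_le[of 0] S by simp
  have long: "long_word (f i)" if "i \<le> Suc n" for i
    using blocks[OF that] S(2) unfolding long_word_def by (meson less_le_trans)
  have per: "f i (4 + l) = f i l" for i l by (simp add: f_def word_period)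
  have T_le: "T \<le> nm (vertex (f i) 4)" if i: "i \<le> Suc n" for i
  proof -
    have "nm (gen 0 [^] f i 0) \<le> nm (vertex (f i) 4) + 4 * turn"
      using vertex_aligned[OF long[OF i], of 0 1 4] block_length[of "f i" 0]
        zero_le_dist[of "pt (vertex (f i) (Suc 0))" "pt (vertex (f i) 4)"]
      by (simp add: displ_def[symmetric] del: vertex.simps(2) zero_le_dist)
    then show ?thesis using blocks[OF i, of 0] S(3) by simp
  qed
  have w12: "f i 1 = b i" "f i 2 = c" for i by (simp_all add: f_def word_def)
  have copy: "\<exists>l1 l2. l1 < l2 \<and> l2 < m \<and> nm (u l2 [^] ee l2) \<le> nm (g1 [^] c) + N \<and>
      nm (u (l2 - 1) [^] ee (l2 - 1)) \<le> nm (g2 [^] b i) + N \<and>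
      (if l1 = l2 - 1 then nm (g2 [^] b i) \<le> nm (u (l2 - 1) [^] ee (l2 - 1)) + N
        else nm (u (l2 - 2) [^] ee (l2 - 2)) \<le> nm (g2 [^] b i) + N)"
    if "i \<le> Suc n" "track (8 * turn) x y m q u ee" "g \<in> carrier G"
      "dist x (pt g) + nm (vertex (f i) 4) + dist (\<Phi> g (pt (vertex (f i) 4))) y \<le> dist x y + e"
    for i x y m q u ee g
  proof -
    have "\<forall>l<4. N \<le> nm (gen l [^] f i l)" using blocks[OF that(1)] S(1) by (meson less_imp_le order_trans)
    then show ?thesis
      using N(2)[rule_format, of "f i" x y m q u ee g] long[OF that(1)] that(2-4) unfolding w12 by blast
  qed
  have forward: "\<not> dist v (pt g) + nm (vertex (f i) 4) + dist (\<Phi> g (pt (vertex (f i) 4))) (pt (vertex (f j) 4 [^] k))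
      \<le> dist v (pt (vertex (f j) 4 [^] k)) + e"
    if ij: "i \<le> Suc n" "j \<le> Suc n" "i \<noteq> j" and g: "g \<in> carrier G" for i j g and k :: nat
  proof
    assume *: "dist v (pt g) + nm (vertex (f i) 4) + dist (\<Phi> g (pt (vertex (f i) 4))) (pt (vertex (f j) 4 [^] k))
      \<le> dist v (pt (vertex (f j) 4 [^] k)) + e"
    have "track (8 * turn) v (pt (vertex (f j) 4 [^] k)) (4 * k) (vertex (f j)) gen (f j)"
      using track_forward[OF long[OF ij(2)], of "4 * k"] unfolding vertex_periodic[of "f j", OF per] .
    from copy[OF ij(1) this g *] obtain l1 l2 where l: "l1 < l2" "nm (gen l2 [^] f j l2) \<le> nm (g1 [^] c) + N"
      "nm (gen (l2 - 1) [^] f j (l2 - 1)) \<le> nm (g2 [^] b i) + N"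
      "if l1 = l2 - 1 then nm (g2 [^] b i) \<le> nm (gen (l2 - 1) [^] f j (l2 - 1)) + N
        else nm (gen (l2 - 2) [^] f j (l2 - 2)) \<le> nm (g2 [^] b i) + N" by blast
    have "l2 mod 4 = 2"
      using mod_4_cases[of l2] word_block[of l2 a "b j" c d] a d C_less b(1)[of j] S(1) l(2)
      unfolding f_def by (elim disjE) auto
    then have "l2 = 4 * (l2 div 4) + 2" using mult_div_mod_eq[of 4 l2] by simp
    then obtain r where "l2 = 4 * r + 2" ..
    then have mods: "(l2 - 1) mod 4 = 1" "(l2 - 2) mod 4 = 0" by simp_all
    have block1: "gen (l2 - 1) [^] f j (l2 - 1) = g2 [^] b j" "gen (l2 - 2) [^] f j (l2 - 2) = g1 [^] a"
      unfolding f_def by (rule word_block(2)[OF mods(1)], rule word_block(1)[OF mods(2)])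
    show False
    proof (cases "l1 = l2 - 1")
      case True
      then have "nm (g2 [^] b i) \<le> nm (g2 [^] b j) + N" using l(4) unfolding block1 by simp
      moreover have "nm (g2 [^] b j) \<le> nm (g2 [^] b i) + N" using l(3) unfolding block1 .
      ultimately show False using b_less[of i j] b_less[of j i] ij(3) S(1) by (cases i j rule: linorder_cases) auto
    next
      case False
      then have "nm (g1 [^] a) \<le> nm (g2 [^] b i) + N" using l(4) unfolding block1 by simp
      then show False using a b_le[OF ij(1)] S(1) by linarith
    qed
  qed
  have backward: "\<not> dist (pt (vertex (f j) 4 [^] k)) (pt g) + nm (vertex (f i) 4) + dist (\<Phi> g (pt (vertex (f i) 4))) v
      \<le> dist (pt (vertex (f j) 4 [^] k)) v + e"
    if ij: "i \<le> Suc n" "j \<le> Suc n" and g: "g \<in> carrier G" for i j g and k :: nat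
  proof
    assume *: "dist (pt (vertex (f j) 4 [^] k)) (pt g) + nm (vertex (f i) 4) + dist (\<Phi> g (pt (vertex (f i) 4))) v
      \<le> dist (pt (vertex (f j) 4 [^] k)) v + e"
    have "track (8 * turn) (pt (vertex (f j) 4 [^] k)) v (4 * k) (\<lambda>l. vertex (f j) (4 * k - l))
        (\<lambda>l. inv (gen (4 * k - Suc l))) (\<lambda>l. f j (4 * k - Suc l))"
      using track_backward[OF long[OF ij(2)], of "4 * k"] unfolding vertex_periodic[of "f j", OF per] .
    from copy[OF ij(1) this g *] obtain l1 l2 where l: "l1 < l2" "l2 < 4 * k"
      "nm (inv (gen (4 * k - Suc l2)) [^] f j (4 * k - Suc l2)) \<le> nm (g1 [^] c) + N"
      "nm (inv (gen (4 * k - Suc (l2 - 1))) [^] f j (4 * k - Suc (l2 - 1))) \<le> nm (g2 [^] b i) + N" by blast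
    \<comment> \<open>Read backwards, block \<open>l2\<close> of the track is block \<open>r\<close>
      of the word, so the block before it on the track is the next one in the word,
      \<open>Suc r\<close>.\<close>
    define r where "r = 4 * k - Suc l2"
    have r: "nm (gen r [^] f j r) \<le> nm (g1 [^] c) + N" using l(3) by (simp add: r_def)
    have "4 * k - Suc (l2 - 1) = Suc r" using l(1,2) by (simp add: r_def)
    then have r': "nm (gen (Suc r) [^] f j (Suc r)) \<le> nm (g2 [^] b i) + N" using l(4) by simp
    have "r mod 4 = 2"
      using mod_4_cases[of r] word_block[of r a "b j" c d] a d C_less b(1)[of j] S(1) r
      unfolding f_def by (elim disjE) auto
    then have "Suc r mod 4 = 3" by (simp add: mod_Suc)
    then have "gen (Suc r) [^] f j (Suc r) = g2 [^] d" unfolding f_def by (rule word_block(4))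
    then show False using r' d b_le[OF ij(1)] S(1) by simp
  qed
  have "inj_on b {..Suc n}"
  proof (rule inj_onI)
    fix i j assume "b i = b j"
    then show "i = j" using b_less[of i j] b_less[of j i] S(4) by (cases i j rule: linorder_cases) auto
  qed
  moreover have "0 < a"
  proof (rule ccontr)
    assume "\<not> 0 < a"
    then have "nm (g1 [^] a) = 0" by simp
    then show False using a b(1)[of "Suc n"] c S(4) displ_nonneg[of v "g1 [^] c"] unfolding M_def by linarith
  qed
  ultimately show ?thesis
    using long per T_le forward backward unfolding copy_free_def
    by (intro exI[of _ f] conjI ballI allI impI) (auto simp: not_le f_def[symmetric] intro!: exI[of _ b] f_def)
qed

text \<open>The homomorphism \<phi> stays bounded on the powers of both spare words, so it vanishes
  on these words. They differ only in the exponent \<open>b\<close>, hence \<phi> kills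
  \<open>g2\<close>, and then \<open>g1\<close> because \<open>0 < a\<close>. So \<phi> drops out on
  every \<open>f i\<close>, whose powers isolate the coefficient \<open>s i\<close>.\<close>

lemma independent_brooks:
  "\<exists>h :: nat \<Rightarrow> 'g \<Rightarrow> real. (\<forall>i. \<exists>C. \<forall>x\<in>carrier G. \<forall>y\<in>carrier G. \<bar>h i (x \<otimes> y) - h i x - h i y\<bar> \<le> C) \<and>
    (\<forall>s \<beta> \<phi> C. (\<forall>g\<in>carrier G. (\<Sum>i<n. s i * h i g) = \<beta> g + \<phi> g \<and> \<bar>\<beta> g\<bar> \<le> C) \<and>
      (\<forall>x\<in>carrier G. \<forall>y\<in>carrier G. \<phi> (x \<otimes> y) = \<phi> x + \<phi> y) \<longrightarrow> (\<forall>i<n. s i = 0))"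
proof -
  \<comment> \<open>One period loses at most \<open>2 * turn\<close> of length and saves
    \<open>W\<close> by a jump, so \<open>h i\<close> decreases by at least 1 per period of
    \<open>f i\<close>.\<close>
  define W where "W = 2 * turn + 1"
  have W: "1 \<le> W" using turn_nonneg by (simp add: W_def)
  obtain e where e: "0 \<le> e" "\<And>p q x y. admissible W p q \<Longrightarrow> mdist W p q x y \<noteq> dist x y \<Longrightarrow>
    \<exists>g\<in>carrier G. dist x (\<Phi> g p) + dist p q + dist (\<Phi> g q) y \<le> dist x y + e"
    using mdist_less_dist[OF W] by blast
  obtain w a b c d where w_all: "\<forall>i\<le>Suc n. long_word (w i) \<and> (\<forall>l. w i (4 + l) = w i l) \<and> 2 * W + 1 \<le> nm (vertex (w i) 4)"
    and free: "\<forall>i\<le>Suc n. \<forall>j\<le>Suc n. \<forall>k::nat.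
      (i \<noteq> j \<longrightarrow> copy_free e v (pt (vertex (w j) 4 [^] k)) (vertex (w i) 4)) \<and>
      copy_free e (pt (vertex (w j) 4 [^] k)) v (vertex (w i) 4)"
    and abcd: "w = (\<lambda>i. word a (b i) c d)" "inj_on b {..Suc n}" "0 < a"
    using separated_words[OF e(1), of n "2 * W + 1"] by (elim exE conjE) (rule that)
  have w: "long_word (w i)" "w i (4 + l) = w i l" "2 * W + 1 \<le> nm (vertex (w i) 4)" if "i \<le> Suc n" for i l
    using w_all that by auto
  define f where "f = (\<lambda>i. vertex (w i) 4)"
  have f [simp]: "f i \<in> carrier G" for i by (simp add: f_def)
  have adm: "admissible W v (pt (f i))" if "i \<le> Suc n" for i
    using w(3)[OF that] W by (simp add: admissible_def f_def displ_def)
  \<comment> \<open>Indices \<open>n\<close> and \<open>Suc n\<close> belong to the spare words;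
    beyond them 0 is a harmless quasi-homomorphism.\<close>
  define h where "h = (\<lambda>i. if i \<le> Suc n then brooks W v (pt (f i)) v else (\<lambda>_. 0))"
  have quasi: "\<exists>C. \<forall>x\<in>carrier G. \<forall>y\<in>carrier G. \<bar>h i (x \<otimes> y) - h i x - h i y\<bar> \<le> C" for i
    using brooks_quasi_hom[OF adm, of i v] by (auto simp: h_def)
  have free_dist: "mdist W v (pt (f i)) x y = dist x y" if i: "i \<le> Suc n" and "copy_free e x y (f i)" for i x y
  proof (rule ccontr)
    assume "\<not> ?thesis"
    then obtain g where "g \<in> carrier G" "dist x (pt g) + nm (f i) + dist (\<Phi> g (pt (f i))) y \<le> dist x y + e"
      using e(2)[OF adm[OF i]] unfolding displ_def by blast
    then show False using \<open>copy_free e x y (f i)\<close> unfolding copy_free_def by (meson not_le)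
  qed
  have bwd: "mdist W v (pt (f i)) (pt (f j [^] k)) v = dist (pt (f j [^] k)) v"
    if "i \<le> Suc n" "j \<le> Suc n" for i j and k :: nat
    using free that by (intro free_dist) (auto simp: f_def)
  have fwd: "mdist W v (pt (f i)) v (pt (f j [^] k)) = dist v (pt (f j [^] k))"
    if "i \<le> Suc n" "j \<le> Suc n" "i \<noteq> j" for i j and k :: nat
    using free that by (intro free_dist) (auto simp: f_def)
  have off_diag: "h i (f j [^] k) = 0" if "i \<le> Suc n" "j \<le> Suc n" "i \<noteq> j" for i j and k :: nat
    using bwd[OF that(1,2)] fwd[OF that] that by (simp add: h_def brooks_def dist_commute)
  have diag: "h i (f i [^] k) \<le> - real k" if i: "i \<le> Suc n" for i and k :: nat
  proof -
    have "k * (nm (f i) - 2 * turn) \<le> dist (pt (f i [^] k)) v"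
      using displ_period_ge[OF w(1,2)[OF i], of k] by (simp add: f_def displ_def dist_commute)
    moreover have "mdist W v (pt (f i)) v (pt (f i [^] k)) \<le> k * (nm (f i) - W)"
      by (rule mdist_period_le[OF adm[OF i] f])
    ultimately show ?thesis using i bwd[OF i i, of k] by (simp add: h_def brooks_def W_def algebra_simps)
  qed
  have "s i = 0"
    if sum: "\<And>g. g \<in> carrier G \<Longrightarrow> (\<Sum>i<n. s i * h i g) = \<beta> g + \<phi> g" and \<beta>: "\<And>g. g \<in> carrier G \<Longrightarrow> \<bar>\<beta> g\<bar> \<le> C"
      and hom: "\<And>x y. x \<in> carrier G \<Longrightarrow> y \<in> carrier G \<Longrightarrow> \<phi> (x \<otimes> y) = \<phi> x + \<phi> y" and i: "i < n"
    for s \<beta> \<phi> C i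
  proof -
    have sum_f: "(\<Sum>i<n. s i * h i (f j [^] k)) = (if j < n then s j * h j (f j [^] k) else 0)" if "j \<le> Suc n" for j and k :: nat
    proof -
      have "(\<Sum>i<n. s i * h i (f j [^] k)) = (\<Sum>i<n. if i = j then s j * h j (f j [^] k) else 0)"
        using off_diag that by (intro sum.cong) auto
      then show ?thesis by simp
    qed
    have \<phi>_pow: "\<phi> (f j [^] k) = k * \<phi> (f j)" for j and k :: nat by (rule hom_word(1)[OF hom f])
    have zero: "\<phi> (f j) = 0" if j: "j \<in> {n, Suc n}" for j
    proof -
      have "\<bar>real k * \<phi> (f j)\<bar> \<le> C" for k :: nat
        using sum[of "f j [^] k"] \<beta>[of "f j [^] k"] sum_f[of j k] j \<phi>_pow[of j k] by auto
      then have "real k * \<phi> (f j) \<le> C" "real k * (- \<phi> (f j)) \<le> C" for k :: nat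
        by (simp_all add: abs_le_iff)
      then have "\<phi> (f j) \<le> 0" "- \<phi> (f j) \<le> 0" using nat_multiples_bounded by blast+
      then show ?thesis by simp
    qed
    have \<phi>_f: "\<phi> (f j) = (a + c) * \<phi> g1 + (b j + d) * \<phi> g2" for j
      using hom_word(2)[OF hom, of a "b j" c d] by (simp add: f_def abcd(1))
    have "real (a + c) * \<phi> g1 + real d * \<phi> g2 + \<phi> g2 * real (b j) = 0" if "j \<in> {n, Suc n}" for j
      using zero[OF that] \<phi>_f[of j] by (simp add: algebra_simps)
    from this[OF insertI1] this[OF insertI2[OF singletonI]] have "\<phi> g2 * real (b n) = \<phi> g2 * real (b (Suc n))" by linarith
    moreover have "b n \<noteq> b (Suc n)" using inj_onD[OF abcd(2), of n "Suc n"] by auto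
    ultimately have "\<phi> g2 = 0" by simp
    then have "\<phi> (f i) = 0" using zero[of n] \<phi>_f[of n] \<phi>_f[of i] abcd(3) by simp
    then have bound: "\<bar>s i * h i (f i [^] k)\<bar> \<le> C" for k :: nat
      using sum[of "f i [^] k"] \<beta>[of "f i [^] k"] sum_f[of i k] i \<phi>_pow[of i k] by simp
    have "real k * \<bar>s i\<bar> \<le> C" for k :: nat
    proof -
      have "real k * \<bar>s i\<bar> \<le> \<bar>h i (f i [^] k)\<bar> * \<bar>s i\<bar>"
        using diag[of i k] i by (intro mult_right_mono) auto
      then show ?thesis using bound[of k] by (simp add: abs_mult mult.commute)
    qed
    then have "\<bar>s i\<bar> \<le> 0" by (rule nat_multiples_bounded)
    then show ?thesis by simp
  qed
  then have "\<forall>s \<beta> \<phi> C. (\<forall>g\<in>carrier G. (\<Sum>i<n. s i * h i g) = \<beta> g + \<phi> g \<and> \<bar>\<beta> g\<bar> \<le> C) \<and>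
      (\<forall>x\<in>carrier G. \<forall>y\<in>carrier G. \<phi> (x \<otimes> y) = \<phi> x + \<phi> y) \<longrightarrow> (\<forall>i<n. s i = 0)"
    by blast
  then show ?thesis using quasi by blast
qed

end

section \<open>Dimension of the quotient space\<close>

lemma homogeneous_system_nontrivial:
  fixes c :: "'i \<Rightarrow> 'x \<Rightarrow> real"
  assumes "finite A" "finite I" "card A < card I"
  shows "\<exists>s. (\<exists>i\<in>I. s i \<noteq> 0) \<and> (\<forall>x\<in>A. (\<Sum>i\<in>I. s i * c i x) = 0)"
  using assms
proof (induction A arbitrary: I c rule: finite_induct)
  case empty
  then have "I \<noteq> {}" by auto
  then show ?case by (intro exI[of _ "\<lambda>_. 1"]) auto
next
  case (insert a A)
  show ?case
  proof (cases "\<forall>i\<in>I. c i a = 0")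
    case True
    obtain s where "\<exists>i\<in>I. s i \<noteq> 0" "\<forall>x\<in>A. (\<Sum>i\<in>I. s i * c i x) = 0"
      using insert.IH[OF insert.prems(1), of c] insert.prems insert.hyps by auto
    then show ?thesis using True by (intro exI[of _ s]) auto
  next
    case False
    then obtain j where j: "j \<in> I" "c j a \<noteq> 0" by blast
    \<comment> \<open>The coefficients that remain after equation \<open>a\<close> has been solved
      for the unknown \<open>s j\<close>, as in Gaussian elimination.\<close>
    define c' where "c' = (\<lambda>i x. c i x - c i a / c j a * c j x)"
    have "card A < card (I - {j})" using insert.prems insert.hyps j by simp
    then obtain s where s: "\<exists>i\<in>I - {j}. s i \<noteq> 0" "\<forall>x\<in>A. (\<Sum>i\<in>I - {j}. s i * c' i x) = 0"
      using insert.IH[of "I - {j}" c'] insert.prems(1) by blast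
    define t where "t = s(j := - (\<Sum>i\<in>I - {j}. s i * c i a) / c j a)"
    have t: "(\<Sum>i\<in>I. t i * c i x) = (\<Sum>i\<in>I - {j}. s i * c' i x)" for x
    proof -
      have "(\<Sum>i\<in>I. t i * c i x) = t j * c j x + (\<Sum>i\<in>I - {j}. s i * c i x)"
        using j insert.prems(1) by (simp add: sum.remove t_def)
      also have "t j * c j x = - (\<Sum>i\<in>I - {j}. s i * (c i a / c j a * c j x))"
        by (simp add: t_def sum_distrib_right sum_divide_distrib mult.assoc)
      finally show ?thesis by (simp add: c'_def algebra_simps sum_subtractf)
    qed
    have "(\<Sum>i\<in>I - {j}. s i * c' i a) = 0" using j by (simp add: c'_def)
    then have "\<forall>x\<in>insert a A. (\<Sum>i\<in>I. t i * c i x) = 0" using s(2) t by simp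
    moreover have "\<exists>i\<in>I. t i \<noteq> 0" using s(1) by (auto simp: t_def)
    ultimately show ?thesis by blast
  qed
qed

context group
begin

abbreviation (input) trivial_homs :: "('a \<Rightarrow> real) set"
  where "trivial_homs \<equiv> bounded_functions G <+>\<^bsub>quasi_hom_space G\<^esub> real_homs G"

lemma trivial_homsE:
  assumes "f \<in> trivial_homs"
  obtains \<beta> \<phi> C where "\<And>x. x \<in> carrier G \<Longrightarrow> f x = \<beta> x + \<phi> x" "\<And>x. x \<in> carrier G \<Longrightarrow> \<bar>\<beta> x\<bar> \<le> C"
    "\<And>x y. x \<in> carrier G \<Longrightarrow> y \<in> carrier G \<Longrightarrow> \<phi> (x \<otimes> y) = \<phi> x + \<phi> y"
proof -
  obtain \<beta> \<phi> where "\<beta> \<in> bounded_functions G" "\<phi> \<in> real_homs G" "f = (\<lambda>x\<in>carrier G. \<beta> x + \<phi> x)"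
    using assms by (auto simp: set_add_def set_mult_def quasi_hom_space_def)
  then show ?thesis using that[of \<beta> \<phi>] by (auto simp: bounded_functions_def real_homs_def)
qed

text \<open>Moves a linear combination in the quotient to representatives, which can be evaluated at
  group elements.\<close>

lemma QH_finsum:
  assumes "finite A" and r: "\<And>a. a \<in> A \<Longrightarrow> r a \<in> carrier (quasi_hom_space G) \<and> a = trivial_homs +>\<^bsub>quasi_hom_space G\<^esub> r a"
  shows "(\<Oplus>\<^bsub>QH G\<^esub>a\<in>A. c a \<odot>\<^bsub>QH G\<^esub> a) = trivial_homs +>\<^bsub>quasi_hom_space G\<^esub> (\<lambda>x\<in>carrier G. \<Sum>a\<in>A. c a * r a x)
    \<and> (\<lambda>x\<in>carrier G. \<Sum>a\<in>A. c a * r a x) \<in> carrier (quasi_hom_space G)"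
  using assms
proof -
  let ?V = "quasi_hom_space G" and ?W = trivial_homs
  interpret V: module real_ring ?V by (rule quasi_hom_space_module)
  interpret Q: module real_ring "QH G" by (rule QH_module)
  interpret W: abelian_subgroup ?W ?V
    using abelian_subgroupI2[OF V.a_comm_group] QH_submodule submodule.axioms(1) by blast
  have car: "carrier (QH G) = (\<lambda>x. ?W +>\<^bsub>?V\<^esub> x) ` carrier ?V"
    by (auto simp: QH_def quotient_module_def A_RCOSETS_def RCOSETS_def a_r_coset_def)
  have R: "s \<in> carrier real_ring" for s by (simp add: real_ring_def)
  have smult: "s \<odot>\<^bsub>QH G\<^esub> (?W +>\<^bsub>?V\<^esub> x) = ?W +>\<^bsub>?V\<^esub> (s \<odot>\<^bsub>?V\<^esub> x)" if x: "x \<in> carrier ?V" for s x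
  proof -
    have "s \<odot>\<^bsub>QH G\<^esub> (?W +>\<^bsub>?V\<^esub> x) \<in> carrier (QH G)"
      using x R by (intro Q.smult_closed) (auto simp: car)
    then obtain y where y: "y \<in> carrier ?V" "s \<odot>\<^bsub>QH G\<^esub> (?W +>\<^bsub>?V\<^esub> x) = ?W +>\<^bsub>?V\<^esub> y" by (auto simp: car)
    \<comment> \<open>Scalar multiplication in the quotient is defined as a union of cosets. Since
      the result is already known to be a single coset, one common element identifies it.\<close>
    have "?W +>\<^bsub>?V\<^esub> (s \<odot>\<^bsub>?V\<^esub> x) \<subseteq> s \<odot>\<^bsub>QH G\<^esub> (?W +>\<^bsub>?V\<^esub> x)"
      using W.a_rcos_self[OF x] by (auto simp: QH_def quotient_module_def)
    then have "s \<odot>\<^bsub>?V\<^esub> x \<in> ?W +>\<^bsub>?V\<^esub> y"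
      using W.a_rcos_self[OF V.smult_closed[OF R x]] y by auto
    then show ?thesis
      using V.add.repr_independence[OF _ _ W.a_subgroup, of "s \<odot>\<^bsub>?V\<^esub> x" y] y
      by (simp add: a_r_coset_def)
  qed
  have add: "(?W +>\<^bsub>?V\<^esub> x) \<oplus>\<^bsub>QH G\<^esub> (?W +>\<^bsub>?V\<^esub> y) = ?W +>\<^bsub>?V\<^esub> (x \<oplus>\<^bsub>?V\<^esub> y)"
    if "x \<in> carrier ?V" "y \<in> carrier ?V" for x y
    using W.a_rcos_sum[OF that] by (simp add: QH_def quotient_module_def)
  have zero: "\<zero>\<^bsub>QH G\<^esub> = ?W +>\<^bsub>?V\<^esub> \<zero>\<^bsub>?V\<^esub>"
    using V.add.coset_mult_one[OF W.a_subset] by (simp add: QH_def quotient_module_def a_r_coset_def)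
  show ?thesis
    using assms
  proof (induction A rule: finite_induct)
    case empty
    have "\<zero>\<^bsub>?V\<^esub> = (\<lambda>x\<in>carrier G. 0)" by (simp add: quasi_hom_space_def)
    then show ?case using zero V.zero_closed by (simp only: Q.finsum_empty sum.empty)
  next
    case (insert a A)
    let ?S = "\<lambda>x\<in>carrier G. \<Sum>a\<in>A. c a * r a x"
    have IH: "(\<Oplus>\<^bsub>QH G\<^esub>a\<in>A. c a \<odot>\<^bsub>QH G\<^esub> a) = ?W +>\<^bsub>?V\<^esub> ?S" "?S \<in> carrier ?V"
      using insert.IH[OF insert.prems[OF insertI2]] by blast+
    have ra: "r a \<in> carrier ?V" "a = ?W +>\<^bsub>?V\<^esub> r a" using insert.prems[of a] by auto
    have cl: "c b \<odot>\<^bsub>QH G\<^esub> b \<in> carrier (QH G)" if "b \<in> insert a A" for b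
      using insert.prems[OF that] R by (intro Q.smult_closed) (auto simp: car)
    have step: "(\<lambda>x\<in>carrier G. \<Sum>a\<in>insert a A. c a * r a x) = (c a \<odot>\<^bsub>?V\<^esub> r a) \<oplus>\<^bsub>?V\<^esub> ?S"
      using insert.hyps by (auto simp: quasi_hom_space_def fun_eq_iff)
    have "(\<Oplus>\<^bsub>QH G\<^esub>a\<in>insert a A. c a \<odot>\<^bsub>QH G\<^esub> a) = c a \<odot>\<^bsub>QH G\<^esub> a \<oplus>\<^bsub>QH G\<^esub> (\<Oplus>\<^bsub>QH G\<^esub>a\<in>A. c a \<odot>\<^bsub>QH G\<^esub> a)"
      using insert.hyps cl by (intro Q.finsum_insert) auto
    also have "c a \<odot>\<^bsub>QH G\<^esub> a = ?W +>\<^bsub>?V\<^esub> (c a \<odot>\<^bsub>?V\<^esub> r a)"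
      using smult[OF ra(1), of "c a"] ra(2) by simp
    finally have "(\<Oplus>\<^bsub>QH G\<^esub>a\<in>insert a A. c a \<odot>\<^bsub>QH G\<^esub> a) = ?W +>\<^bsub>?V\<^esub> ((c a \<odot>\<^bsub>?V\<^esub> r a) \<oplus>\<^bsub>?V\<^esub> ?S)"
      using add[OF V.smult_closed[OF R ra(1)] IH(2)] IH(1) by simp
    moreover have "(c a \<odot>\<^bsub>?V\<^esub> r a) \<oplus>\<^bsub>?V\<^esub> ?S \<in> carrier ?V"
      using V.smult_closed[OF R ra(1)] IH(2) by simp
    ultimately show ?case unfolding step by blast
  qed
qed

text \<open>With more functions than spanning elements, some nontrivial combination of the
  \<open>h i\<close> has vanishing coordinates. It is then a bounded function plus a homomorphism,
  against the hypothesis.\<close>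

lemma QH_infinite_dimensional:
  assumes indep: "\<And>n. \<exists>h :: nat \<Rightarrow> 'a \<Rightarrow> real.
    (\<forall>i. \<exists>C. \<forall>x\<in>carrier G. \<forall>y\<in>carrier G. \<bar>h i (x \<otimes> y) - h i x - h i y\<bar> \<le> C) \<and>
    (\<forall>s \<beta> \<phi> C. (\<forall>g\<in>carrier G. (\<Sum>i<n. s i * h i g) = \<beta> g + \<phi> g \<and> \<bar>\<beta> g\<bar> \<le> C) \<and>
      (\<forall>x\<in>carrier G. \<forall>y\<in>carrier G. \<phi> (x \<otimes> y) = \<phi> x + \<phi> y) \<longrightarrow> (\<forall>i<n. s i = 0))"
  shows "\<not> finite_dimensional real_ring (QH G)"
proof
  let ?V = "quasi_hom_space G" and ?W = trivial_homs
  interpret V: module real_ring ?V by (rule quasi_hom_space_module)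
  interpret W: abelian_subgroup ?W ?V
    using abelian_subgroupI2[OF V.a_comm_group] QH_submodule submodule.axioms(1) by blast
  have car: "carrier (QH G) = (\<lambda>x. ?W +>\<^bsub>?V\<^esub> x) ` carrier ?V"
    by (auto simp: QH_def quotient_module_def A_RCOSETS_def RCOSETS_def a_r_coset_def)
  assume "finite_dimensional real_ring (QH G)"
  then obtain A where A: "finite A" "A \<subseteq> carrier (QH G)"
    and span: "\<And>x. x \<in> carrier (QH G) \<Longrightarrow> \<exists>c\<in>A \<rightarrow> carrier real_ring. x = (\<Oplus>\<^bsub>QH G\<^esub>a\<in>A. c a \<odot>\<^bsub>QH G\<^esub> a)"
    unfolding finite_dimensional_def by blast
  define n where "n = Suc (card A)"
  obtain h :: "nat \<Rightarrow> 'a \<Rightarrow> real" where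
    h: "\<And>i. \<exists>C. \<forall>x\<in>carrier G. \<forall>y\<in>carrier G. \<bar>h i (x \<otimes> y) - h i x - h i y\<bar> \<le> C" and
    free: "\<forall>s \<beta> \<phi> C. (\<forall>g\<in>carrier G. (\<Sum>i<n. s i * h i g) = \<beta> g + \<phi> g \<and> \<bar>\<beta> g\<bar> \<le> C) \<and>
      (\<forall>x\<in>carrier G. \<forall>y\<in>carrier G. \<phi> (x \<otimes> y) = \<phi> x + \<phi> y) \<longrightarrow> (\<forall>i<n. s i = 0)"
    using indep[of n] by blast
  define r where "r = (\<lambda>a. SOME x. x \<in> carrier ?V \<and> a = ?W +>\<^bsub>?V\<^esub> x)"
  have r: "r a \<in> carrier ?V \<and> a = ?W +>\<^bsub>?V\<^esub> r a" if "a \<in> A" for a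
  proof -
    have "\<exists>x. x \<in> carrier ?V \<and> a = ?W +>\<^bsub>?V\<^esub> x" using that A(2) car by auto
    then show ?thesis unfolding r_def by (rule someI_ex)
  qed
  define k where "k = (\<lambda>i. restrict (h i) (carrier G))"
  have k: "k i \<in> carrier ?V" for i
    using h[of i] by (auto simp: k_def quasi_hom_space_def quasi_homs_def)
  have "\<exists>c w. w \<in> ?W \<and> (\<forall>g\<in>carrier G. h i g = w g + (\<Sum>a\<in>A. c a * r a g))" for i
  proof -
    have "?W +>\<^bsub>?V\<^esub> k i \<in> carrier (QH G)" using k by (auto simp: car)
    then obtain c where "?W +>\<^bsub>?V\<^esub> k i = (\<Oplus>\<^bsub>QH G\<^esub>a\<in>A. c a \<odot>\<^bsub>QH G\<^esub> a)" using span by blast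
    then have "?W +>\<^bsub>?V\<^esub> k i = ?W +>\<^bsub>?V\<^esub> (\<lambda>x\<in>carrier G. \<Sum>a\<in>A. c a * r a x)"
      using QH_finsum[OF A(1) r, of c] by simp
    then have "k i \<in> ?W +>\<^bsub>?V\<^esub> (\<lambda>x\<in>carrier G. \<Sum>a\<in>A. c a * r a x)" using W.a_rcos_self[OF k, of i] by simp
    then obtain w where w: "w \<in> ?W" "k i = w \<oplus>\<^bsub>?V\<^esub> (\<lambda>x\<in>carrier G. \<Sum>a\<in>A. c a * r a x)"
      unfolding a_r_coset_def' by blast
    have "h i g = w g + (\<Sum>a\<in>A. c a * r a g)" if "g \<in> carrier G" for g
      using fun_cong[OF w(2), of g] that by (simp add: k_def quasi_hom_space_def)
    then show ?thesis using w(1) by blast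
  qed
  then obtain c w where w: "\<And>i. w i \<in> ?W" and hw: "\<And>i g. g \<in> carrier G \<Longrightarrow> h i g = w i g + (\<Sum>a\<in>A. c i a * r a g)"
    by metis
  have "\<exists>\<beta> \<phi> C. (\<forall>x\<in>carrier G. w i x = \<beta> x + \<phi> x) \<and> (\<forall>x\<in>carrier G. \<bar>\<beta> x\<bar> \<le> C) \<and>
      (\<forall>x\<in>carrier G. \<forall>y\<in>carrier G. \<phi> (x \<otimes> y) = \<phi> x + (\<phi> y :: real))" for i
    by (rule trivial_homsE[OF w[of i]]) blast
  then obtain \<beta> \<phi> C where wi: "\<And>i x. x \<in> carrier G \<Longrightarrow> w i x = \<beta> i x + \<phi> i x"
    and \<beta>: "\<And>i x. x \<in> carrier G \<Longrightarrow> \<bar>\<beta> i x\<bar> \<le> C i"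
    and \<phi>: "\<And>i x y. x \<in> carrier G \<Longrightarrow> y \<in> carrier G \<Longrightarrow> \<phi> i (x \<otimes> y) = \<phi> i x + (\<phi> i y :: real)"
    by metis
  have "\<exists>s. (\<exists>i\<in>{..<n}. s i \<noteq> 0) \<and> (\<forall>a\<in>A. (\<Sum>i\<in>{..<n}. s i * c i a) = 0)"
    by (rule homogeneous_system_nontrivial[OF A(1)]) (simp_all add: n_def)
  then obtain s where s: "\<exists>i<n. s i \<noteq> 0" "\<And>a. a \<in> A \<Longrightarrow> (\<Sum>i<n. s i * c i a) = 0" by auto
  have decomp: "(\<Sum>i<n. s i * h i g) = (\<Sum>i<n. s i * \<beta> i g) + (\<Sum>i<n. s i * \<phi> i g)" if "g \<in> carrier G" for g
  proof -
    have "(\<Sum>i<n. s i * (\<Sum>a\<in>A. c i a * r a g)) = (\<Sum>a\<in>A. (\<Sum>i<n. s i * c i a) * r a g)"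
      unfolding sum_distrib_left sum_distrib_right by (subst sum.swap) (simp add: mult.assoc)
    also have "\<dots> = 0" using s(2) by simp
    finally have "(\<Sum>i<n. s i * (\<Sum>a\<in>A. c i a * r a g)) = 0" .
    then show ?thesis using that by (simp add: hw wi distrib_left sum.distrib)
  qed
  have bounded: "\<bar>\<Sum>i<n. s i * \<beta> i g\<bar> \<le> (\<Sum>i<n. \<bar>s i\<bar> * C i)" if "g \<in> carrier G" for g
  proof -
    have "\<bar>\<Sum>i<n. s i * \<beta> i g\<bar> \<le> (\<Sum>i<n. \<bar>s i * \<beta> i g\<bar>)" by (rule sum_abs)
    also have "\<dots> \<le> (\<Sum>i<n. \<bar>s i\<bar> * C i)"
      using \<beta>[OF that] by (intro sum_mono) (simp add: abs_mult mult_left_mono)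
    finally show ?thesis .
  qed
  have hom: "(\<Sum>i<n. s i * \<phi> i (x \<otimes> y)) = (\<Sum>i<n. s i * \<phi> i x) + (\<Sum>i<n. s i * \<phi> i y)"
    if "x \<in> carrier G" "y \<in> carrier G" for x y
    using that by (simp add: \<phi> distrib_left sum.distrib)
  have "\<forall>i<n. s i = 0"
  proof (rule free[THEN spec, THEN spec, THEN spec, THEN spec, THEN mp])
    show "(\<forall>g\<in>carrier G. (\<Sum>i<n. s i * h i g) = (\<Sum>i<n. s i * \<beta> i g) + (\<Sum>i<n. s i * \<phi> i g) \<and>
        \<bar>\<Sum>i<n. s i * \<beta> i g\<bar> \<le> (\<Sum>i<n. \<bar>s i\<bar> * C i)) \<and>
      (\<forall>x\<in>carrier G. \<forall>y\<in>carrier G. (\<Sum>i<n. s i * \<phi> i (x \<otimes> y)) = (\<Sum>i<n. s i * \<phi> i x) + (\<Sum>i<n. s i * \<phi> i y))"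
      using decomp bounded hom by simp
  qed
  then show False using s(1) by blast
qed

end

section \<open>Quasi-axes\<close>

lemma quasi_geodesic_reverse:
  assumes "quasi_geodesic K L UNIV l"
  shows "quasi_geodesic K L UNIV (\<lambda>t. l (- t))"
proof -
  have "\<bar>- s - - t\<bar> = \<bar>s - t\<bar>" for s t :: real by simp
  moreover have "1 / K * \<bar>- s - - t\<bar> - L \<le> dist (l (- s)) (l (- t)) \<and> dist (l (- s)) (l (- t)) \<le> K * \<bar>- s - - t\<bar> + L" for s t
    using assms unfolding quasi_geodesic_def by blast
  ultimately show ?thesis using assms unfolding quasi_geodesic_def by simp
qed

lemma oriented_quasi_axis_exists:
  assumes "quasi_axis K L f l"
  shows "\<exists>l'. oriented_quasi_axis K L f l'"
proof -
  obtain \<tau> where l: "quasi_geodesic K L UNIV l" "\<tau> \<noteq> 0" "\<And>t. f (l t) = l (t + \<tau>)"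
    using assms unfolding quasi_axis_def by blast
  show ?thesis
  proof (cases "0 < \<tau>")
    case True
    then show ?thesis using l unfolding oriented_quasi_axis_def by blast
  next
    case False
    have "quasi_geodesic K L UNIV (\<lambda>t. l (- t))"
      using l(1) by (rule quasi_geodesic_reverse)
    moreover have "f (l (- t)) = l (- (t + - \<tau>))" for t using l(3)[of "- t"] by simp
    moreover have "0 < - \<tau>" using False l(2) by simp
    ultimately show ?thesis unfolding oriented_quasi_axis_def by (intro exI[of _ "\<lambda>t. l (- t)"]) blast
  qed
qed

lemma oriented_quasi_axisD: "oriented_quasi_axis K L f l \<Longrightarrow> quasi_axis K L f l"
  unfolding oriented_quasi_axis_def quasi_axis_def by (metis less_irrefl)

lemma nbhd_mono: "r \<le> r' \<Longrightarrow> nbhd r S \<subseteq> nbhd r' S"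
  by (auto simp: nbhd_def intro: order_trans)

lemma stability_constant_mono:
  "stability_constant X K L B \<Longrightarrow> B \<le> B' \<Longrightarrow> stability_constant X K L B'"
  unfolding stability_constant_def within_distance_def using nbhd_mono by (meson order_trans)

context hyperbolic_action
begin

lemma axis_pow:
  fixes l :: "real \<Rightarrow> 'a" and \<tau> :: real
  assumes "u \<in> carrier G" "\<And>t. \<Phi> u (l t) = l (t + \<tau>)"
  shows "\<Phi> (u [^] (n::nat)) (l t) = l (t + n * \<tau>)"
proof (induction n arbitrary: t)
  case (Suc n)
  then show ?case using assms by (simp add: act_mult algebra_simps)
qed simp

lemma axis_displ:
  fixes l :: "real \<Rightarrow> 'a" and \<tau> :: real
  assumes "u \<in> carrier G" "\<And>t. \<Phi> u (l t) = l (t + \<tau>)"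
  shows "\<bar>displ v (u [^] (n::nat)) - dist (l 0) (l (n * \<tau>))\<bar> \<le> 2 * dist v (l 0)"
proof -
  have "dist (\<Phi> (u [^] n) v) (l (n * \<tau>)) = dist v (l 0)"
    using axis_pow[of u l \<tau> n 0, OF assms] act_dist[of "u [^] n" v "l 0"] assms(1) by simp
  moreover have "\<bar>dist v (\<Phi> (u [^] n) v) - dist (l 0) (l (n * \<tau>))\<bar> \<le> dist v (l 0) + dist (\<Phi> (u [^] n) v) (l (n * \<tau>))"
    using dist_triangle[of v "\<Phi> (u [^] n) v" "l 0"] dist_triangle[of "l 0" "\<Phi> (u [^] n) v" "l (n * \<tau>)"]
      dist_triangle[of "l 0" "l (n * \<tau>)" v] dist_triangle[of v "l (n * \<tau>)" "\<Phi> (u [^] n) v"]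
    by (simp add: dist_commute abs_le_iff)
  ultimately show ?thesis unfolding displ_def by simp
qed

lemma axis_growth:
  assumes u: "u \<in> carrier G" and l: "oriented_quasi_axis K L (\<Phi> u) l"
  shows "\<exists>n0. \<forall>n\<ge>n0. T \<le> displ v (u [^] (n::nat))"
proof -
  obtain \<tau> where \<tau>: "0 < \<tau>" "\<And>t. \<Phi> u (l t) = l (t + \<tau>)" and qg: "quasi_geodesic K L UNIV l"
    using l unfolding oriented_quasi_axis_def by blast
  have K: "1 \<le> K" by (rule quasi_geodesic_bounds(1)[OF qg])
  define S where "S = T + 2 * dist v (l 0) + L"
  obtain n0 :: nat where n0: "K * S < n0 * \<tau>" using reals_Archimedean3[OF \<tau>(1)] by blast
  have "T \<le> displ v (u [^] n)" if "n0 \<le> n" for n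
  proof -
    have "K * S \<le> n * \<tau>" using n0 that \<tau>(1) by (smt (verit) mult_right_mono of_nat_mono)
    also have "\<dots> \<le> K * (dist (l 0) (l (n * \<tau>)) + L)"
      using quasi_geodesic_bounds(3)[OF qg, of 0 "n * \<tau>"] \<tau>(1) by simp
    finally have "S \<le> dist (l 0) (l (n * \<tau>)) + L" using K by simp
    then show ?thesis using axis_displ[of u l \<tau> v n, OF u \<tau>(2)] unfolding S_def by linarith
  qed
  then show ?thesis by blast
qed

text \<open>The orbit of \<open>v\<close> stays at bounded distance from the axis, where the point
  at time \<open>m * \<tau>\<close> has bounded Gromov product with respect to the times
  \<open>0\<close> and \<open>(m + n) * \<tau>\<close>.\<close>

lemma axis_superadditive:
  assumes u: "u \<in> carrier G" and l: "oriented_quasi_axis K L (\<Phi> u) l"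
  shows "\<exists>A. \<forall>m n. displ v (u [^] (m::nat)) + displ v (u [^] (n::nat)) \<le> displ v (u [^] (m + n)) + 2 * A"
proof -
  obtain \<tau> where \<tau>: "0 < \<tau>" "\<And>t. \<Phi> u (l t) = l (t + \<tau>)" and qg: "quasi_geodesic K L UNIV l"
    using l unfolding oriented_quasi_axis_def by blast
  obtain M where M: "0 \<le> M" "\<And>(\<phi>::real \<Rightarrow> 'a) a b t. quasi_geodesic K L {a..b} \<phi> \<Longrightarrow> t \<in> {a..b} \<Longrightarrow>
      gp (\<phi> t) (\<phi> a) (\<phi> b) \<le> M"
    using quasi_geodesic_gp[OF quasi_geodesic_bounds(1,2)[OF qg]] by blast
  have "displ v (u [^] m) + displ v (u [^] n) \<le> displ v (u [^] (m + n)) + 2 * (M + 3 * dist v (l 0))" for m n :: nat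
  proof -
    have "gp (l (m * \<tau>)) (l 0) (l ((m + n) * \<tau>)) \<le> M"
      using M(2)[OF quasi_geodesic_subset[OF qg], of 0 "(m + n) * \<tau>" "m * \<tau>"] \<tau>(1)
      by (simp add: is_interval_cc distrib_right)
    moreover have "dist (l (m * \<tau>)) (l ((m + n) * \<tau>)) = dist (l 0) (l (n * \<tau>))"
      using act_dist[of "u [^] m" "l 0" "l (n * \<tau>)"] axis_pow[of u l \<tau> m, OF u \<tau>(2)] u by (simp add: algebra_simps)
    ultimately have "dist (l 0) (l (m * \<tau>)) + dist (l 0) (l (n * \<tau>)) \<le> dist (l 0) (l ((m + n) * \<tau>)) + 2 * M"
      unfolding gp_def by (simp add: dist_commute field_simps)
    then show ?thesis
      using axis_displ[of u l \<tau> v m, OF u \<tau>(2)] axis_displ[of u l \<tau> v n, OF u \<tau>(2)] axis_displ[of u l \<tau> v "m + n", OF u \<tau>(2)]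
      by (simp add: abs_le_iff)
  qed
  then show ?thesis by blast
qed

text \<open>The displacement of \<open>u1 [^] m \<otimes> u2 [^] n\<close> is the distance between
  the images of \<open>v\<close> under \<open>inv (u1 [^] m)\<close> and \<open>u2 [^] n\<close>.
  These follow the negative ray of \<open>l1\<close> and the positive ray of \<open>l2\<close>, and
  unbounded products at \<open>v\<close> would put the two rays within finite distance.\<close>

lemma axes_transverse:
  assumes u1: "u1 \<in> carrier G" and l1: "oriented_quasi_axis K1 L1 (\<Phi> u1) l1"
    and u2: "u2 \<in> carrier G" and l2: "oriented_quasi_axis K2 L2 (\<Phi> u2) l2"
    and apart: "\<not> (\<exists>C. within_distance C (l1 ` {..0}) (l2 ` {0..}))"
  shows "\<exists>A. \<forall>m n. displ v (u1 [^] (m::nat)) + displ v (u2 [^] (n::nat)) \<le> displ v (u1 [^] m \<otimes> u2 [^] n) + 2 * A"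
proof -
  obtain \<tau>1 where \<tau>1: "0 < \<tau>1" "\<And>t. \<Phi> u1 (l1 t) = l1 (t + \<tau>1)" and qg1: "quasi_geodesic K1 L1 UNIV l1"
    using l1 unfolding oriented_quasi_axis_def by blast
  obtain \<tau>2 where \<tau>2: "0 < \<tau>2" "\<And>t. \<Phi> u2 (l2 t) = l2 (t + \<tau>2)" and qg2: "quasi_geodesic K2 L2 UNIV l2"
    using l2 unfolding oriented_quasi_axis_def by blast
  define \<rho> where "\<rho> = (\<lambda>t. l1 (- t))"
  have q\<rho>: "quasi_geodesic K1 L1 {0..} \<rho>"
    using quasi_geodesic_subset[OF quasi_geodesic_reverse[OF qg1], of "{0..}"] by (simp add: \<rho>_def is_interval_ci)
  have q\<sigma>: "quasi_geodesic K2 L2 {0..} l2"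
    using quasi_geodesic_subset[OF qg2, of "{0..}"] by (simp add: is_interval_ci)
  have \<rho>_image: "\<rho> ` {0..} = l1 ` {..0}"
  proof -
    have "uminus ` {0..} = {..0::real}" by (auto simp: image_iff intro: bexI[of _ "- x" for x])
    then show ?thesis unfolding \<rho>_def by (metis image_image)
  qed
  have "\<exists>T. \<forall>a\<ge>0. \<forall>b\<ge>0. gp v (\<rho> a) (l2 b) < T"
  proof (rule ccontr)
    assume "\<not> ?thesis"
    then have unb: "\<exists>a\<ge>0. \<exists>b\<ge>0. T \<le> gp v (\<rho> a) (l2 b)" for T by (meson not_le)
    then have unb': "\<exists>a\<ge>0. \<exists>b\<ge>0. T \<le> gp v (l2 a) (\<rho> b)" for T by (metis gp_commute)
    obtain C1 where C1: "\<rho> ` {0..} \<subseteq> nbhd C1 (l2 ` {0..})" using ray_in_nbhd[OF q\<rho> q\<sigma> unb] by blast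
    obtain C2 where C2: "l2 ` {0..} \<subseteq> nbhd C2 (\<rho> ` {0..})" using ray_in_nbhd[OF q\<sigma> q\<rho> unb'] by blast
    have "within_distance (max C1 C2) (\<rho> ` {0..}) (l2 ` {0..})"
      unfolding within_distance_def
      by (meson C1 C2 nbhd_mono max.cobounded1 max.cobounded2 order_trans)
    then show False using apart unfolding \<rho>_image by blast
  qed
  then obtain T where T: "\<And>a b. 0 \<le> a \<Longrightarrow> 0 \<le> b \<Longrightarrow> gp v (\<rho> a) (l2 b) < T" by blast
  have "displ v (u1 [^] m) + displ v (u2 [^] n) \<le> displ v (u1 [^] m \<otimes> u2 [^] n) + 2 * (T + dist v (l1 0) + dist v (l2 0))" for m n :: nat
  proof -
    note [simp] = u1 u2
    have "\<Phi> (u1 [^] m) (\<rho> (m * \<tau>1)) = l1 0"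
      using axis_pow[of u1 l1 \<tau>1 m "- (m * \<tau>1)", OF u1 \<tau>1(2)] by (simp add: \<rho>_def)
    then have "\<Phi> (inv (u1 [^] m)) (l1 0) = \<rho> (m * \<tau>1)" using act_inv(1)[of "u1 [^] m" "\<rho> (m * \<tau>1)"] by simp
    then have 1: "dist (\<Phi> (inv (u1 [^] m)) v) (\<rho> (m * \<tau>1)) = dist v (l1 0)"
      using act_dist[of "inv (u1 [^] m)" v "l1 0"] by simp
    have "\<Phi> (u2 [^] n) (l2 0) = l2 (n * \<tau>2)" using axis_pow[of u2 l2 \<tau>2 n 0, OF u2 \<tau>2(2)] by simp
    then have 2: "dist (\<Phi> (u2 [^] n) v) (l2 (n * \<tau>2)) = dist v (l2 0)"
      using act_dist[of "u2 [^] n" v "l2 0"] by simp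
    have "gp v (\<Phi> (inv (u1 [^] m)) v) (\<Phi> (u2 [^] n) v) \<le> T + dist v (l1 0) + dist v (l2 0)"
      using gp_move_ends[of v "\<Phi> (inv (u1 [^] m)) v" "\<Phi> (u2 [^] n) v" "\<rho> (m * \<tau>1)" "l2 (n * \<tau>2)"]
        T[of "m * \<tau>1" "n * \<tau>2"] \<tau>1(1) \<tau>2(1) 1 2 by simp
    moreover have "dist v (\<Phi> (inv (u1 [^] m)) v) = displ v (u1 [^] m)" by (simp add: displ_def[symmetric])
    moreover have "dist (\<Phi> (inv (u1 [^] m)) v) (\<Phi> (u2 [^] n) v) = displ v (u1 [^] m \<otimes> u2 [^] n)"
      by (simp add: displ_def act_mult dist_act_move[of "u1 [^] m"])
    ultimately show ?thesis unfolding gp_def displ_def by (simp add: field_simps)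
  qed
  then show ?thesis by blast
qed

text \<open>Otherwise arbitrarily long orbit segments would be close at both ends. By stability the
  axes are then close in between, with one constant \<open>B\<close> for all lengths as
  \<open>axis_equivalent\<close> demands.\<close>

lemma inequivalent_orbits:
  assumes u1: "u1 \<in> carrier G" and l1: "oriented_quasi_axis K L (\<Phi> u1) l1"
    and u2: "u2 \<in> carrier G" and l2: "oriented_quasi_axis K L (\<Phi> u2) l2"
    and ineq: "\<not> axis_equivalent G \<Phi> K L u1 u2"
  shows "\<exists>N. \<forall>g\<in>carrier G. \<forall>n\<ge>N. \<forall>m.
      \<not> (displ v g \<le> R \<and> dist (\<Phi> g (\<Phi> (u1 [^] (n::nat)) v)) (\<Phi> (u2 [^] (m::nat)) v) \<le> R)"
proof (rule ccontr)
  assume neg: "\<not> ?thesis"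
  obtain \<tau>1 where \<tau>1: "0 < \<tau>1" "\<And>t. \<Phi> u1 (l1 t) = l1 (t + \<tau>1)" and qg1: "quasi_geodesic K L UNIV l1"
    using l1 unfolding oriented_quasi_axis_def by blast
  obtain \<tau>2 where \<tau>2: "0 < \<tau>2" "\<And>t. \<Phi> u2 (l2 t) = l2 (t + \<tau>2)" and qg2: "quasi_geodesic K L UNIV l2"
    using l2 unfolding oriented_quasi_axis_def by blast
  note KL = quasi_geodesic_bounds(1,2)[OF qg1]
  obtain M where M: "0 \<le> M" "\<And>(\<phi>::real \<Rightarrow> 'a) a b t. quasi_geodesic K L {a..b} \<phi> \<Longrightarrow> t \<in> {a..b} \<Longrightarrow>
      gp (\<phi> t) (\<phi> a) (\<phi> b) \<le> M"
    using quasi_geodesic_gp[OF KL] by blast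
  obtain R0 where R0: "0 \<le> R0" "\<And>(\<phi>::real \<Rightarrow> 'a) a b w c. quasi_geodesic K L {a..b} \<phi> \<Longrightarrow> a \<le> b \<Longrightarrow>
      gp w (\<phi> a) (\<phi> b) \<le> c \<Longrightarrow> \<exists>t\<in>{a..b}. dist w (\<phi> t) \<le> R0 + c"
    using quasi_geodesic_near_segment[OF KL] by blast
  obtain B0 where B0: "stability_constant TYPE('a) K L B0" using stability_constant_exists[OF KL] by blast
  define D where "D = dist v (l1 0) + R + dist v (l2 0)"
  \<comment> \<open>\<open>D\<close> covers the endpoints, \<open>R0 + (M + 2 * D)\<close> the
    points in between, and \<open>B0\<close> makes \<open>B\<close> a stability constant.\<close>
  define B where "B = max B0 (max D (R0 + (M + 2 * D)))"
  have B: "stability_constant TYPE('a) K L B" by (rule stability_constant_mono[OF B0]) (simp add: B_def)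
  have "\<exists>l1 l2 a b. \<exists>g\<in>carrier G. oriented_quasi_axis K L (\<Phi> u1) l1 \<and> oriented_quasi_axis K L (\<Phi> u2) l2 \<and>
        a < b \<and> N \<le> b - a \<and> \<Phi> g ` l1 ` {a..b} \<subseteq> nbhd B (range l2) \<and> positively_oriented_along B (\<Phi> g \<circ> l1) a b l2" for N
  proof -
    \<comment> \<open>Beyond \<open>n1\<close> the displacement exceeds \<open>2 * R\<close>, which
      excludes \<open>m = 0\<close>; then \<open>0\<close> and \<open>m * \<tau>2\<close> are
      parameters on \<open>l2\<close> that witness the orientation.\<close>
    obtain n1 :: nat where n1: "\<And>n. n1 \<le> n \<Longrightarrow> 2 * R + 1 \<le> displ v (u1 [^] n)" using axis_growth[OF u1 l1] by blast
    obtain n2 :: nat where n2: "N < n2 * \<tau>1" using reals_Archimedean3[OF \<tau>1(1)] by blast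
    have "\<exists>g\<in>carrier G. \<exists>n\<ge>max n1 (max n2 1). \<exists>m.
        displ v g \<le> R \<and> dist (\<Phi> g (\<Phi> (u1 [^] (n::nat)) v)) (\<Phi> (u2 [^] (m::nat)) v) \<le> R"
    proof (rule ccontr)
      assume "\<not> ?thesis"
      then have "\<forall>g\<in>carrier G. \<forall>n\<ge>max n1 (max n2 1). \<forall>m.
          \<not> (displ v g \<le> R \<and> dist (\<Phi> g (\<Phi> (u1 [^] (n::nat)) v)) (\<Phi> (u2 [^] (m::nat)) v) \<le> R)"
        by blast
      then show False by (rule notE[OF neg, OF exI])
    qed
    then obtain g and n m :: nat where g: "g \<in> carrier G" and n: "max n1 (max n2 1) \<le> n" and close: "displ v g \<le> R"
      "dist (\<Phi> g (\<Phi> (u1 [^] n) v)) (\<Phi> (u2 [^] m) v) \<le> R"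
      by (elim bexE exE conjE) (rule that)
    note [simp] = g u1 u2
    have m: "0 < m"
    proof (rule ccontr)
      assume "\<not> 0 < m"
      then have "dist (\<Phi> g (\<Phi> (u1 [^] n) v)) v \<le> R" using close(2) by simp
      then have "dist (\<Phi> g v) (\<Phi> g (\<Phi> (u1 [^] n) v)) \<le> 2 * R"
        using close(1) dist_triangle3[of "\<Phi> g v" "\<Phi> g (\<Phi> (u1 [^] n) v)" v] unfolding displ_def by (simp add: dist_commute)
      then show False using n1[of n] n by (simp add: displ_def)
    qed
    have start: "dist (\<Phi> g (l1 0)) (l2 0) \<le> D"
    proof -
      have "dist (\<Phi> g (l1 0)) (l2 0) \<le> dist (\<Phi> g v) (\<Phi> g (l1 0)) + dist v (\<Phi> g v) + dist v (l2 0)" by metric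
      then show ?thesis using close(1) by (simp add: D_def displ_def)
    qed
    have stop: "dist (\<Phi> g (l1 (n * \<tau>1))) (l2 (m * \<tau>2)) \<le> D"
    proof -
      have a: "\<Phi> (u1 [^] n) (l1 0) = l1 (n * \<tau>1)" using axis_pow[of u1 l1 \<tau>1 n 0, OF u1 \<tau>1(2)] by simp
      have b: "\<Phi> (u2 [^] m) (l2 0) = l2 (m * \<tau>2)" using axis_pow[of u2 l2 \<tau>2 m 0, OF u2 \<tau>2(2)] by simp
      have "dist (\<Phi> g (\<Phi> (u1 [^] n) v)) (\<Phi> g (l1 (n * \<tau>1))) = dist v (l1 0)"
        "dist (\<Phi> (u2 [^] m) v) (l2 (m * \<tau>2)) = dist v (l2 0)"
        unfolding a[symmetric] b[symmetric] by simp_all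
      then show ?thesis
        using close(2) dist_triangle3[of "\<Phi> g (l1 (n * \<tau>1))" "l2 (m * \<tau>2)" "\<Phi> g (\<Phi> (u1 [^] n) v)"]
          dist_triangle[of "\<Phi> g (\<Phi> (u1 [^] n) v)" "l2 (m * \<tau>2)" "\<Phi> (u2 [^] m) v"]
        unfolding D_def by linarith
    qed
    have near: "\<Phi> g (l1 t) \<in> nbhd B (range l2)" if t: "t \<in> {0..n * \<tau>1}" for t
    proof -
      have "gp (l1 t) (l1 0) (l1 (n * \<tau>1)) \<le> M"
        using M(2)[OF quasi_geodesic_subset[OF qg1] t] by (simp add: is_interval_cc)
      then have "gp (\<Phi> g (l1 t)) (\<Phi> g (l1 0)) (\<Phi> g (l1 (n * \<tau>1))) \<le> M" by (simp add: gp_def)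
      then have "gp (\<Phi> g (l1 t)) (l2 0) (l2 (m * \<tau>2)) \<le> M + 2 * D"
        using gp_move_ends[of "\<Phi> g (l1 t)" "l2 0" "l2 (m * \<tau>2)" "\<Phi> g (l1 0)" "\<Phi> g (l1 (n * \<tau>1))"] start stop
        by (simp add: dist_commute)
      then obtain s where "dist (\<Phi> g (l1 t)) (l2 s) \<le> R0 + (M + 2 * D)"
        using R0(2)[OF quasi_geodesic_subset[OF qg2], of 0 "m * \<tau>2"] \<tau>2(1) by (auto simp: is_interval_cc)
      then have "dist (l2 s) (\<Phi> g (l1 t)) \<le> B" unfolding B_def by (simp add: dist_commute)
      then show ?thesis by (auto simp: nbhd_def)
    qed
    have "n2 * \<tau>1 \<le> n * \<tau>1" using n \<tau>1(1) by simp
    then have "N \<le> n * \<tau>1 - 0" using n2 by simp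
    moreover have "0 < n * \<tau>1" using n \<tau>1(1) by simp
    moreover have "positively_oriented_along B (\<Phi> g \<circ> l1) 0 (n * \<tau>1) l2"
      unfolding positively_oriented_along_def
      using start stop m \<tau>2(1) by (intro exI[of _ 0] exI[of _ "m * \<tau>2"]) (auto simp: B_def dist_commute)
    moreover have "\<Phi> g ` l1 ` {0..n * \<tau>1} \<subseteq> nbhd B (range l2)" using near by blast
    ultimately show ?thesis using l1 l2 g by blast
  qed
  then show False using ineq B unfolding axis_equivalent_def by blast
qed

end

theorem theorem1:
  fixes G :: "('g, 'b) monoid_scheme"
    and \<Phi> :: "'g \<Rightarrow> 'a::metric_space \<Rightarrow> 'a"
    and V :: "'a set" and E :: "(real \<Rightarrow> 'a) set"
    and \<delta> K L :: real and g\<^sub>1 g\<^sub>2 :: 'g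
  assumes "connected_metric_graph V E"
    and "delta_hyperbolic TYPE('a) \<delta>"
    and "group G"
    and "isometric_action G \<Phi>"
    and "nonelementary_action G \<Phi>"
    and "g\<^sub>1 \<in> carrier G" and "g\<^sub>2 \<in> carrier G"
    and "independent_isometries (\<Phi> g\<^sub>1) (\<Phi> g\<^sub>2)"
    and "\<exists>l. quasi_axis K L (\<Phi> g\<^sub>1) l" and "\<exists>l. quasi_axis K L (\<Phi> g\<^sub>2) l"
    and "\<not> axis_equivalent G \<Phi> K L g\<^sub>1 g\<^sub>2"
  shows "\<not> finite_dimensional real_ring (QH G)"
proof -
  interpret group G by fact
  have geo: "\<exists>c. geodesic_curve c x y" for x y :: 'a
    by (rule connected_metric_graph_geodesic) fact
  interpret hyperbolic_space "TYPE('a)" "3 * \<delta> + 1"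
  proof
    fix x y :: 'a and t :: real assume t: "0 \<le> t" "t \<le> dist x y"
    obtain c where "geodesic_curve c x y" using geo by blast
    then show "\<exists>m. dist x m = t \<and> dist m y = dist x y - t" using geodesic_curve_on[OF _ t] by blast
  next
    fix w x y z :: 'a
    show "min (gp w x y) (gp w y z) \<le> gp w x z + (3 * \<delta> + 1)"
      using delta_hyperbolic_four_points[OF geo assms(2)] by (simp add: add.assoc)
  qed
  interpret action: group_action G UNIV \<Phi> using assms(4) unfolding isometric_action_def by blast
  interpret hyperbolic_action "TYPE('a)" "3 * \<delta> + 1" G \<Phi>
  proof
    show "dist (\<Phi> g x) (\<Phi> g y) = dist x y" if "g \<in> carrier G" for g x y
      using assms(4) that unfolding isometric_action_def by blast
    show "\<Phi> (g \<otimes>\<^bsub>G\<^esub> h) x = \<Phi> g (\<Phi> h x)" if "g \<in> carrier G" "h \<in> carrier G" for g h x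
      using action.composition_rule[of x g h] that by simp
    show "\<Phi> \<one>\<^bsub>G\<^esub> x = x" for x using action.id_eq_one by (metis UNIV_I restrict_apply')
  qed
  obtain l1 where l1: "oriented_quasi_axis K L (\<Phi> g\<^sub>1) l1" using assms(9) oriented_quasi_axis_exists by blast
  obtain l2 where l2: "oriented_quasi_axis K L (\<Phi> g\<^sub>2) l2" using assms(10) oriented_quasi_axis_exists by blast
  have axes: "quasi_axis K L (\<Phi> g\<^sub>1) l1" "quasi_axis K L (\<Phi> g\<^sub>2) l2"
    by (rule oriented_quasi_axisD[OF l1], rule oriented_quasi_axisD[OF l2])
  have apart: "\<not> within_distance C r s" if "r \<in> rays l1" "s \<in> rays l2" for C r s
    using assms(8) axes that unfolding independent_isometries_def by blast
  have apart12: "\<not> (\<exists>C. within_distance C (l1 ` {..0}) (l2 ` {0..}))"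
  proof -
    have "l1 ` {..0} \<in> rays l1" "l2 ` {0..} \<in> rays l2" unfolding rays_def by blast+
    then show ?thesis using apart by blast
  qed
  \<comment> \<open>Independence compares rays of \<open>l1\<close> with rays of \<open>l2\<close>
    in this order; \<open>within_distance\<close> is symmetric.\<close>
  have apart21: "\<not> (\<exists>C. within_distance C (l2 ` {..0}) (l1 ` {0..}))"
  proof -
    have "l1 ` {0..} \<in> rays l1" "l2 ` {..0} \<in> rays l2" unfolding rays_def by blast+
    then have "\<not> within_distance C (l1 ` {0..}) (l2 ` {..0})" for C using apart by blast
    then show ?thesis unfolding within_distance_def by blast
  qed
  define v where "v = l1 0"
  obtain A1 where A1: "\<And>m n. displ v (g\<^sub>1 [^]\<^bsub>G\<^esub> (m::nat)) + displ v (g\<^sub>1 [^]\<^bsub>G\<^esub> (n::nat)) \<le> displ v (g\<^sub>1 [^]\<^bsub>G\<^esub> (m + n)) + 2 * A1"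
    using axis_superadditive[OF assms(6) l1] by blast
  obtain A2 where A2: "\<And>m n. displ v (g\<^sub>2 [^]\<^bsub>G\<^esub> (m::nat)) + displ v (g\<^sub>2 [^]\<^bsub>G\<^esub> (n::nat)) \<le> displ v (g\<^sub>2 [^]\<^bsub>G\<^esub> (m + n)) + 2 * A2"
    using axis_superadditive[OF assms(7) l2] by blast
  obtain A3 where A3: "\<And>m n. displ v (g\<^sub>1 [^]\<^bsub>G\<^esub> (m::nat)) + displ v (g\<^sub>2 [^]\<^bsub>G\<^esub> (n::nat)) \<le>
      displ v (g\<^sub>1 [^]\<^bsub>G\<^esub> m \<otimes>\<^bsub>G\<^esub> g\<^sub>2 [^]\<^bsub>G\<^esub> n) + 2 * A3"
    using axes_transverse[OF assms(6) l1 assms(7) l2 apart12] by blast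
  obtain A4 where A4: "\<And>m n. displ v (g\<^sub>2 [^]\<^bsub>G\<^esub> (m::nat)) + displ v (g\<^sub>1 [^]\<^bsub>G\<^esub> (n::nat)) \<le>
      displ v (g\<^sub>2 [^]\<^bsub>G\<^esub> m \<otimes>\<^bsub>G\<^esub> g\<^sub>1 [^]\<^bsub>G\<^esub> n) + 2 * A4"
    using axes_transverse[OF assms(7) l2 assms(6) l1 apart21] by blast
  define A where "A = max (max A1 A2) (max A3 A4)"
  have A: "A1 \<le> A" "A2 \<le> A" "A3 \<le> A" "A4 \<le> A" by (auto simp: A_def)
  interpret inequivalent_pair "TYPE('a)" "3 * \<delta> + 1" G \<Phi> v g\<^sub>1 g\<^sub>2 A
  proof
    show "g\<^sub>1 \<in> carrier G" "g\<^sub>2 \<in> carrier G" by fact+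
    fix u :: 'g and T :: real and m n :: nat
    show "\<exists>n0. \<forall>n\<ge>n0. T \<le> displ v (u [^]\<^bsub>G\<^esub> (n::nat))" if "u \<in> {g\<^sub>1, g\<^sub>2}"
      using that axis_growth[OF assms(6) l1] axis_growth[OF assms(7) l2] by blast
    show "displ v (u [^]\<^bsub>G\<^esub> m) + displ v (u [^]\<^bsub>G\<^esub> n) \<le> displ v (u [^]\<^bsub>G\<^esub> (m + n)) + 2 * A" if "u \<in> {g\<^sub>1, g\<^sub>2}"
      using that A1[of m n] A2[of m n] A by auto
    show "displ v (g\<^sub>1 [^]\<^bsub>G\<^esub> m) + displ v (g\<^sub>2 [^]\<^bsub>G\<^esub> n) \<le> displ v (g\<^sub>1 [^]\<^bsub>G\<^esub> m \<otimes>\<^bsub>G\<^esub> g\<^sub>2 [^]\<^bsub>G\<^esub> n) + 2 * A"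
      using A3[of m n] A by linarith
    show "displ v (g\<^sub>2 [^]\<^bsub>G\<^esub> m) + displ v (g\<^sub>1 [^]\<^bsub>G\<^esub> n) \<le> displ v (g\<^sub>2 [^]\<^bsub>G\<^esub> m \<otimes>\<^bsub>G\<^esub> g\<^sub>1 [^]\<^bsub>G\<^esub> n) + 2 * A"
      using A4[of m n] A by linarith
  next
    show "\<exists>N. \<forall>g\<in>carrier G. \<forall>n\<ge>N. \<forall>m.
      \<not> (displ v g \<le> R \<and> dist (\<Phi> g (\<Phi> (g\<^sub>1 [^]\<^bsub>G\<^esub> (n::nat)) v)) (\<Phi> (g\<^sub>2 [^]\<^bsub>G\<^esub> (m::nat)) v) \<le> R)" for R
      by (rule inequivalent_orbits[OF assms(6) l1 assms(7) l2 assms(11)])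
  qed
  show ?thesis by (rule QH_infinite_dimensional) (rule independent_brooks)
qed

end
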